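(* Let $\Omega\subseteq\mathbb{R}^N$ be a bounded open set with Lipschitz boundary, and let $(p_n)$ be a sequence of measurable functions $p_n:\overline\Omega\to(1,+\infty)$ such that $p_n^-\to+\infty$ as $n\to\infty$ and there exists $\beta>1$ with $p_n^+\le\beta p_n^-$ for all $n$. Let $f:\Omega\times\mathbb{R}^d\times\mathbb{R}^{Nd}\to\mathbb{R}$ be a normal integrand such that (H1) for a.e. $x\in\Omega$ and every $u\in\mathbb{R}^d$, $f(x,u,\cdot)$ is level convex; and (H2) there exist $\alpha,\gamma>0$ with $f(x,u,\xi)\ge\alpha|\xi|^\gamma$ for a.e. $x\in\Omega$ and every $(u,\xi)\in\mathbb{R}^d\times\mathbb{R}^{Nd}$. Define $\mathcal{F}_n,\mathcal{F}:L^1(\Omega,\mathbb{R}^d)\to[0,+\infty]$ by $$\mathcal{F}_n(u):=\begin{cases}\displaystyle\int_\Omega\frac{1}{p_n(x)}f^{p_n(x)}(x,u(x),Du(x))\,dx&\text{if }u\in W^{1,p_n(\cdot)}(\Omega,\mathbb{R}^d),\\ +\infty&\text{otherwise,}\end{cases}$$ $$\mathcal{F}(u):=\begin{cases}0&\text{if }u\in W^{1,\infty}(\Omega,\mathbb{R}^d)\text{ and }\|f(\cdot,u(\cdot),Du(\cdot))\|_\infty\le1,\\ +\infty&\text{otherwise.}\end{cases}$$ Then: (i) for every $u\in L^1(\Omega,\mathbb{R}^d)$ and every $(u_n)\subset L^1(\Omega,\mathbb{R}^d)$ with $u_n\rightharpoonup u$ weakly in $L^1(\Omega,\mathbb{R}^d)$,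 $\mathcal{F}(u)\le\liminf_{n\to\infty}\mathcal{F}_n(u_n)$; (ii) for every $u\in L^1(\Omega,\mathbb{R}^d)$ there exists $(u_n)\subset L^1(\Omega,\mathbb{R}^d)$ with $u_n\to u$ strongly in $L^1(\Omega,\mathbb{R}^d)$ and $\limsup_{n\to\infty}\mathcal{F}_n(u_n)\le\mathcal{F}(u)$. In particular, $(\mathcal{F}_n)$ $\Gamma$-converges to $\mathcal{F}$ as $n\to\infty$ with respect to the strong $L^1$ convergence.
   Context: $p_n^-:=\operatorname{ess\,inf}_{\overline\Omega}p_n$, $p_n^+:=\operatorname{ess\,sup}_{\overline\Omega}p_n$. $W^{1,p(\cdot)}(\Omega,\mathbb{R}^d)$ is the set of $u:\Omega\to\mathbb{R}^d$ such that $|u|$ and $|\partial_i u|$ (weak derivatives) lie in $L^{p(\cdot)}(\Omega)=\{g\text{ measurable}:\int_\Omega|g|^{p(x)}dx<\infty\}$. A normal integrand is a $\mathcal{L}^N\otimes\mathcal{B}_d\otimes\mathcal{B}_{Nd}$-measurable function with $f(x,\cdot,\cdot)$ lower semicontinuous for a.e. $x$. $g$ is level convex if all sublevel sets $\{g\le t\}$ are convex. $\Gamma$-convergence in a metric space: for all $x$ and $x_n\to x$, $\varphi(x)\le\liminf\varphi_n(x_n)$, and for all $x$ there is $x_n\to x$ with $\varphi(x)=\lim\varphi_n(x_n)$. *)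

theory Defs
  imports "HOL-Analysis.Analysis" "HOL-Probability.Essential_Supremum"
begin

(* Lipschitz boundary: near every boundary point, \<Omega> is (in a rotated frame with
   unit normal e) the subgraph of a Lipschitz function over the hyperplane e\<^sup>\<bottom>. *)
definition lipschitz_boundary :: "(real^'n) set \<Rightarrow> bool" where
  "lipschitz_boundary \<Omega> \<longleftrightarrow>
     (\<forall>x\<in>frontier \<Omega>. \<exists>r>0. \<exists>e::real^'n. \<exists>g::real^'n \<Rightarrow> real. \<exists>L.
        norm e = 1 \<and> L-lipschitz_on UNIV g \<and>
        \<Omega> \<inter> ball x r = {y \<in> ball x r. y \<bullet> e < g (y - (y \<bullet> e) *\<^sub>R e)})"

definition partial :: "(real^'n \<Rightarrow> real) \<Rightarrow> 'n \<Rightarrow> real^'n \<Rightarrow> real" where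
  "partial \<phi> i x = frechet_derivative \<phi> (at x) (axis i 1)"

fun Ck :: "nat \<Rightarrow> (real^'n \<Rightarrow> real) \<Rightarrow> bool" where
  "Ck 0 \<phi> \<longleftrightarrow> continuous_on UNIV \<phi>"
| "Ck (Suc k) \<phi> \<longleftrightarrow> (\<forall>x. \<phi> differentiable (at x)) \<and> (\<forall>i. Ck k (partial \<phi> i))"

definition smooth_fun :: "(real^'n \<Rightarrow> real) \<Rightarrow> bool" where
  "smooth_fun \<phi> \<longleftrightarrow> (\<forall>k. Ck k \<phi>)"

definition test_function :: "(real^'n) set \<Rightarrow> (real^'n \<Rightarrow> real) \<Rightarrow> bool" where
  "test_function \<Omega> \<phi> \<longleftrightarrow> smooth_fun \<phi> \<and> compact (closure {x. \<phi> x \<noteq> 0})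
      \<and> closure {x. \<phi> x \<noteq> 0} \<subseteq> \<Omega>"

definition locally_integrable :: "(real^'n) set \<Rightarrow> (real^'n \<Rightarrow> real^'d) \<Rightarrow> bool" where
  "locally_integrable \<Omega> u \<longleftrightarrow> (\<forall>K. compact K \<and> K \<subseteq> \<Omega> \<longrightarrow> set_integrable lebesgue K u)"

definition weak_partial :: "(real^'n) set \<Rightarrow> (real^'n \<Rightarrow> real^'d) \<Rightarrow> 'n \<Rightarrow> (real^'n \<Rightarrow> real^'d) \<Rightarrow> bool" where
  "weak_partial \<Omega> u i g \<longleftrightarrow> locally_integrable \<Omega> u \<and> locally_integrable \<Omega> g \<and>
     (\<forall>\<phi>. test_function \<Omega> \<phi> \<longrightarrow>
        (LINT x:\<Omega>|lebesgue. partial \<phi> i x *\<^sub>R u x) = - (LINT x:\<Omega>|lebesgue. \<phi> x *\<^sub>R g x))"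

definition has_weak_partials :: "(real^'n) set \<Rightarrow> (real^'n \<Rightarrow> real^'d) \<Rightarrow> bool" where
  "has_weak_partials \<Omega> u \<longleftrightarrow> (\<forall>i. \<exists>g. weak_partial \<Omega> u i g)"

definition weak_grad :: "(real^'n) set \<Rightarrow> (real^'n \<Rightarrow> real^'d) \<Rightarrow> real^'n \<Rightarrow> real^'n^'d" where
  "weak_grad \<Omega> u = (\<lambda>x. \<chi> k i. (SOME g. weak_partial \<Omega> u i g) x $ k)"

definition in_Lp_var :: "(real^'n) set \<Rightarrow> (real^'n \<Rightarrow> real) \<Rightarrow> (real^'n \<Rightarrow> real) \<Rightarrow> bool" where
  "in_Lp_var \<Omega> p g \<longleftrightarrow> g \<in> borel_measurable (lebesgue_on \<Omega>) \<and>
     (\<integral>\<^sup>+ x\<in>\<Omega>. ennreal (\<bar>g x\<bar> powr p x) \<partial>lebesgue) < \<infinity>"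

definition in_Linf :: "(real^'n) set \<Rightarrow> (real^'n \<Rightarrow> real) \<Rightarrow> bool" where
  "in_Linf \<Omega> g \<longleftrightarrow> g \<in> borel_measurable (lebesgue_on \<Omega>) \<and>
     (\<exists>C. AE x in lebesgue_on \<Omega>. \<bar>g x\<bar> \<le> C)"

definition sobolev_var :: "(real^'n) set \<Rightarrow> (real^'n \<Rightarrow> real) \<Rightarrow> (real^'n \<Rightarrow> real^'d) \<Rightarrow> bool" where
  "sobolev_var \<Omega> p u \<longleftrightarrow> u \<in> borel_measurable (lebesgue_on \<Omega>) \<and>
     in_Lp_var \<Omega> p (\<lambda>x. norm (u x)) \<and>
     (\<forall>i. \<exists>g. weak_partial \<Omega> u i g \<and> g \<in> borel_measurable (lebesgue_on \<Omega>) \<and>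
              in_Lp_var \<Omega> p (\<lambda>x. norm (g x)))"

definition sobolev_inf :: "(real^'n) set \<Rightarrow> (real^'n \<Rightarrow> real^'d) \<Rightarrow> bool" where
  "sobolev_inf \<Omega> u \<longleftrightarrow> u \<in> borel_measurable (lebesgue_on \<Omega>) \<and>
     in_Linf \<Omega> (\<lambda>x. norm (u x)) \<and>
     (\<forall>i. \<exists>g. weak_partial \<Omega> u i g \<and> g \<in> borel_measurable (lebesgue_on \<Omega>) \<and>
              in_Linf \<Omega> (\<lambda>x. norm (g x)))"

definition in_L1 :: "(real^'n) set \<Rightarrow> (real^'n \<Rightarrow> real^'d) \<Rightarrow> bool" where
  "in_L1 \<Omega> u \<longleftrightarrow> set_integrable lebesgue \<Omega> u"

definition weak_L1_conv :: "(real^'n) set \<Rightarrow> (nat \<Rightarrow> real^'n \<Rightarrow> real^'d) \<Rightarrow> (real^'n \<Rightarrow> real^'d) \<Rightarrow> bool" where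
  "weak_L1_conv \<Omega> us u \<longleftrightarrow>
     (\<forall>g::real^'n \<Rightarrow> real^'d. g \<in> borel_measurable (lebesgue_on \<Omega>) \<and> in_Linf \<Omega> (\<lambda>x. norm (g x)) \<longrightarrow>
        (\<lambda>n. LINT x:\<Omega>|lebesgue. us n x \<bullet> g x) \<longlonglongrightarrow> (LINT x:\<Omega>|lebesgue. u x \<bullet> g x))"

definition strong_L1_conv :: "(real^'n) set \<Rightarrow> (nat \<Rightarrow> real^'n \<Rightarrow> real^'d) \<Rightarrow> (real^'n \<Rightarrow> real^'d) \<Rightarrow> bool" where
  "strong_L1_conv \<Omega> us u \<longleftrightarrow>
     (\<lambda>n. LINT x:\<Omega>|lebesgue. norm (us n x - u x)) \<longlonglongrightarrow> 0"

definition ess_sup_on :: "(real^'n) set \<Rightarrow> (real^'n \<Rightarrow> real) \<Rightarrow> ereal" where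
  "ess_sup_on S p = esssup (lebesgue_on S) (\<lambda>x. ereal (p x))"

definition ess_inf_on :: "(real^'n) set \<Rightarrow> (real^'n \<Rightarrow> real) \<Rightarrow> ereal" where
  "ess_inf_on S p = - esssup (lebesgue_on S) (\<lambda>x. - ereal (p x))"

definition normal_integrand :: "(real^'n) set \<Rightarrow> (real^'n \<Rightarrow> real^'d \<Rightarrow> real^'n^'d \<Rightarrow> real) \<Rightarrow> bool" where
  "normal_integrand \<Omega> f \<longleftrightarrow>
     (\<lambda>(x,u,\<xi>). f x u \<xi>) \<in> borel_measurable (lebesgue_on \<Omega> \<Otimes>\<^sub>M (borel \<Otimes>\<^sub>M borel)) \<and>
     (AE x in lebesgue_on \<Omega>. \<forall>t. closed {(u,\<xi>). f x u \<xi> \<le> t})"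

definition level_convex :: "('a::real_vector \<Rightarrow> real) \<Rightarrow> bool" where
  "level_convex g \<longleftrightarrow> (\<forall>t. convex {\<xi>. g \<xi> \<le> t})"

definition Fn :: "(real^'n) set \<Rightarrow> (real^'n \<Rightarrow> real^'d \<Rightarrow> real^'n^'d \<Rightarrow> real) \<Rightarrow>
                  (real^'n \<Rightarrow> real) \<Rightarrow> (real^'n \<Rightarrow> real^'d) \<Rightarrow> ennreal" where
  "Fn \<Omega> f p u = (if sobolev_var \<Omega> p u
      then (\<integral>\<^sup>+ x\<in>\<Omega>. ennreal ((1 / p x) * f x (u x) (weak_grad \<Omega> u x) powr p x) \<partial>lebesgue)
      else \<infinity>)"

definition Finf :: "(real^'n) set \<Rightarrow> (real^'n \<Rightarrow> real^'d \<Rightarrow> real^'n^'d \<Rightarrow> real) \<Rightarrow>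
                  (real^'n \<Rightarrow> real^'d) \<Rightarrow> ennreal" where
  "Finf \<Omega> f u = (if sobolev_inf \<Omega> u \<and>
        (AE x in lebesgue_on \<Omega>. \<bar>f x (u x) (weak_grad \<Omega> u x)\<bar> \<le> 1)
      then 0 else \<infinity>)"

end

(*
  Recovery sequences are constant, since (1/p) f^p <= 1/p_n^- -> 0 wherever 0 <= f <= 1.

  For the lower bound, bounded energies and t^s >= binom(floor s, m) (t - 1)^m for t >= 1 force
  max(f - 1, 0)^m -> 0 in L^1 for every m >= 2. By coercivity the gradients are bounded in L^2,
  and suitable convex combinations of the tails converge a.e. to the weak gradient of u.
  Poincare's inequality on small boxes upgrades weak L^1 convergence of u_n to convergence in
  measure, so a subsequence converges a.e. At almost every x, lower semicontinuity and
  coercivity push D u_n(x) towards the convex set {f(x, u(x), .) <= 1 + e}, hence it contains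
  the limit of the convex combinations. The resulting bound on Du, together with the Lipschitz
  boundary, gives u in L^infinity.

  The calculus of weak derivatives rests on one formula,
  u(x + v) - u(x) = sum_i v_i int_0^1 g_i(x + s v) ds for a.e. x.
*)
theory Submission
  imports Defs "HOL-Computational_Algebra.Polynomial"
begin

section \<open>Smooth product test functions\<close>

text \<open>Because f is only level convex, no convexity inequality for f can be integrated, and
  Mazur's lemma cannot be applied to f itself. This is why the weights of the convex combinations
  must not depend on x: the same weights enter the integral identity that defines the weak gradient
  and the gradients at a single point, where only convexity of a sublevel set is available. A bound
  on the energy controls f^p only up to a factor p. The binomial coefficient is of order s^m; for m
  >= 2 it absorbs that factor and still leaves a decay like 1/s. Choosing m with \<gamma> m >= 2 as
  well makes the same excess control |Du|^2. \<open>weak_grad\<close> is an arbitrary choice among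
  the weak derivatives, so uniqueness of weak derivatives is needed to carry the final bound from
  the limit gradient over to it. The relation between p_n^+ and p_n^- enters through the recovery
  sequence: it bounds each exponent, which puts every function of W^{1,\<infinity>} into
  W^{1,p_n}.\<close>

fun Ck_real :: "nat \<Rightarrow> (real \<Rightarrow> real) \<Rightarrow> bool" where
  "Ck_real 0 f \<longleftrightarrow> continuous_on UNIV f"
| "Ck_real (Suc k) f \<longleftrightarrow> (\<exists>f'. (\<forall>x. (f has_real_derivative f' x) (at x)) \<and> Ck_real k f')"

definition smooth_real :: "(real \<Rightarrow> real) \<Rightarrow> bool" where
  "smooth_real f \<longleftrightarrow> (\<forall>k. Ck_real k f)"

lemma Ck_real_Suc_imp: "Ck_real (Suc k) f \<Longrightarrow> Ck_real k f"
proof (induction k arbitrary: f)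
  case 0
  then show ?case
    unfolding Ck_real.simps by (meson DERIV_isCont continuous_at_imp_continuous_on)
next
  case (Suc k)
  then obtain f' where "\<forall>x. (f has_real_derivative f' x) (at x)" "Ck_real (Suc k) f'"
    by (metis Ck_real.simps(2))
  with Suc.IH show ?case by auto
qed

lemma Ck_real_add: "Ck_real k f \<Longrightarrow> Ck_real k g \<Longrightarrow> Ck_real k (\<lambda>x. f x + g x)"
proof (induction k arbitrary: f g)
  case 0
  then show ?case by (auto intro: continuous_intros)
next
  case (Suc k)
  then obtain f' g' where "\<forall>x. (f has_real_derivative f' x) (at x)" "Ck_real k f'"
    "\<forall>x. (g has_real_derivative g' x) (at x)" "Ck_real k g'" by auto
  then show ?case using Suc.IH[of f' g']
    by (auto intro!: exI[of _ "\<lambda>x. f' x + g' x"] derivative_intros)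
qed

lemma Ck_real_mult: "Ck_real k f \<Longrightarrow> Ck_real k g \<Longrightarrow> Ck_real k (\<lambda>x. f x * g x)"
proof (induction k arbitrary: f g)
  case 0
  then show ?case by (auto intro: continuous_intros)
next
  case (Suc k)
  then obtain f' g' where d: "\<forall>x. (f has_real_derivative f' x) (at x)" "Ck_real k f'"
    "\<forall>x. (g has_real_derivative g' x) (at x)" "Ck_real k g'" by auto
  have "Ck_real k f" "Ck_real k g" using Suc.prems Ck_real_Suc_imp by blast+
  then have "Ck_real k (\<lambda>x. f' x * g x + g' x * f x)"
    using d Suc.IH by (intro Ck_real_add) auto
  then show ?case using d
    by (auto intro!: exI[of _ "\<lambda>x. f' x * g x + g' x * f x"] DERIV_mult)
qed

lemma Ck_real_const: "Ck_real k (\<lambda>x. c)"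
proof (induction k arbitrary: c)
  case (Suc k)
  then show ?case by (auto intro!: exI[of _ "\<lambda>x. 0"])
qed auto

lemma Ck_real_affine: "Ck_real k f \<Longrightarrow> Ck_real k (\<lambda>x. f (c * x + d))"
proof (induction k arbitrary: f)
  case 0
  then show ?case
    using continuous_on_compose2[of UNIV f UNIV "\<lambda>x. c * x + d"]
    by (simp add: continuous_intros)
next
  case (Suc k)
  then obtain f' where d: "\<And>x. (f has_real_derivative f' x) (at x)" "Ck_real k f'" by auto
  have "((\<lambda>x. f (c * x + d)) has_real_derivative f' (c * x + d) * c) (at x)" for x
    by (rule DERIV_chain2[OF d(1)]) (auto intro!: derivative_eq_intros)
  moreover have "Ck_real k (\<lambda>x. f' (c * x + d) * c)"
    by (rule Ck_real_mult[OF Suc.IH[OF d(2)] Ck_real_const])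
  ultimately show ?case
    unfolding Ck_real.simps by (intro exI[of _ "\<lambda>x. f' (c * x + d) * c"]) blast
qed

text \<open>\<open>Ck_real\<close> hides the derivative behind an existential quantifier, so each
  order may bring its own witness. Uniqueness of derivatives merges them into one function, which is
  then smooth itself.\<close>

lemma smooth_real_deriv:
  assumes "smooth_real f"
  obtains f' where "\<And>x. (f has_real_derivative f' x) (at x)" "smooth_real f'"
proof -
  obtain f' where f': "\<And>x. (f has_real_derivative f' x) (at x)"
    using assms unfolding smooth_real_def by (metis Ck_real.simps(2))
  have "Ck_real k f'" for k
  proof -
    obtain g where g: "\<And>x. (f has_real_derivative g x) (at x)" "Ck_real k g"
      using assms unfolding smooth_real_def by (metis Ck_real.simps(2))
    have "g = f'" using DERIV_unique[OF g(1) f'] by auto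
    with g show ?thesis by simp
  qed
  then show ?thesis using that f' by (auto simp: smooth_real_def)
qed

lemma smooth_real_affine: "smooth_real f \<Longrightarrow> smooth_real (\<lambda>x. f (c * x + d))"
  by (auto simp: smooth_real_def Ck_real_affine)

lemma smooth_real_continuous: "smooth_real f \<Longrightarrow> continuous_on A f"
  unfolding smooth_real_def using Ck_real.simps(1) continuous_on_subset by blast

text \<open>The polynomial makes the class closed under differentiation: the derivative of P(1/t)
  exp(-1/t) is t^(-2) (P - P')(1/t) exp(-1/t), again of this form. The classical flat function is
  the case P = 1.\<close>

definition flat_exp :: "real poly \<Rightarrow> real \<Rightarrow> real" where
  "flat_exp P t = (if t \<le> 0 then 0 else poly P (1 / t) * exp (- 1 / t))"

lemma poly_exp_tendsto_0:
  fixes P :: "real poly"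
  shows "((\<lambda>y. poly P y * exp (- y)) \<longlongrightarrow> 0) at_top"
proof -
  have "((\<lambda>y::real. \<Sum>i\<le>degree P. coeff P i * (y ^ i / exp y)) \<longlongrightarrow> (\<Sum>i\<le>degree P. coeff P i * 0)) at_top"
    by (intro tendsto_sum tendsto_mult tendsto_const tendsto_power_div_exp_0)
  moreover have "(\<lambda>y. poly P y * exp (- y)) = (\<lambda>y. \<Sum>i\<le>degree P. coeff P i * (y ^ i / exp y))"
    by (auto simp: poly_altdef sum_distrib_right exp_minus field_simps sum_divide_distrib)
  ultimately show ?thesis by simp
qed

lemma flat_exp_has_derivative:
  "(flat_exp P has_real_derivative flat_exp ([:0,0,1:] * (P - pderiv P)) t) (at t)"
proof -
  consider "t < 0" | "t > 0" | "t = 0" by linarith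
  then show ?thesis
  proof cases
    case 1
    have "((\<lambda>_. 0) has_real_derivative 0) (at t)" by simp
    then show ?thesis
      by (rule DERIV_cong_ev[THEN iffD1, rotated 3])
        (use 1 eventually_nhds_in_open[of "{..<0::real}" t] in \<open>auto simp: flat_exp_def elim!: eventually_mono\<close>)
  next
    case 2
    have "((\<lambda>t. poly P (1 / t) * exp (- 1 / t)) has_real_derivative
       poly ([:0,0,1:] * (P - pderiv P)) (1 / t) * exp (- 1 / t)) (at t)"
      using 2 by (auto intro!: derivative_eq_intros DERIV_chain2[of "poly P"] poly_DERIV
         simp: field_simps power2_eq_square)
    then show ?thesis
      by (rule DERIV_cong_ev[THEN iffD1, rotated 3])
        (use 2 eventually_nhds_in_open[of "{0::real<..}" t] in \<open>auto simp: flat_exp_def elim!: eventually_mono\<close>)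
  next
    case 3
    have R: "((\<lambda>h. flat_exp P h / h) \<longlongrightarrow> 0) (at_right 0)"
    proof -
      \<comment> \<open>\<open>pCons 0 P\<close> is y P(y): dividing by h is multiplying by y =
        1/h.\<close>
      have "((\<lambda>h. poly (pCons 0 P) (inverse h) * exp (- (inverse h))) \<longlongrightarrow> 0) (at_right (0::real))"
        using filterlim_compose[OF poly_exp_tendsto_0 filterlim_inverse_at_top_right] .
      then show ?thesis
        by (rule tendsto_cong[THEN iffD1, rotated])
          (auto simp: eventually_at_filter flat_exp_def field_simps)
    qed
    have L: "((\<lambda>h. flat_exp P h / h) \<longlongrightarrow> 0) (at_left 0)"
      by (rule tendsto_cong[THEN iffD1, of "\<lambda>_. 0"])
        (auto simp: eventually_at_filter flat_exp_def)
    from L R have "((\<lambda>h. flat_exp P h / h) \<longlongrightarrow> 0) (at 0)"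
      by (simp add: filterlim_split_at_real)
    then show ?thesis using 3 by (auto simp: DERIV_def flat_exp_def)
  qed
qed

lemma smooth_real_flat_exp: "smooth_real (flat_exp P)"
proof -
  have "Ck_real k (flat_exp P)" for k
  proof (induction k arbitrary: P)
    case 0
    then show ?case
      by (auto intro!: continuous_at_imp_continuous_on DERIV_isCont flat_exp_has_derivative)
  next
    case (Suc k)
    then show ?case using flat_exp_has_derivative by auto
  qed
  then show ?thesis by (simp add: smooth_real_def)
qed

text \<open>Each factor is the flat function of the distance to an endpoint, stretched by
  \<open>Suc m\<close>. Stretching moves no zero but drives the product to 1 inside the interval, so
  the bumps approximate its indicator. The arguments are spelled as c x + d to fit
  \<open>Ck_real_affine\<close>.\<close>

definition bump :: "nat \<Rightarrow> real \<Rightarrow> real \<Rightarrow> real \<Rightarrow> real" where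
  "bump m a b x = flat_exp 1 (real (Suc m) * x + - (real (Suc m) * a)) * flat_exp 1 (- real (Suc m) * x + real (Suc m) * b)"

lemma smooth_real_bump: "smooth_real (bump m a b)"
  unfolding smooth_real_def bump_def
  by (intro allI Ck_real_mult Ck_real_affine[where f = "flat_exp 1"])
    (use smooth_real_flat_exp[of 1] in \<open>simp_all add: smooth_real_def\<close>)

lemma bump_props: "0 \<le> bump m a b x" "bump m a b x \<le> 1" "x \<notin> {a<..<b} \<Longrightarrow> bump m a b x = 0"
proof -
  have *: "0 \<le> flat_exp 1 t" "flat_exp 1 t \<le> 1" for t by (auto simp: flat_exp_def)
  show "0 \<le> bump m a b x" "bump m a b x \<le> 1"
    using * unfolding bump_def by (auto intro: mult_le_one)
  assume "x \<notin> {a<..<b}"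
  then have "x \<le> a \<or> b \<le> x" by auto
  then have "real (Suc m) * x \<le> real (Suc m) * a \<or> real (Suc m) * b \<le> real (Suc m) * x"
    by (metis mult_left_mono of_nat_0_le_iff)
  then have "real (Suc m) * x + - (real (Suc m) * a) \<le> 0 \<or> - real (Suc m) * x + real (Suc m) * b \<le> 0"
    by linarith
  moreover have "flat_exp 1 t = 0" if "t \<le> 0" for t using that by (simp add: flat_exp_def)
  ultimately show "bump m a b x = 0" unfolding bump_def using mult_zero_left mult_zero_right by metis
qed

lemma bump_tendsto: "(\<lambda>m. bump m a b x) \<longlonglongrightarrow> indicator {a<..<b} x"
proof (cases "x \<in> {a<..<b}")
  case True
  have *: "(\<lambda>m. flat_exp 1 (real (Suc m) * c)) \<longlonglongrightarrow> 1" if "c > 0" for c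
  proof -
    have "(\<lambda>m. exp (- (1/c) * inverse (real (Suc m)))) \<longlonglongrightarrow> exp (-(1/c) * 0)"
      by (intro tendsto_intros LIMSEQ_inverse_real_of_nat)
    moreover have "flat_exp 1 (real (Suc m) * c) = exp (- (1/c) * inverse (real (Suc m)))" for m
      using that by (auto simp: flat_exp_def field_simps not_le mult_le_0_iff add_pos_nonneg)
    ultimately show ?thesis by simp
  qed
  have "(\<lambda>m. flat_exp 1 (real (Suc m) * (x - a)) * flat_exp 1 (real (Suc m) * (b - x))) \<longlonglongrightarrow> 1 * 1"
    using True by (intro tendsto_mult *) auto
  then show ?thesis using True by (simp add: bump_def algebra_simps)
qed (simp add: bump_props)

section \<open>Tensor products of one-variable functions as test functions\<close>

definition tensor :: "('n \<Rightarrow> real \<Rightarrow> real) \<Rightarrow> real^'n \<Rightarrow> real" where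
  "tensor \<phi> x = (\<Prod>j\<in>UNIV. \<phi> j (x $ j))"

lemma tensor_has_derivative:
  assumes "\<And>j t. (\<phi> j has_real_derivative \<phi>' j t) (at t)"
  shows "(tensor \<phi> has_derivative (\<lambda>h. \<Sum>i\<in>UNIV. h $ i * tensor (\<phi>(i := \<phi>' i)) x)) (at x)"
proof -
  have "((\<lambda>x. \<phi> j (x $ j)) has_derivative (\<lambda>h. \<phi>' j (x $ j) * h $ j)) (at x)" for j
  proof -
    have "((\<lambda>x. x $ j) has_derivative (\<lambda>h. h $ j)) (at x)"
      by (intro bounded_linear_imp_has_derivative bounded_linear_vec_nth)
    from has_derivative_compose[OF this assms[unfolded has_field_derivative_def]]
    show ?thesis by (simp add: mult.commute)
  qed
  then have "((\<lambda>x. \<Prod>j\<in>UNIV. \<phi> j (x $ j)) has_derivative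
     (\<lambda>h. \<Sum>i\<in>UNIV. \<phi>' i (x $ i) * h $ i * (\<Prod>j\<in>UNIV - {i}. \<phi> j (x $ j)))) (at x)"
    by (intro has_derivative_prod) auto
  moreover have "tensor (\<phi>(i := \<phi>' i)) x = \<phi>' i (x $ i) * (\<Prod>j\<in>UNIV - {i}. \<phi> j (x $ j))" for i
    unfolding tensor_def by (subst prod.remove[of UNIV i]) auto
  ultimately show ?thesis unfolding tensor_def[abs_def] by (simp add: mult_ac)
qed

lemma partial_tensor:
  assumes "\<And>j t. (\<phi> j has_real_derivative \<phi>' j t) (at t)"
  shows "partial (tensor \<phi>) i = tensor (\<phi>(i := \<phi>' i))"
proof
  fix x
  have "partial (tensor \<phi>) i x = (\<Sum>k\<in>UNIV. axis i 1 $ k * tensor (\<phi>(k := \<phi>' k)) x)"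
    unfolding partial_def frechet_derivative_at[OF tensor_has_derivative[OF assms], symmetric] ..
  also have "\<dots> = tensor (\<phi>(i := \<phi>' i)) x"
    by (simp add: axis_def if_distrib[of "\<lambda>c. c * _"] cong: if_cong)
  finally show "partial (tensor \<phi>) i x = tensor (\<phi>(i := \<phi>' i)) x" .
qed

lemma continuous_on_tensor:
  assumes "\<And>j. continuous_on UNIV (\<phi> j)"
  shows "continuous_on A (tensor \<phi>)"
  unfolding tensor_def[abs_def]
proof (rule continuous_on_prod)
  fix j
  show "continuous_on A (\<lambda>x. \<phi> j (x $ j))"
    by (rule continuous_on_compose2[OF assms]) (auto intro: continuous_on_component continuous_on_id)
qed

text \<open>A partial derivative replaces one factor by its derivative, so it is again a product of
  smooth one-variable functions; the induction therefore runs over all families of factors at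
  once.\<close>

lemma smooth_fun_tensor:
  fixes \<phi> :: "'n::finite \<Rightarrow> real \<Rightarrow> real"
  assumes "\<And>j. smooth_real (\<phi> j)"
  shows "smooth_fun (tensor \<phi>)"
proof -
  have "Ck k (tensor \<phi>)" if "\<And>j. smooth_real (\<phi> j)" for k and \<phi> :: "'n \<Rightarrow> real \<Rightarrow> real"
    using that
  proof (induction k arbitrary: \<phi>)
    case 0
    then show ?case by (auto intro: continuous_on_tensor smooth_real_continuous)
  next
    case (Suc k)
    have "\<exists>f'. (\<forall>t. (\<phi> j has_real_derivative f' t) (at t)) \<and> smooth_real f'" for j
      using smooth_real_deriv[OF Suc.prems[of j]] by metis
    then obtain \<phi>' where d: "\<And>j t. (\<phi> j has_real_derivative \<phi>' j t) (at t)"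
      and s: "\<And>j. smooth_real (\<phi>' j)" by metis
    then show ?case
      using Suc by (auto simp: partial_tensor[OF d] differentiable_def intro: tensor_has_derivative[OF d] Suc.IH)
  qed
  with assms show ?thesis by (simp add: smooth_fun_def)
qed

lemma tensor_support: 
  assumes "\<And>j t. t \<notin> {a $ j<..<b $ j} \<Longrightarrow> \<phi> j t = 0" "x \<notin> box a b"
  shows "tensor \<phi> x = 0"
proof -
  obtain j where "x $ j \<notin> {a $ j<..<b $ j}"
    using assms(2) by (auto simp: mem_box_cart)
  then have "\<phi> j (x $ j) = 0" by (rule assms(1))
  then show ?thesis unfolding tensor_def by (intro prod_zero) auto
qed

lemma test_function_tensor:
  assumes "\<And>j. smooth_real (\<phi> j)" "\<And>j t. t \<notin> {a $ j<..<b $ j} \<Longrightarrow> \<phi> j t = 0" "cbox a b \<subseteq> \<Omega>"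
  shows "test_function \<Omega> (tensor \<phi>)"
proof -
  have "{x. tensor \<phi> x \<noteq> 0} \<subseteq> cbox a b"
    using tensor_support[of a b \<phi>] assms(2) box_subset_cbox[of a b] by blast
  then have *: "closure {x. tensor \<phi> x \<noteq> 0} \<subseteq> cbox a b"
    by (simp add: closure_minimal closed_cbox)
  then have "bounded {x. tensor \<phi> x \<noteq> 0}"
    using bounded_subset[OF bounded_cbox] closure_subset by blast
  then show ?thesis
    using * assms smooth_fun_tensor[of \<phi>] by (auto simp: test_function_def)
qed

section \<open>Scalar weak derivatives\<close>

lemma smooth_fun_Ck: "smooth_fun \<phi> \<Longrightarrow> continuous_on UNIV \<phi> \<and> continuous_on UNIV (partial \<phi> i)"
  unfolding smooth_fun_def by (metis Ck.simps)

lemma partial_outside_support: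
  fixes \<phi> :: "real^'n \<Rightarrow> real"
  assumes "x \<notin> closure {x. \<phi> x \<noteq> 0}"
  shows "partial \<phi> i x = 0"
proof -
  have "((\<lambda>_. 0) has_derivative (\<lambda>_. 0)) (at x)" by simp
  then have "(\<phi> has_derivative (\<lambda>_. 0)) (at x)"
    by (rule has_derivative_transform_within_open[of _ _ _ UNIV "- closure {x. \<phi> x \<noteq> 0}"])
      (use assms closure_subset[of "{x. \<phi> x \<noteq> 0}"] in auto)
  then have "frechet_derivative \<phi> (at x) = (\<lambda>_. 0)" by (rule frechet_derivative_at[symmetric])
  then show ?thesis by (simp add: partial_def)
qed

lemma test_functionE:
  fixes \<phi> :: "real^'n \<Rightarrow> real"
  assumes "test_function \<Omega> \<phi>"
  obtains K B where "compact K" "K \<subseteq> \<Omega>"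
    "\<And>x. x \<notin> K \<Longrightarrow> \<phi> x = 0" "\<And>x i. x \<notin> K \<Longrightarrow> partial \<phi> i x = 0"
    "\<And>x. \<bar>\<phi> x\<bar> \<le> B" "\<And>x i. \<bar>partial \<phi> i x\<bar> \<le> B"
    "continuous_on UNIV \<phi>" "\<And>i. continuous_on UNIV (partial \<phi> i)"
    "0 \<le> B"
proof -
  define K where "K = closure {x. \<phi> x \<noteq> 0}"
  have s: "smooth_fun \<phi>" "compact K" "K \<subseteq> \<Omega>"
    using assms by (auto simp: test_function_def K_def)
  have z: "\<phi> x = 0" "partial \<phi> i x = 0" if "x \<notin> K" for x i
    using that partial_outside_support[of x \<phi>] closure_subset[of "{x. \<phi> x \<noteq> 0}"]
    by (auto simp: K_def)
  have bd: "\<exists>B. \<forall>x. \<bar>h x\<bar> \<le> B" if "continuous_on UNIV h" "\<And>x. x \<notin> K \<Longrightarrow> h x = 0" for h :: "real^'n \<Rightarrow> real"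
  proof -
    have "bounded (h ` K)"
      by (intro compact_imp_bounded compact_continuous_image s(2) continuous_on_subset[OF that(1)]) simp
    then obtain B where "\<forall>x\<in>K. \<bar>h x\<bar> \<le> B" by (auto simp: bounded_iff)
    then have "\<bar>h x\<bar> \<le> max B 0" for x using that(2)[of x] by (cases "x \<in> K") auto
    then show ?thesis by blast
  qed
  obtain B0 where B0: "\<And>x. \<bar>\<phi> x\<bar> \<le> B0" using bd[of \<phi>] z smooth_fun_Ck[OF s(1)] by blast
  have "\<exists>B. \<forall>x. \<bar>partial \<phi> i x\<bar> \<le> B" for i using bd[of "partial \<phi> i"] z smooth_fun_Ck[OF s(1)] by blast
  then obtain B1 where B1: "\<And>i x. \<bar>partial \<phi> i x\<bar> \<le> B1 i" by metis
  \<comment> \<open>A sum dominates each of its nonnegative terms, so one constant serves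
    \<open>\<phi>\<close> and all its partial derivatives.\<close>
  define B where "B = B0 + (\<Sum>i\<in>UNIV. B1 i)"
  have B1': "0 \<le> B1 i" for i using B1[of i undefined] by linarith
  have B0': "0 \<le> B0" using B0[of undefined] by linarith
  have "\<bar>\<phi> x\<bar> \<le> B" for x
    using B0[of x] sum_nonneg[of UNIV B1] B1' by (simp add: B_def add_increasing2)
  moreover have "\<bar>partial \<phi> i x\<bar> \<le> B" for x i
    using B1[of i x] member_le_sum[of i UNIV B1] B1' B0' by (simp add: B_def)
  ultimately show ?thesis
    using that[of K B] z s smooth_fun_Ck[OF s(1)] B0' sum_nonneg[of UNIV B1] B1' by (auto simp: B_def)
qed

section \<open>The fundamental lemma of the calculus of variations with product test
  functions\<close>

lemma box_Int_box_cart: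
  fixes a b c d :: "real^'n"
  shows "box a b \<inter> box c d = box (\<chi> j. max (a $ j) (c $ j)) (\<chi> j. min (b $ j) (d $ j))"
  by (auto simp: mem_box_cart)

text \<open>Boxes are an intersection-stable generator of the Borel sets, so a Dynkin argument
  carries the vanishing of the integral from boxes to all Borel sets. The assumption on the whole
  space serves the complement step.\<close>

lemma integral_boxes_zero_imp_AE_zero:
  fixes F :: "real^'n \<Rightarrow> real"
  assumes F: "integrable lborel F" and 0: "integral\<^sup>L lborel F = 0"
    and box: "\<And>c d. (LINT x:box c d|lborel. F x) = 0"
  shows "AE x in lborel. F x = 0"
proof (rule density_unique_real[OF F, of "\<lambda>_. 0"])
  fix A :: "(real^'n) set"
  assume "A \<in> sets lborel"
  then have A: "A \<in> sigma_sets UNIV (range (\<lambda>(a, b). box a b))"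
    by (simp add: borel_eq_box)
  have seq: "sigma_sets UNIV (range (\<lambda>(a, b). box a b)) = sets (borel :: (real^'n) measure)"
    by (simp add: borel_eq_box)
  have si: "set_integrable lborel B F" if "B \<in> sets borel" for B
    using integrable_mult_indicator[OF _ F, of B] that by (simp add: set_integrable_def)
  have "Int_stable (range (\<lambda>(a, b). box a b) :: (real^'n) set set)"
    by (auto simp: Int_stable_def box_Int_box_cart)
  moreover have "range (\<lambda>(a, b). box a b) \<subseteq> Pow (UNIV :: (real^'n) set)" by simp
  ultimately have "(LINT x:A|lborel. F x) = 0"
    using A
  proof (induction rule: sigma_sets_induct_disjoint)
    case (basic A)
    then show ?case using box by auto
  next
    case empty
    show ?case by (simp add: set_lebesgue_integral_def)
  next
    case (compl A)
    have "(LINT x:(UNIV - A) \<union> A|lborel. F x) = (LINT x:UNIV - A|lborel. F x) + (LINT x:A|lborel. F x)"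
      using compl(1) by (intro set_integral_Un si) (auto simp: seq)
    moreover have "(LINT x:(UNIV - A) \<union> A|lborel. F x) = 0"
      using 0 by (simp add: set_lebesgue_integral_def)
    ultimately show ?case using compl by simp
  next
    case (union A)
    then show ?case
      by (subst lebesgue_integral_countable_add) (auto simp: seq disjoint_family_on_def intro!: si)
  qed
  then show "(LINT x:A|lborel. F x) = (LINT x:A|lborel. 0)"
    by (simp add: set_lebesgue_integral_def)
qed simp

text \<open>Products of bumps tend boundedly to the indicator of any sub-box, so dominated
  convergence turns the hypothesis into vanishing integrals over sub-boxes. No mollifier is
  involved.\<close>

lemma tensor_test_imp_AE_zero:
  fixes F :: "real^'n \<Rightarrow> real"
  assumes F: "integrable lborel F"
    and test: "\<And>\<phi>. (\<And>j. smooth_real (\<phi> j)) \<Longrightarrow> (\<And>j t. t \<notin> {a $ j<..<b $ j} \<Longrightarrow> \<phi> j t = 0) \<Longrightarrow>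
       (\<integral>x. tensor \<phi> x * F x \<partial>lborel) = 0"
  shows "AE x in lborel. x \<in> box a b \<longrightarrow> F x = 0"
proof -
  have [measurable]: "F \<in> borel_measurable borel" using F by auto
  have sub: "(LINT x:box c d|lborel. F x) = 0" if "\<And>j. a $ j \<le> c $ j" "\<And>j. d $ j \<le> b $ j" for c d
  proof -
    define \<phi> where "\<phi> m j = bump m (c $ j) (d $ j)" for m j
    have meas: "tensor (\<phi> m) \<in> borel_measurable borel" for m
      by (intro borel_measurable_continuous_onI continuous_on_tensor smooth_real_continuous)
        (simp add: \<phi>_def smooth_real_bump)
    have "(\<lambda>m. \<integral>x. tensor (\<phi> m) x * F x \<partial>lborel) \<longlonglongrightarrow> (\<integral>x. indicator (box c d) x * F x \<partial>lborel)"
    proof (rule integral_dominated_convergence)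
      show "AE x in lborel. (\<lambda>m. tensor (\<phi> m) x * F x) \<longlonglongrightarrow> indicator (box c d) x * F x"
      proof (intro always_eventually allI tendsto_mult tendsto_const)
        fix x
        have "(\<lambda>m. tensor (\<phi> m) x) \<longlonglongrightarrow> (\<Prod>j\<in>UNIV. indicator {c $ j<..<d $ j} (x $ j))"
          unfolding tensor_def \<phi>_def by (intro tendsto_prod bump_tendsto)
        moreover have "(\<Prod>j\<in>UNIV. indicator {c $ j<..<d $ j} (x $ j)) = (indicator (box c d) x :: real)"
          by (auto simp: indicator_def mem_box_cart intro!: prod_zero)
        ultimately show "(\<lambda>m. tensor (\<phi> m) x) \<longlonglongrightarrow> indicator (box c d) x" by simp
      qed
      show "AE x in lborel. norm (tensor (\<phi> m) x * F x) \<le> \<bar>F x\<bar>" for m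
      proof (intro always_eventually allI)
        fix x
        have "0 \<le> tensor (\<phi> m) x \<and> tensor (\<phi> m) x \<le> 1"
          unfolding tensor_def \<phi>_def by (auto intro!: prod_nonneg prod_le_1 bump_props)
        then show "norm (tensor (\<phi> m) x * F x) \<le> \<bar>F x\<bar>"
          by (simp add: abs_mult mult_left_le_one_le)
      qed
    qed (use meas F in auto)
    moreover have "(\<integral>x. tensor (\<phi> m) x * F x \<partial>lborel) = 0" for m
    proof (rule test)
      fix j t assume "t \<notin> {a $ j<..<b $ j}"
      then have "t \<notin> {c $ j<..<d $ j}" using that[of j] by auto
      then show "\<phi> m j t = 0" by (simp add: \<phi>_def bump_props)
    qed (simp add: \<phi>_def smooth_real_bump)
    ultimately show ?thesis
      by (simp add: LIMSEQ_const_iff set_lebesgue_integral_def)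
  qed
  have "AE x in lborel. indicator (box a b) x * F x = 0"
  proof (rule integral_boxes_zero_imp_AE_zero)
    show "integrable lborel (\<lambda>x. indicator (box a b) x * F x)"
      using integrable_mult_indicator[OF _ F, of "box a b"] by simp
    show "(\<integral>x. indicator (box a b) x * F x \<partial>lborel) = 0"
      using sub[of a b] by (simp add: set_lebesgue_integral_def)
    fix c d :: "real^'n"
    \<comment> \<open>Any box meets \<open>box a b\<close> in a sub-box of it, to which
      \<open>sub\<close> applies.\<close>
    define c' d' where "c' = (\<chi> j. max (a $ j) (c $ j))" "d' = (\<chi> j. min (b $ j) (d $ j))"
    have "indicator (box c d) x * indicator (box a b) x = (indicator (box c' d') x :: real)" for x
      by (auto simp: c'_d'_def indicator_def mem_box_cart)
    with sub[of c' d'] show "(LINT x:box c d|lborel. indicator (box a b) x * F x) = 0"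
      by (simp add: set_lebesgue_integral_def c'_d'_def flip: mult.assoc)
  qed
  then show ?thesis by (auto elim!: eventually_mono)
qed

text \<open>Scalar counterpart of \<open>weak_partial\<close>; by
  \<open>weak_partial_iff_weak_deriv\<close> the vector notion is this one in every
  component.\<close>

definition weak_deriv :: "(real^'n) set \<Rightarrow> (real^'n \<Rightarrow> real) \<Rightarrow> 'n \<Rightarrow> (real^'n \<Rightarrow> real) \<Rightarrow> bool" where
  "weak_deriv \<Omega> u i g \<longleftrightarrow>
     (\<forall>K. compact K \<and> K \<subseteq> \<Omega> \<longrightarrow> set_integrable lebesgue K u \<and> set_integrable lebesgue K g) \<and>
     (\<forall>\<phi>. test_function \<Omega> \<phi> \<longrightarrow>
        (LINT x:\<Omega>|lebesgue. partial \<phi> i x * u x) = - (LINT x:\<Omega>|lebesgue. \<phi> x * g x))"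

text \<open>Translations and Fubini are carried out with Borel functions, for which (s, x) \<mapsto>
  h'(x + s v) is jointly measurable by composition. Being zero outside K makes the representative
  integrable on the whole space, so shifted arguments need no domain conditions.\<close>

definition borel_version :: "(real^'n) set \<Rightarrow> (real^'n \<Rightarrow> real) \<Rightarrow> (real^'n \<Rightarrow> real) \<Rightarrow> bool" where
  "borel_version K h h' \<longleftrightarrow> integrable lborel h' \<and> (\<forall>x. x \<notin> K \<longrightarrow> h' x = 0) \<and>
     (AE x in lborel. x \<in> K \<longrightarrow> h' x = h x)"

lemma borel_versionD:
  assumes "borel_version K h h'"
  shows "integrable lborel h'" "\<And>x. x \<notin> K \<Longrightarrow> h' x = 0" "AE x in lborel. x \<in> K \<longrightarrow> h' x = h x"
  using assms by (simp_all add: borel_version_def)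

lemma borel_version_ex:
  assumes "set_integrable lebesgue K h" "compact K"
  shows "\<exists>h'. borel_version K h h'"
proof -
  have [measurable]: "K \<in> sets borel" using assms(2) by (simp add: borel_compact)
  have i: "integrable lebesgue (\<lambda>x. indicator K x * h x)"
    using assms(1) by (simp add: set_integrable_def)
  then obtain g where g: "g \<in> borel_measurable lborel" "AE x in lborel. indicator K x * h x = g x"
    using completion_ex_borel_measurable_real[of "\<lambda>x. indicator K x * h x" lborel] by auto
  define h' where "h' x = indicator K x * g x" for x
  have m[measurable]: "h' \<in> borel_measurable lborel" unfolding h'_def using g(1) by measurable
  have ae: "AE x in lborel. h' x = indicator K x * h x"
    using g(2) by eventually_elim (auto simp: h'_def indicator_def split: if_splits)
  then have "AE x in lebesgue. h' x = indicator K x * h x" by (simp add: AE_completion)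
  then have "integrable lebesgue h'"
    using i m by (subst integrable_cong_AE[where g = "\<lambda>x. indicator K x * h x"]) (auto simp: measurable_completion)
  then have "integrable lborel h'" using m by (simp add: integrable_completion)
  moreover have "AE x in lborel. x \<in> K \<longrightarrow> h' x = h x"
    using ae by eventually_elim auto
  ultimately show ?thesis
    by (intro exI[of _ h']) (simp add: borel_version_def h'_def)
qed

text \<open>A test function that vanishes outside K sees only the values on K, where h and its Borel
  representative agree almost everywhere.\<close>

lemma lebesgue_integral_borel_version:
  fixes h h' \<phi> :: "real^'n \<Rightarrow> real"
  assumes h': "borel_version K h h'" and h: "set_integrable lebesgue K h"
    and \<phi>: "\<phi> \<in> borel_measurable borel" "\<And>x. x \<notin> K \<Longrightarrow> \<phi> x = 0" "K \<subseteq> \<Omega>"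
  shows "(LINT x:\<Omega>|lebesgue. \<phi> x * h x) = (\<integral>x. \<phi> x * h' x \<partial>lborel)"
proof -
  have m: "h' \<in> borel_measurable borel" "\<phi> \<in> borel_measurable lborel" using borel_versionD(1)[OF h'] \<phi>(1) by auto
  have "AE x in lebesgue. \<phi> x * h' x = \<phi> x * (indicator K x * h x)"
    using AE_completion[OF borel_versionD(3)[OF h']] borel_versionD(2)[OF h']
    by (auto elim!: eventually_mono simp: indicator_def)
  moreover have "(\<lambda>x. \<phi> x * h' x) \<in> borel_measurable lebesgue"
    using m by (intro measurable_completion) simp
  moreover have "(\<lambda>x. \<phi> x * (indicator K x * h x)) \<in> borel_measurable lebesgue"
    using h unfolding set_integrable_def real_scaleR_def
    by (intro borel_measurable_times[OF measurable_completion[OF m(2)]]) simp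
  ultimately have "(\<integral>x. \<phi> x * h' x \<partial>lebesgue) = (\<integral>x. \<phi> x * (indicator K x * h x) \<partial>lebesgue)"
    by (intro integral_cong_AE) auto
  also have "\<dots> = (LINT x:\<Omega>|lebesgue. \<phi> x * h x)"
    unfolding set_lebesgue_integral_def using \<phi>(2,3)
    by (intro Bochner_Integration.integral_cong) (auto simp: indicator_def)
  finally show ?thesis using m by (subst (asm) integral_completion) auto
qed

section \<open>Weak derivatives and translations\<close>

lemma lborel_integral_shift:
  fixes f :: "real^'n \<Rightarrow> real"
  assumes "f \<in> borel_measurable borel"
  shows "(\<integral>x. f (x + c) \<partial>lborel) = (\<integral>x. f x \<partial>lborel)"
proof -
  have "(\<integral>x. f x \<partial>distr lborel borel ((+) c)) = (\<integral>x. f (c + x) \<partial>lborel)"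
    using assms by (intro integral_distr) auto
  then show ?thesis by (simp add: lborel_distr_plus add.commute)
qed

lemma lborel_integrable_shift:
  fixes f :: "real^'n \<Rightarrow> real"
  assumes "integrable lborel f"
  shows "integrable lborel (\<lambda>x. f (x + c))"
proof -
  have "integrable (distr lborel borel ((+) c)) f" using assms by (simp add: lborel_distr_plus)
  then show ?thesis by (subst (asm) integrable_distr_eq) (use assms in \<open>auto simp: add.commute\<close>)
qed

lemma nn_integral_lborel_shift:
  fixes f :: "real^'n \<Rightarrow> ennreal"
  assumes "f \<in> borel_measurable borel"
  shows "(\<integral>\<^sup>+x. f (x + c) \<partial>lborel) = (\<integral>\<^sup>+x. f x \<partial>lborel)"
proof -
  have "(\<integral>\<^sup>+x. f x \<partial>distr lborel borel ((+) c)) = (\<integral>\<^sup>+x. f (c + x) \<partial>lborel)"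
    using assms by (intro nn_integral_distr) auto
  then show ?thesis by (simp add: lborel_distr_plus add.commute)
qed

lemma AE_lborel_shift:
  fixes P :: "real^'n \<Rightarrow> bool"
  assumes "AE x in lborel. P x"
  shows "AE x in lborel. P (x + c)"
proof -
  obtain N where N: "N \<in> null_sets lborel" "{x. \<not> P x} \<subseteq> N"
    using assms by (auto simp: eventually_ae_filter)
  have "AE x in distr lborel borel ((+) c). x \<notin> N"
    using N by (simp add: lborel_distr_plus AE_not_in)
  then have "AE x in lborel. c + x \<notin> N"
    by (subst (asm) AE_distr_iff) (use N in auto)
  then show ?thesis
    by (rule eventually_mono) (use N in \<open>auto simp: add.commute\<close>)
qed

text \<open>The integral of |h(x + s v)| over x does not depend on s, so Fubini only has to
  integrate a constant over [0, 1]. This justifies the exchanges of integrals in the translation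
  formula.\<close>

lemma integrable_unit_interval_times:
  fixes h :: "real^'n \<Rightarrow> real"
  assumes "integrable lborel h"
  shows "integrable (lborel \<Otimes>\<^sub>M lborel) (\<lambda>(s, x). indicator {0..1::real} s * h (x + s *\<^sub>R v))"
proof (rule lborel_pair.Fubini_integrable)
  have [measurable]: "h \<in> borel_measurable borel" using assms by auto
  show "(\<lambda>(s, x). indicator {0..1::real} s * h (x + s *\<^sub>R v)) \<in> borel_measurable (lborel \<Otimes>\<^sub>M lborel)"
    by measurable
  have "(\<integral>x. norm (indicator {0..1::real} s * h (x + s *\<^sub>R v)) \<partial>lborel) = indicator {0..1} s * (\<integral>x. norm (h x) \<partial>lborel)" for s
    using lborel_integral_shift[of "\<lambda>x. norm (h x)" "s *\<^sub>R v"] by (simp add: abs_mult)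
  then show "integrable lborel (\<lambda>s. \<integral>x. norm (case (s, x) of (s, x) \<Rightarrow> indicator {0..1::real} s * h (x + s *\<^sub>R v)) \<partial>lborel)"
    by simp
  show "AE s in lborel. integrable lborel (\<lambda>x. case (s, x) of (s, x) \<Rightarrow> indicator {0..1::real} s * h (x + s *\<^sub>R v))"
    using lborel_integrable_shift[OF assms] by simp
qed

text \<open>Translating by w keeps a product of smooth factors and moves its support into the box
  shifted by w, which \<open>seg\<close> places in C. The identity on \<Omega>, stated with Lebesgue
  integrals, can then be read off on the Borel representatives.\<close>

lemma weak_deriv_tens_shift:
  fixes u u' :: "real^'n \<Rightarrow> real" and g g' :: "real^'n \<Rightarrow> real"
  assumes sw: "weak_deriv \<Omega> u i g" and C: "compact C" "C \<subseteq> \<Omega>"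
    and u': "borel_version C u u'" and g': "borel_version C g g'"
    and seg: "\<And>x. x \<in> cbox a b \<Longrightarrow> x + w \<in> C"
    and \<phi>: "\<And>j. smooth_real (\<phi> j)" "\<And>j t. t \<notin> {a $ j<..<b $ j} \<Longrightarrow> \<phi> j t = 0"
      "\<And>j t. (\<phi> j has_real_derivative \<phi>' j t) (at t)"
  shows "(\<integral>x. tensor (\<phi>(i := \<phi>' i)) (x - w) * u' x \<partial>lborel) = - (\<integral>x. tensor \<phi> (x - w) * g' x \<partial>lborel)"
proof -
  define \<psi> where "\<psi> j t = \<phi> j (1 * t + - w $ j)" for j t
  define \<psi>' where "\<psi>' j t = \<phi>' j (1 * t + - w $ j)" for j t
  have d: "(\<psi> j has_real_derivative \<psi>' j t) (at t)" for j t
    using DERIV_shift[of "\<phi> j" "\<phi>' j (t - w $ j)" t "- w $ j"] \<phi>(3)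
    by (simp add: \<psi>_def[abs_def] \<psi>'_def)
  have sub: "cbox (a + w) (b + w) \<subseteq> C"
  proof
    fix y assume "y \<in> cbox (a + w) (b + w)"
    then have "y - w \<in> cbox a b" by (auto simp: mem_box_cart algebra_simps)
    from seg[OF this] show "y \<in> C" by simp
  qed
  have "smooth_real (\<psi> j)" for j
    unfolding \<psi>_def by (rule smooth_real_affine[OF \<phi>(1)])
  moreover have "\<psi> j t = 0" if "t \<notin> {(a + w) $ j<..<(b + w) $ j}" for j t
    using that unfolding \<psi>_def by (intro \<phi>(2)) auto
  ultimately have tf: "test_function C (tensor \<psi>)"
    using sub by (intro test_function_tensor[of \<psi> "a + w" "b + w"])
  then have tf': "test_function \<Omega> (tensor \<psi>)" using C by (auto simp: test_function_def)
  obtain K B where KB: "K \<subseteq> C" "\<And>x. x \<notin> K \<Longrightarrow> tensor \<psi> x = 0" "\<And>x i. x \<notin> K \<Longrightarrow> partial (tensor \<psi>) i x = 0"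
    "continuous_on UNIV (tensor \<psi>)" "\<And>i. continuous_on UNIV (partial (tensor \<psi>) i)"
    by (rule test_functionE[OF tf]) metis
  have uC: "set_integrable lebesgue C u" "set_integrable lebesgue C g"
    using sw C unfolding weak_deriv_def by blast+
  have e1: "tensor \<psi> x = tensor \<phi> (x - w)" for x by (simp add: tensor_def \<psi>_def)
  have e2: "partial (tensor \<psi>) i x = tensor (\<phi>(i := \<phi>' i)) (x - w)" for x
    unfolding partial_tensor[OF d] unfolding tensor_def
    by (intro prod.cong refl) (auto simp: \<psi>_def \<psi>'_def)
  have "(LINT x:\<Omega>|lebesgue. partial (tensor \<psi>) i x * u x) = - (LINT x:\<Omega>|lebesgue. tensor \<psi> x * g x)"
    using sw tf' by (auto simp: weak_deriv_def)
  also have "(LINT x:\<Omega>|lebesgue. partial (tensor \<psi>) i x * u x) = (\<integral>x. partial (tensor \<psi>) i x * u' x \<partial>lborel)"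
    by (rule lebesgue_integral_borel_version[OF u' uC(1) _ _ C(2)])
      (use KB in \<open>auto intro: borel_measurable_continuous_onI\<close>)
  also have "(LINT x:\<Omega>|lebesgue. tensor \<psi> x * g x) = (\<integral>x. tensor \<psi> x * g' x \<partial>lborel)"
    by (rule lebesgue_integral_borel_version[OF g' uC(2) _ _ C(2)])
      (use KB in \<open>auto intro: borel_measurable_continuous_onI\<close>)
  finally show ?thesis unfolding e2 unfolding e1 .
qed

text \<open>The fundamental theorem of calculus for s \<mapsto>
  \<open>tensor \<phi> (x - s *\<^sub>R v)\<close>. The test function moves backwards because u is
  to move forwards.\<close>

lemma tensor_segment:
  fixes v :: "real^'n"
  assumes d: "\<And>j t. (\<phi> j has_real_derivative \<phi>' j t) (at t)" and s: "\<And>j. smooth_real (\<phi>' j)"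
    and s0: "\<And>j. smooth_real (\<phi> j)"
  shows "tensor \<phi> (x - v) - tensor \<phi> x =
    - (\<integral>s. indicator {0..1} s * (\<Sum>i\<in>UNIV. v $ i * tensor (\<phi>(i := \<phi>' i)) (x - s *\<^sub>R v)) \<partial>lborel)"
proof -
  let ?P = "\<lambda>s. - (\<Sum>i\<in>UNIV. v $ i * tensor (\<phi>(i := \<phi>' i)) (x - s *\<^sub>R v))"
  have D: "((\<lambda>s. tensor \<phi> (x - s *\<^sub>R v)) has_real_derivative ?P s) (at s)" for s
  proof -
    have "((\<lambda>s. x - s *\<^sub>R v) has_derivative (\<lambda>h. - (h *\<^sub>R v))) (at s)"
      by (auto intro!: derivative_eq_intros)
    from has_derivative_compose[OF this tensor_has_derivative[OF d]]
    show ?thesis unfolding has_field_derivative_def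
      by (rule has_derivative_eq_rhs) (auto simp: sum_distrib_left sum_negf mult_ac)
  qed
  have cont: "isCont ?P s" for s
  proof -
    have c: "continuous_on UNIV (tensor (\<phi>(i := \<phi>' i)))" for i
      using s s0 by (intro continuous_on_tensor) (auto intro: smooth_real_continuous)
    have "continuous_on UNIV (\<lambda>s. tensor (\<phi>(i := \<phi>' i)) (x - s *\<^sub>R v))" for i
      by (rule continuous_on_compose2[OF c]) (auto intro!: continuous_intros)
    then have "continuous_on UNIV ?P"
      by (intro continuous_on_minus continuous_on_sum continuous_on_mult continuous_on_const)
    then show ?thesis by (simp add: continuous_on_eq_continuous_at)
  qed
  have "(\<integral>s. ?P s * indicator {0..1} s \<partial>lborel) = tensor \<phi> (x - 1 *\<^sub>R v) - tensor \<phi> (x - 0 *\<^sub>R v)"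
    by (rule integral_FTC_Icc_real) (use D cont in auto)
  then show ?thesis by (simp add: mult.commute)
qed

text \<open>
  For each \<open>s\<close> the shifted function \<open>\<phi>(x - s v)\<close> is again an admissible test function, so integrating
  the derivative of \<open>s \<mapsto> \<integral> u(x) \<phi>(x - s v) dx\<close> over \<open>[0, 1]\<close> gives the formula without mollification.
\<close>

lemma weak_deriv_translate:
  fixes u u' :: "real^'n \<Rightarrow> real" and g g' :: "'n \<Rightarrow> real^'n \<Rightarrow> real"
  assumes sw: "\<And>i. weak_deriv \<Omega> u i (g i)" and C: "compact C" "C \<subseteq> \<Omega>"
    and uv: "borel_version C u u'" and gv: "\<And>i. borel_version C (g i) (g' i)"
    and seg: "\<And>x s. x \<in> cbox a b \<Longrightarrow> 0 \<le> s \<Longrightarrow> s \<le> 1 \<Longrightarrow> x + s *\<^sub>R v \<in> C"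
  shows "AE x in lborel. x \<in> box a b \<longrightarrow>
    u' (x + v) - u' x = (\<Sum>i\<in>UNIV. v $ i * (\<integral>s. indicator {0..1} s * g' i (x + s *\<^sub>R v) \<partial>lborel))"
proof -
  let ?P = "\<lambda>P x s. (\<Sum>i\<in>UNIV. v $ i * P i (x - s *\<^sub>R v))"
  note u' = borel_versionD[OF uv] and g' = borel_versionD[OF gv]
  have meas[measurable]: "u' \<in> borel_measurable borel" "g' i \<in> borel_measurable borel" for i
    using u' g' by auto
  have gint: "integrable (lborel \<Otimes>\<^sub>M lborel) (\<lambda>(s, x). indicator {0..1::real} s * g' i (x + s *\<^sub>R v))" for i
    by (rule integrable_unit_interval_times[OF g'(1)])
  define T where "T x = (\<Sum>i\<in>UNIV. v $ i * (\<integral>s. indicator {0..1::real} s * g' i (x + s *\<^sub>R v) \<partial>lborel))" for x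
  have Tint: "integrable lborel T"
    unfolding T_def by (intro Bochner_Integration.integrable_sum integrable_mult_right lborel_pair.integrable_snd gint)
  have ush: "integrable lborel (\<lambda>x. u' (x + v))" by (rule lborel_integrable_shift[OF u'(1)])
  have "AE x in lborel. x \<in> box a b \<longrightarrow> u' (x + v) - u' x - T x = 0"
  proof (rule tensor_test_imp_AE_zero)
    show "integrable lborel (\<lambda>x. u' (x + v) - u' x - T x)" using ush Tint u'(1) by auto
    fix \<phi> :: "'n \<Rightarrow> real \<Rightarrow> real"
    assume \<phi>: "\<And>j. smooth_real (\<phi> j)" "\<And>j t. t \<notin> {a $ j<..<b $ j} \<Longrightarrow> \<phi> j t = 0"
    have "\<exists>f'. (\<forall>t. (\<phi> j has_real_derivative f' t) (at t)) \<and> smooth_real f'" for j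
      using smooth_real_deriv[OF \<phi>(1)[of j]] by metis
    then obtain \<phi>' where d: "\<And>j t. (\<phi> j has_real_derivative \<phi>' j t) (at t)"
      and s: "\<And>j. smooth_real (\<phi>' j)" by metis
    define P where "P i = tensor (\<phi>(i := \<phi>' i))" for i
    have "test_function UNIV (tensor \<phi>)" by (rule test_function_tensor[OF \<phi>]) auto
    then obtain B where B: "0 \<le> B" "\<And>x. \<bar>tensor \<phi> x\<bar> \<le> B" "\<And>x i. \<bar>P i x\<bar> \<le> B"
      "continuous_on UNIV (tensor \<phi>)" "\<And>i. continuous_on UNIV (P i)"
      by (rule test_functionE) (unfold partial_tensor[OF d] P_def[symmetric], metis)
    have [measurable]: "tensor \<phi> \<in> borel_measurable borel" "P i \<in> borel_measurable borel" for i
      using B by (auto intro: borel_measurable_continuous_onI)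
    have bdi: "integrable lborel (\<lambda>x. h x * f x)" if "\<And>x. \<bar>h x\<bar> \<le> B" "h \<in> borel_measurable borel" "integrable lborel f"
      for f h :: "real^'n \<Rightarrow> real"
      by (rule Bochner_Integration.integrable_bound[of _ "\<lambda>x. B * f x"])
        (use that B(1) in \<open>auto simp: abs_mult intro!: mult_mono\<close>)
    have uP: "integrable (lborel \<Otimes>\<^sub>M lborel) (\<lambda>(s, x). indicator {0..1::real} s * (v $ i * P i (x - s *\<^sub>R v) * u' x))" for i
    proof (rule Bochner_Integration.integrable_bound)
      \<comment> \<open>A shift by the zero vector: the unit-interval lemma then covers u'(x)
        itself, which dominates because the derivatives of the test function are bounded by
        B.\<close>
      show "integrable (lborel \<Otimes>\<^sub>M lborel) (\<lambda>p. (v $ i * B) * (case p of (s, x) \<Rightarrow> indicator {0..1::real} s * u' (x + s *\<^sub>R 0)))"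
        by (intro integrable_mult_right integrable_unit_interval_times u')
      show "AE p in lborel \<Otimes>\<^sub>M lborel. norm (case p of (s, x) \<Rightarrow> indicator {0..1::real} s * (v $ i * P i (x - s *\<^sub>R v) * u' x))
          \<le> norm ((v $ i * B) * (case p of (s, x) \<Rightarrow> indicator {0..1::real} s * u' (x + s *\<^sub>R 0)))"
        using B(1,3) by (intro AE_I2) (auto simp: abs_mult indicator_def intro!: mult_mono)
    qed measurable
    have uP': "integrable (lborel \<Otimes>\<^sub>M lborel) (\<lambda>(s, x). indicator {0..1::real} s * ((?P P x s) * u' x))"
    proof -
      have "integrable (lborel \<Otimes>\<^sub>M lborel) (\<lambda>p. \<Sum>i\<in>UNIV. case p of (s, x) \<Rightarrow> indicator {0..1::real} s * (v $ i * P i (x - s *\<^sub>R v) * u' x))"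
        by (intro Bochner_Integration.integrable_sum uP)
      then show ?thesis unfolding split_beta sum_distrib_left sum_distrib_right mult.assoc .
    qed
    \<comment> \<open>Integration by parts at a fixed s, followed by a change of variables that
      returns the test function to its place and shifts g instead.\<close>
    have step: "(\<integral>x. (?P P x s) * u' x \<partial>lborel)
       = - (\<Sum>i\<in>UNIV. v $ i * (\<integral>x. tensor \<phi> x * g' i (x + s *\<^sub>R v) \<partial>lborel))" if "s \<in> {0..1}" for s
    proof -
      have "(\<integral>x. (?P P x s) * u' x \<partial>lborel)
         = (\<integral>x. (\<Sum>i\<in>UNIV. v $ i * (P i (x - s *\<^sub>R v) * u' x)) \<partial>lborel)"
        by (simp add: sum_distrib_right mult.assoc)
      also have "\<dots> = (\<Sum>i\<in>UNIV. v $ i * (\<integral>x. P i (x - s *\<^sub>R v) * u' x \<partial>lborel))"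
        by (subst Bochner_Integration.integral_sum)
          (auto intro!: integrable_mult_right bdi u' B)
      also have "\<dots> = (\<Sum>i\<in>UNIV. v $ i * - (\<integral>x. tensor \<phi> x * g' i (x + s *\<^sub>R v) \<partial>lborel))"
      proof (intro sum.cong refl arg_cong2[where f = "(*)"])
        fix i
        have "(\<integral>x. P i (x - s *\<^sub>R v) * u' x \<partial>lborel) = - (\<integral>x. tensor \<phi> (x - s *\<^sub>R v) * g' i x \<partial>lborel)"
          unfolding P_def using that
          by (intro weak_deriv_tens_shift[OF sw C uv gv _ \<phi> d] seg) auto
        also have "(\<integral>x. tensor \<phi> (x - s *\<^sub>R v) * g' i x \<partial>lborel) = (\<integral>x. tensor \<phi> x * g' i (x + s *\<^sub>R v) \<partial>lborel)"
          using lborel_integral_shift[of "\<lambda>x. tensor \<phi> (x - s *\<^sub>R v) * g' i x" "s *\<^sub>R v"] by simp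
        finally show "(\<integral>x. P i (x - s *\<^sub>R v) * u' x \<partial>lborel) = - (\<integral>x. tensor \<phi> x * g' i (x + s *\<^sub>R v) \<partial>lborel)" .
      qed
      finally show ?thesis by (simp add: sum_negf)
    qed
    have gP: "integrable (lborel \<Otimes>\<^sub>M lborel) (\<lambda>(s, x). tensor \<phi> x * (indicator {0..1::real} s * g' i (x + s *\<^sub>R v)))" for i
    proof (rule Bochner_Integration.integrable_bound)
      show "integrable (lborel \<Otimes>\<^sub>M lborel) (\<lambda>p. B * (case p of (s, x) \<Rightarrow> indicator {0..1::real} s * g' i (x + s *\<^sub>R v)))"
        by (intro integrable_mult_right gint)
      show "AE p in lborel \<Otimes>\<^sub>M lborel. norm (case p of (s, x) \<Rightarrow> tensor \<phi> x * (indicator {0..1::real} s * g' i (x + s *\<^sub>R v)))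
          \<le> norm (B * (case p of (s, x) \<Rightarrow> indicator {0..1::real} s * g' i (x + s *\<^sub>R v)))"
        using B(1,2) by (intro AE_I2) (auto simp: abs_mult indicator_def intro!: mult_mono)
    qed measurable
    have ush': "integrable lborel (\<lambda>x. tensor \<phi> (x - v) * u' x)"
      by (intro bdi B u') simp
    have "(\<integral>x. tensor \<phi> x * (u' (x + v) - u' x) \<partial>lborel)
       = (\<integral>x. tensor \<phi> x * u' (x + v) \<partial>lborel) - (\<integral>x. tensor \<phi> x * u' x \<partial>lborel)"
      by (simp add: right_diff_distrib bdi B u' ush)
    also have "(\<integral>x. tensor \<phi> x * u' (x + v) \<partial>lborel) = (\<integral>x. tensor \<phi> (x - v) * u' x \<partial>lborel)"
      using lborel_integral_shift[of "\<lambda>x. tensor \<phi> (x - v) * u' x" v] by simp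
    also have "(\<integral>x. tensor \<phi> (x - v) * u' x \<partial>lborel) - (\<integral>x. tensor \<phi> x * u' x \<partial>lborel)
      = (\<integral>x. (tensor \<phi> (x - v) - tensor \<phi> x) * u' x \<partial>lborel)"
      by (simp add: left_diff_distrib bdi B u' ush')
    also have "\<dots> = - (\<integral>x. (\<integral>s. indicator {0..1} s * ((?P P x s) * u' x) \<partial>lborel) \<partial>lborel)"
      unfolding tensor_segment[OF d s \<phi>(1)] P_def[symmetric]
      by (simp flip: mult.assoc)
    also have "\<dots> = - (\<integral>s. (\<integral>x. indicator {0..1} s * ((?P P x s) * u' x) \<partial>lborel) \<partial>lborel)"
      by (subst lborel_pair.Fubini_integral[OF uP']) simp
    also have "\<dots> = - (\<integral>s. - (\<Sum>i\<in>UNIV. v $ i * (\<integral>x. tensor \<phi> x * (indicator {0..1} s * g' i (x + s *\<^sub>R v)) \<partial>lborel)) \<partial>lborel)"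
    proof (intro arg_cong[where f = uminus] Bochner_Integration.integral_cong refl)
      fix s :: real
      show "(\<integral>x. indicator {0..1} s * ((?P P x s) * u' x) \<partial>lborel) =
         - (\<Sum>i\<in>UNIV. v $ i * (\<integral>x. tensor \<phi> x * (indicator {0..1} s * g' i (x + s *\<^sub>R v)) \<partial>lborel))"
        using step[of s] by (cases "s \<in> {0..1}") auto
    qed
    also have "\<dots> = (\<Sum>i\<in>UNIV. v $ i * (\<integral>s. (\<integral>x. tensor \<phi> x * (indicator {0..1} s * g' i (x + s *\<^sub>R v)) \<partial>lborel) \<partial>lborel))"
      using lborel_pair.integrable_fst[OF gP]
      by (simp add: Bochner_Integration.integral_sum)
    also have "\<dots> = (\<Sum>i\<in>UNIV. v $ i * (\<integral>x. (\<integral>s. tensor \<phi> x * (indicator {0..1} s * g' i (x + s *\<^sub>R v)) \<partial>lborel) \<partial>lborel))"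
      by (subst lborel_pair.Fubini_integral[OF gP]) simp
    also have "\<dots> = (\<Sum>i\<in>UNIV. \<integral>x. v $ i * (tensor \<phi> x * (\<integral>s. indicator {0..1} s * g' i (x + s *\<^sub>R v) \<partial>lborel)) \<partial>lborel)"
      by simp
    also have "\<dots> = (\<integral>x. (\<Sum>i\<in>UNIV. v $ i * (tensor \<phi> x * (\<integral>s. indicator {0..1} s * g' i (x + s *\<^sub>R v) \<partial>lborel))) \<partial>lborel)"
    proof (rule Bochner_Integration.integral_sum[symmetric])
      fix i
      show "integrable lborel (\<lambda>x. v $ i * (tensor \<phi> x * (\<integral>s. indicator {0..1} s * g' i (x + s *\<^sub>R v) \<partial>lborel)))"
        using lborel_pair.integrable_snd[OF gP] by (intro integrable_mult_right) simp
    qed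
    also have "\<dots> = (\<integral>x. tensor \<phi> x * T x \<partial>lborel)"
      unfolding T_def sum_distrib_left by (simp add: mult.left_commute)
    finally show "(\<integral>x. tensor \<phi> x * (u' (x + v) - u' x - T x) \<partial>lborel) = 0"
      by (simp add: right_diff_distrib[of _ _ "T _"] bdi B u' ush Tint)
  qed
  then show ?thesis by eventually_elim (auto simp: T_def)
qed

section \<open>Bounded weak gradients on Lipschitz domains\<close>

text \<open>By Lindelof's theorem countably many of the neighbourhoods cover U, and countably many
  null sets unite to a null set.\<close>

lemma AE_lborel_local:
  fixes P :: "real^'n \<Rightarrow> bool"
  assumes "\<And>x. x \<in> U \<Longrightarrow> \<exists>V. open V \<and> x \<in> V \<and> (AE y in lborel. y \<in> V \<longrightarrow> P y)"
  shows "AE y in lborel. y \<in> U \<longrightarrow> P y"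
proof -
  define F where "F = {V. open V \<and> (AE y in lborel. y \<in> V \<longrightarrow> P y)}"
  obtain F' where F': "F' \<subseteq> F" "countable F'" "\<Union>F' = \<Union>F"
    by (rule Lindelof[of F]) (auto simp: F_def)
  have "AE y in lborel. \<forall>V\<in>F'. y \<in> V \<longrightarrow> P y"
    using F' by (subst AE_ball_countable) (auto simp: F_def)
  moreover have "U \<subseteq> \<Union>F'" using assms unfolding F'(3) F_def by blast
  ultimately show ?thesis by (auto elim!: eventually_mono)
qed

lemma weak_deriv_integrable:
  "weak_deriv \<Omega> u i g \<Longrightarrow> compact K \<Longrightarrow> K \<subseteq> \<Omega> \<Longrightarrow> set_integrable lebesgue K u"
  "weak_deriv \<Omega> u i g \<Longrightarrow> compact K \<Longrightarrow> K \<subseteq> \<Omega> \<Longrightarrow> set_integrable lebesgue K g"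
  by (auto simp: weak_deriv_def)

text \<open>Both integral identities have the same left side, so g - h is orthogonal to all product
  test functions on a small box. This later identifies the choice made in \<open>weak_grad\<close>
  with a gradient obtained as a limit.\<close>

lemma weak_deriv_unique:
  fixes u :: "real^'n \<Rightarrow> real"
  assumes "open \<Omega>" and g: "weak_deriv \<Omega> u i g" and h: "weak_deriv \<Omega> u i h"
  shows "AE x in lborel. x \<in> \<Omega> \<longrightarrow> g x = h x"
proof (rule AE_lborel_local)
  fix x assume "x \<in> \<Omega>"
  then obtain a b where ab: "cbox a b \<subseteq> \<Omega>" "x \<in> box a b"
    using open_contains_cbox[OF \<open>open \<Omega>\<close>] by metis
  obtain g' where gv: "borel_version (cbox a b) g g'"
    using borel_version_ex[OF weak_deriv_integrable(2)[OF g compact_cbox ab(1)] compact_cbox] by blast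
  note g' = borel_versionD[OF gv]
  obtain h' where hv: "borel_version (cbox a b) h h'"
    using borel_version_ex[OF weak_deriv_integrable(2)[OF h compact_cbox ab(1)] compact_cbox] by blast
  note h' = borel_versionD[OF hv]
  have "AE x in lborel. x \<in> box a b \<longrightarrow> g' x - h' x = 0"
  proof (rule tensor_test_imp_AE_zero)
    show "integrable lborel (\<lambda>x. g' x - h' x)" using g' h' by auto
    fix \<phi> :: "'n \<Rightarrow> real \<Rightarrow> real"
    assume \<phi>: "\<And>j. smooth_real (\<phi> j)" "\<And>j t. t \<notin> {a $ j<..<b $ j} \<Longrightarrow> \<phi> j t = 0"
    have tf: "test_function \<Omega> (tensor \<phi>)" by (rule test_function_tensor[OF \<phi> ab(1)])
    have m: "tensor \<phi> \<in> borel_measurable borel"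
      by (intro borel_measurable_continuous_onI continuous_on_tensor smooth_real_continuous \<phi>)
    have z: "tensor \<phi> x = 0" if "x \<notin> cbox a b" for x
      using tensor_support[of a b \<phi> x] \<phi>(2) that box_subset_cbox[of a b] by blast
    have eq: "(LINT x:\<Omega>|lebesgue. tensor \<phi> x * g x) = (LINT x:\<Omega>|lebesgue. tensor \<phi> x * h x)"
      using g h tf unfolding weak_deriv_def by (metis neg_equal_iff_equal)
    have "(\<integral>x. tensor \<phi> x * g' x \<partial>lborel) = (\<integral>x. tensor \<phi> x * h' x \<partial>lborel)"
      using eq lebesgue_integral_borel_version[OF gv weak_deriv_integrable(2)[OF g compact_cbox ab(1)] m z ab(1)]
        lebesgue_integral_borel_version[OF hv weak_deriv_integrable(2)[OF h compact_cbox ab(1)] m z ab(1)] by simp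
    moreover have "integrable lborel (\<lambda>x. tensor \<phi> x * f x)" if "integrable lborel f" for f
    proof -
      obtain B where "\<And>x. \<bar>tensor \<phi> x\<bar> \<le> B" "0 \<le> B" by (rule test_functionE[OF tf]) metis
      then have "norm (tensor \<phi> x * f x) \<le> norm (B * f x)" for x
        by (simp add: abs_mult mult_right_mono)
      then show ?thesis
        using m that borel_measurable_integrable[OF that]
        by (intro Bochner_Integration.integrable_bound[OF integrable_mult_right[OF that, of B] _ AE_I2]) auto
    qed
    ultimately show "(\<integral>x. tensor \<phi> x * (g' x - h' x) \<partial>lborel) = 0"
      using g' h' by (simp add: right_diff_distrib)
  qed
  then have "AE x in lborel. x \<in> box a b \<longrightarrow> g x = h x"
    using g'(3) h'(3) by eventually_elim (use box_subset_cbox[of a b] in auto)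
  then show "\<exists>V. open V \<and> x \<in> V \<and> (AE y in lborel. y \<in> V \<longrightarrow> g y = h y)"
    using ab open_box by blast
qed

text \<open>The translation formula turns a bound on the derivatives into a Lipschitz estimate along
  segments in \<Omega>. The argument is local in the starting point, because the formula needs one
  compact subset of \<Omega> that holds all segments starting in a box.\<close>

lemma weak_deriv_translate_le:
  fixes u :: "real^'n \<Rightarrow> real"
  assumes "open \<Omega>" and sw: "\<And>i. weak_deriv \<Omega> u i (g i)" and M: "0 \<le> M"
    and bd: "\<And>i. AE x in lborel. x \<in> \<Omega> \<longrightarrow> \<bar>g i x\<bar> \<le> M"
  shows "AE x in lborel. x \<in> {x. \<forall>s\<in>{0..1}. x + s *\<^sub>R v \<in> \<Omega>} \<longrightarrow>
    \<bar>u (x + v) - u x\<bar> \<le> M * (\<Sum>i\<in>UNIV. \<bar>v $ i\<bar>)"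
proof (rule AE_lborel_local)
  fix x0 assume x0: "x0 \<in> {x. \<forall>s\<in>{0..1}. x + s *\<^sub>R v \<in> \<Omega>}"
  define L where "L = (\<lambda>s. x0 + s *\<^sub>R v) ` {0..1}"
  have "compact L" unfolding L_def
    by (intro compact_continuous_image continuous_intros) auto
  moreover have "L \<subseteq> \<Omega>" using x0 by (auto simp: L_def)
  ultimately obtain e where e: "e > 0" "(\<Union>x\<in>L. ball x e) \<subseteq> \<Omega>"
    using compact_subset_open_imp_ball_epsilon_subset \<open>open \<Omega>\<close> by metis
  obtain a b where ab: "cbox a b \<subseteq> ball x0 e" "x0 \<in> box a b"
    using open_contains_cbox[of "ball x0 e" x0] e(1) by (metis centre_in_ball open_ball)
  define C where "C = (\<lambda>(x, s). x + s *\<^sub>R v) ` (cbox a b \<times> {0..1})"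
  have C: "compact C" unfolding C_def split_beta
    by (intro compact_continuous_image continuous_intros compact_Times) auto
  have C\<Omega>: "C \<subseteq> \<Omega>"
  proof
    fix y assume "y \<in> C"
    then obtain x s where xs: "x \<in> cbox a b" "s \<in> {0..1}" "y = x + s *\<^sub>R v" by (auto simp: C_def)
    then have "x0 + s *\<^sub>R v \<in> L" by (auto simp: L_def)
    moreover have "y \<in> ball (x0 + s *\<^sub>R v) e" using xs ab by (auto simp: dist_norm)
    ultimately show "y \<in> \<Omega>" using e by blast
  qed
  have seg: "x + s *\<^sub>R v \<in> C" if "x \<in> cbox a b" "0 \<le> s" "s \<le> 1" for x s
    using that unfolding C_def by (intro image_eqI[of _ _ "(x, s)"]) auto
  obtain u' where uv: "borel_version C u u'"
    using borel_version_ex[OF weak_deriv_integrable(1)[OF sw C C\<Omega>] C] by blast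
  note u' = borel_versionD[OF uv]
  have "\<exists>g'. borel_version C (g i) g' \<and> (\<forall>x. \<bar>g' x\<bar> \<le> M)" for i
  proof -
    obtain h where hv: "borel_version C (g i) h"
      using borel_version_ex[OF weak_deriv_integrable(2)[OF sw C C\<Omega>] C] by blast
    note h = borel_versionD[OF hv]
    \<comment> \<open>Truncation at M changes nothing almost everywhere on C and bounds the
      representative at every point, so its integral along the segment is bounded for each
      x.\<close>
    define g' where "g' x = max (- M) (min M (h x))" for x
    have "integrable lborel g'"
      by (rule Bochner_Integration.integrable_bound[OF h(1)])
        (use borel_measurable_integrable[OF h(1)] M in \<open>auto simp: g'_def[abs_def]\<close>)
    moreover have "AE x in lborel. x \<in> C \<longrightarrow> g' x = g i x"
      using h(3) bd[of i] by eventually_elim (use C\<Omega> in \<open>auto simp: g'_def\<close>)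
    ultimately show ?thesis using h(2) M by (intro exI[of _ g']) (auto simp: g'_def borel_version_def)
  qed
  then obtain g' where gv: "\<And>i. borel_version C (g i) (g' i)" and g'M: "\<And>i x. \<bar>g' i x\<bar> \<le> M" by metis
  have "\<bar>\<Sum>i\<in>UNIV. v $ i * (\<integral>s. indicator {0..1} s * g' i (x + s *\<^sub>R v) \<partial>lborel)\<bar> \<le> M * (\<Sum>i\<in>UNIV. \<bar>v $ i\<bar>)" for x
  proof -
    have I: "\<bar>\<integral>s. indicator {0..1::real} s * g' i (x + s *\<^sub>R v) \<partial>lborel\<bar> \<le> M" for i
    proof -
      have "\<bar>\<integral>s. indicator {0..1::real} s * g' i (x + s *\<^sub>R v) \<partial>lborel\<bar> \<le> (\<integral>s. indicator {0..1::real} s * M \<partial>lborel)"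
      proof (cases "integrable lborel (\<lambda>s. indicator {0..1::real} s * g' i (x + s *\<^sub>R v))")
        case True
        have "norm (\<integral>s. indicator {0..1::real} s * g' i (x + s *\<^sub>R v) \<partial>lborel)
          \<le> (\<integral>s. norm (indicator {0..1::real} s * g' i (x + s *\<^sub>R v)) \<partial>lborel)"
          by (rule integral_norm_bound)
        also have "(\<integral>s. norm (indicator {0..1::real} s * g' i (x + s *\<^sub>R v)) \<partial>lborel) \<le> (\<integral>s. indicator {0..1::real} s * M \<partial>lborel)"
          using True by (intro integral_mono integrable_norm integrable_mult_left integrable_real_indicator)
            (auto simp: abs_mult indicator_def g'M)
        finally show ?thesis unfolding real_norm_def .
      next
        \<comment> \<open>The Bochner integral of a non-integrable function is 0, so the bound
          persists.\<close>
        case False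
        then show ?thesis using M by (simp add: not_integrable_integral_eq)
      qed
      then show ?thesis by simp
    qed
    have "\<bar>\<Sum>i\<in>UNIV. v $ i * (\<integral>s. indicator {0..1} s * g' i (x + s *\<^sub>R v) \<partial>lborel)\<bar>
      \<le> (\<Sum>i\<in>UNIV. \<bar>v $ i\<bar> * M)"
      by (intro sum_abs[THEN order_trans] sum_mono) (auto simp: abs_mult intro!: mult_left_mono I)
    then show ?thesis by (simp add: sum_distrib_left mult.commute)
  qed note bnd = this
  have "AE x in lborel. x \<in> box a b \<longrightarrow>
      u' (x + v) - u' x = (\<Sum>i\<in>UNIV. v $ i * (\<integral>s. indicator {0..1} s * g' i (x + s *\<^sub>R v) \<partial>lborel))"
    by (rule weak_deriv_translate[OF sw C C\<Omega> uv gv]) (rule seg)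
  then have "AE x in lborel. x \<in> box a b \<longrightarrow> \<bar>u (x + v) - u x\<bar> \<le> M * (\<Sum>i\<in>UNIV. \<bar>v $ i\<bar>)"
    using u'(3) AE_lborel_shift[OF u'(3), of v]
  proof eventually_elim
    case (elim x)
    show ?case
    proof
      assume x: "x \<in> box a b"
      then have "x \<in> C" "x + v \<in> C"
        using seg[of x 0] seg[of x 1] box_subset_cbox by auto
      then show "\<bar>u (x + v) - u x\<bar> \<le> M * (\<Sum>i\<in>UNIV. \<bar>v $ i\<bar>)" using elim x bnd[of x] by auto
    qed
  qed
  then show "\<exists>V. open V \<and> x0 \<in> V \<and> (AE x in lborel. x \<in> V \<longrightarrow> \<bar>u (x + v) - u x\<bar> \<le> M * (\<Sum>i\<in>UNIV. \<bar>v $ i\<bar>))"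
    using ab open_box by blast
qed

text \<open>For almost every x in a box, |u(x)| is at most |u(y)| plus the largest possible
  oscillation, for almost every y. Averaging over y replaces |u(y)| by a mean, which is finite
  because u is locally integrable.\<close>

lemma weak_deriv_locally_bounded:
  fixes u :: "real^'n \<Rightarrow> real"
  assumes "open \<Omega>" and sw: "\<And>i. weak_deriv \<Omega> u i (g i)" and M: "0 \<le> M"
    and bd: "\<And>i. AE x in lborel. x \<in> \<Omega> \<longrightarrow> \<bar>g i x\<bar> \<le> M"
    and "x0 \<in> \<Omega>"
  shows "\<exists>V B. open V \<and> x0 \<in> V \<and> (AE y in lborel. y \<in> V \<longrightarrow> \<bar>u y\<bar> \<le> B)"
proof -
  obtain a b where ab: "cbox a b \<subseteq> \<Omega>" "x0 \<in> box a b"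
    using open_contains_cbox[OF \<open>open \<Omega>\<close> \<open>x0 \<in> \<Omega>\<close>] by metis
  obtain u' where uv: "borel_version (cbox a b) u u'"
    using borel_version_ex[OF weak_deriv_integrable(1)[OF sw compact_cbox ab(1)] compact_cbox] by blast
  note u' = borel_versionD[OF uv]
  have [measurable]: "u' \<in> borel_measurable borel" using u' by auto
  \<comment> \<open>M times the sum of the side lengths bounds the change of u under every
    displacement within the box.\<close>
  define K where "K = M * (\<Sum>i\<in>UNIV. b $ i - a $ i)"
  have D: "AE x in lborel. x \<in> box a b \<and> x + h \<in> box a b \<longrightarrow> \<bar>u' (x + h) - u' x\<bar> \<le> K" for h
    using weak_deriv_translate_le[OF assms(1-4), of h] u'(3) AE_lborel_shift[OF u'(3), of h]
  proof eventually_elim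
    case (elim x)
    show ?case
    proof
      assume x: "x \<in> box a b \<and> x + h \<in> box a b"
      then have xc: "x \<in> cbox a b" "x + h \<in> cbox a b" using box_subset_cbox by auto
      have "x + s *\<^sub>R h \<in> cbox a b" if "s \<in> {0..1}" for s
      proof -
        have "(1 - s) *\<^sub>R x + s *\<^sub>R (x + h) \<in> cbox a b"
          using xc that by (intro convexD convex_box) auto
        then show ?thesis by (simp add: algebra_simps)
      qed
      then have "x \<in> {x. \<forall>s\<in>{0..1}. x + s *\<^sub>R h \<in> \<Omega>}" using ab by auto
      then have "\<bar>u (x + h) - u x\<bar> \<le> M * (\<Sum>i\<in>UNIV. \<bar>h $ i\<bar>)" using elim by blast
      also have "\<dots> \<le> K" unfolding K_def
      proof (intro mult_left_mono sum_mono M)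
        fix i
        have "a $ i \<le> x $ i" "x $ i \<le> b $ i" "a $ i \<le> x $ i + h $ i" "x $ i + h $ i \<le> b $ i"
          using xc by (auto simp: mem_box_cart)
        then show "\<bar>h $ i\<bar> \<le> b $ i - a $ i" by linarith
      qed
      finally show "\<bar>u' (x + h) - u' x\<bar> \<le> K" using elim xc by auto
    qed
  qed
  \<comment> \<open>The null set in \<open>D\<close> depends on the displacement h. Exchanging the
    quantifiers yields instead a null set of points x, outside of which almost every h is
    admissible.\<close>
  have "(AE h in lborel. AE x in lborel. x \<in> box a b \<and> x + h \<in> box a b \<longrightarrow> \<bar>u' (x + h) - u' x\<bar> \<le> K) \<longleftrightarrow>
    (AE x in lborel. AE h in lborel. x \<in> box a b \<and> x + h \<in> box a b \<longrightarrow> \<bar>u' (x + h) - u' x\<bar> \<le> K)"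
    by (rule lborel_pair.AE_commute) measurable
  then have AE: "AE x in lborel. AE h in lborel. x \<in> box a b \<and> x + h \<in> box a b \<longrightarrow> \<bar>u' (x + h) - u' x\<bar> \<le> K"
    using D by simp
  define V where "V = measure lborel (box a b)"
  have V: "V > 0"
    using ab(2) unfolding V_def by (subst measure_lborel_box_eq) (auto simp: mem_box algebra_simps intro!: prod_pos less_imp_le)
  define I where "I = (\<integral>x. \<bar>u' x\<bar> \<partial>lborel)"
  have "AE x in lborel. x \<in> box a b \<longrightarrow> \<bar>u' x\<bar> \<le> I / V + K"
    using AE
  proof eventually_elim
    case (elim x)
    show ?case
    proof
      assume x: "x \<in> box a b"
      have y: "AE y in lborel. y \<in> box a b \<longrightarrow> \<bar>u' y - u' x\<bar> \<le> K"
        using AE_lborel_shift[OF elim, of "- x"] by eventually_elim (use x in auto)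
      have i1: "integrable lborel (\<lambda>y. indicator (box a b) y * \<bar>u' y\<bar>)"
        using integrable_mult_indicator[OF _ integrable_abs[OF u'(1)], of "box a b"] by simp
      have i2: "integrable lborel (\<lambda>y. indicator (box a b) y * c)" for c :: real
        by (intro integrable_mult_left integrable_real_indicator) (auto simp: emeasure_lborel_box_eq)
      have "\<bar>u' x\<bar> * V = (\<integral>y. indicator (box a b) y * \<bar>u' x\<bar> \<partial>lborel)"
        by (simp add: V_def)
      also have "\<dots> \<le> (\<integral>y. indicator (box a b) y * \<bar>u' y\<bar> + indicator (box a b) y * K \<partial>lborel)"
        using y by (intro integral_mono_AE i1 i2 Bochner_Integration.integrable_add)
          (auto elim!: eventually_mono simp: indicator_def)
      also have "\<dots> = (\<integral>y. indicator (box a b) y * \<bar>u' y\<bar> \<partial>lborel) + (\<integral>y. indicator (box a b) y * K \<partial>lborel)"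
        by (rule Bochner_Integration.integral_add[OF i1 i2])
      also have "(\<integral>y. indicator (box a b) y * K \<partial>lborel) = K * V" by (simp add: V_def)
      also have "(\<integral>y. indicator (box a b) y * \<bar>u' y\<bar> \<partial>lborel) \<le> I"
        unfolding I_def using u'(1) by (intro integral_mono i1) (auto simp: indicator_def)
      finally show "\<bar>u' x\<bar> \<le> I / V + K" using V by (simp add: field_simps)
    qed
  qed
  then have "AE x in lborel. x \<in> box a b \<longrightarrow> \<bar>u x\<bar> \<le> I / V + K"
    using u'(3) by eventually_elim (use box_subset_cbox[of a b] in auto)
  then show ?thesis using ab open_box by blast
qed

text \<open>A finite subcover yields one bound. The local estimates concern only points of \<Omega>,
  so that neighbourhoods of boundary points may stick out of it.\<close>

lemma locally_bounded_imp_bounded_compact: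
  fixes u :: "real^'n \<Rightarrow> real"
  assumes "compact K" "\<And>x. x \<in> K \<Longrightarrow> \<exists>V B. open V \<and> x \<in> V \<and> (AE y in lborel. y \<in> V \<and> y \<in> \<Omega> \<longrightarrow> \<bar>u y\<bar> \<le> B)"
  shows "\<exists>B. AE y in lborel. y \<in> K \<and> y \<in> \<Omega> \<longrightarrow> \<bar>u y\<bar> \<le> B"
proof -
  define Q where "Q x V B \<longleftrightarrow> open V \<and> x \<in> V \<and> (AE y in lborel. y \<in> V \<and> y \<in> \<Omega> \<longrightarrow> \<bar>u y\<bar> \<le> B)" for x V B
  have "\<forall>x. \<exists>V B. x \<in> K \<longrightarrow> Q x V B" using assms(2) unfolding Q_def by blast
  then obtain V B where Q: "\<And>x. x \<in> K \<Longrightarrow> Q x (V x) (B x)" by metis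
  have VB: "\<And>x. x \<in> K \<Longrightarrow> open (V x)" "\<And>x. x \<in> K \<Longrightarrow> x \<in> V x"
    "\<And>x. x \<in> K \<Longrightarrow> AE y in lborel. y \<in> V x \<and> y \<in> \<Omega> \<longrightarrow> \<bar>u y\<bar> \<le> B x"
    using Q unfolding Q_def by blast+
  obtain T where T: "T \<subseteq> K" "finite T" "K \<subseteq> (\<Union>x\<in>T. V x)"
  proof (rule compactE_image[OF assms(1), of K V])
    show "K \<subseteq> (\<Union>x\<in>K. V x)" using VB(2) by auto
  qed (use VB(1) in auto)
  have "AE y in lborel. \<forall>x\<in>T. y \<in> V x \<and> y \<in> \<Omega> \<longrightarrow> \<bar>u y\<bar> \<le> B x"
    using T VB(3) by (subst AE_ball_countable) (auto intro: countable_finite)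
  then have "AE y in lborel. y \<in> K \<and> y \<in> \<Omega> \<longrightarrow> \<bar>u y\<bar> \<le> (\<Sum>x\<in>T. \<bar>B x\<bar>)"
  proof eventually_elim
    case (elim y)
    show ?case
    proof
      assume y: "y \<in> K \<and> y \<in> \<Omega>"
      then obtain x where "x \<in> T" "y \<in> V x" using T by auto
      then have "\<bar>u y\<bar> \<le> \<bar>B x\<bar>" using elim y by fastforce
      also have "\<dots> \<le> (\<Sum>x\<in>T. \<bar>B x\<bar>)" using \<open>x \<in> T\<close> T by (intro member_le_sum) auto
      finally show "\<bar>u y\<bar> \<le> (\<Sum>x\<in>T. \<bar>B x\<bar>)" .
    qed
  qed
  then show ?thesis by blast
qed

text \<open>
  In a boundary chart the shift by \<open>-(r/2) e\<close> moves all points near \<open>x0\<close> into a compact subset of \<open>\<Omega>\<close>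
  along segments that stay in \<open>\<Omega>\<close>.
\<close>

lemma weak_deriv_bounded_near_boundary:
  fixes u :: "real^'n \<Rightarrow> real"
  assumes "open \<Omega>" and sw: "\<And>i. weak_deriv \<Omega> u i (g i)" and M: "0 \<le> M"
    and bd: "\<And>i. AE x in lborel. x \<in> \<Omega> \<longrightarrow> \<bar>g i x\<bar> \<le> M"
    and "lipschitz_boundary \<Omega>" "x0 \<in> frontier \<Omega>"
  shows "\<exists>V B. open V \<and> x0 \<in> V \<and> (AE y in lborel. y \<in> V \<and> y \<in> \<Omega> \<longrightarrow> \<bar>u y\<bar> \<le> B)"
proof -
  obtain r e \<gamma> L where r: "r > 0" and e: "norm e = 1" and lip: "L-lipschitz_on UNIV \<gamma>"
    and ch: "\<Omega> \<inter> ball x0 r = {y \<in> ball x0 r. y \<bullet> e < \<gamma> (y - (y \<bullet> e) *\<^sub>R e)}"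
    using bspec[OF assms(5)[unfolded lipschitz_boundary_def] assms(6)]
    by (elim exE conjE) (rule that)
  have ee: "e \<bullet> e = 1" using e by (simp add: norm_eq_1)
  define P where "P y = y - (y \<bullet> e) *\<^sub>R e" for y
  have cont: "continuous_on UNIV (\<lambda>y. \<gamma> (P y))"
    unfolding P_def
    by (rule continuous_on_compose2[OF lipschitz_on_continuous_on[OF lip]]) (auto intro!: continuous_intros)
  \<comment> \<open>Here 3r/4 = r/4 + r/2: a point within r/4 of x0, moved by at most r/2, stays in
    this closed ball and inside the chart. The margin r/2 below the graph makes the height condition
    closed, so Z is compact and still contained in \<Omega>.\<close>
  define Z where "Z = cball x0 (3 * r / 4) \<inter> {z. z \<bullet> e \<le> \<gamma> (P z) - r / 2}"
  have "compact Z" unfolding Z_def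
    by (intro compact_Int_closed compact_cball closed_Collect_le continuous_intros cont)
  have Z\<Omega>: "Z \<subseteq> \<Omega>"
  proof
    fix z assume "z \<in> Z"
    then have "z \<in> {y \<in> ball x0 r. y \<bullet> e < \<gamma> (y - (y \<bullet> e) *\<^sub>R e)}"
      using r by (auto simp: Z_def P_def)
    then show "z \<in> \<Omega>" using ch by blast
  qed
  have "\<exists>B. AE y in lborel. y \<in> Z \<and> y \<in> \<Omega> \<longrightarrow> \<bar>u y\<bar> \<le> B"
  proof (rule locally_bounded_imp_bounded_compact[OF \<open>compact Z\<close>])
    fix x assume "x \<in> Z"
    then obtain V B where "open V" "x \<in> V" "AE y in lborel. y \<in> V \<longrightarrow> \<bar>u y\<bar> \<le> B"
      using weak_deriv_locally_bounded[OF assms(1-4)] Z\<Omega> by blast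
    then show "\<exists>V B. open V \<and> x \<in> V \<and> (AE y in lborel. y \<in> V \<and> y \<in> \<Omega> \<longrightarrow> \<bar>u y\<bar> \<le> B)"
      by (intro exI[of _ V] exI[of _ B]) auto
  qed
  then obtain B where B: "AE y in lborel. y \<in> Z \<and> y \<in> \<Omega> \<longrightarrow> \<bar>u y\<bar> \<le> B" by blast
  define v where "v = - (r / 2) *\<^sub>R e"
  \<comment> \<open>Moving along e changes the height of a point but not its projection, hence not
    the height of the graph above or below it.\<close>
  have P: "P (y + s *\<^sub>R v) = P y" "(y + s *\<^sub>R v) \<bullet> e = y \<bullet> e - s * r / 2" for y s
    by (simp_all add: P_def v_def ee inner_add_left inner_diff_left algebra_simps)
  have "AE y in lborel. y \<in> ball x0 (r / 4) \<and> y \<in> \<Omega> \<longrightarrow> \<bar>u y\<bar> \<le> B + M * (\<Sum>i\<in>UNIV. \<bar>v $ i\<bar>)"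
    using AE_lborel_shift[OF B, of v] weak_deriv_translate_le[OF assms(1-4), of v]
  proof eventually_elim
    case (elim y)
    show ?case
    proof
      assume y: "y \<in> ball x0 (r / 4) \<and> y \<in> \<Omega>"
      then have "y \<in> \<Omega> \<inter> ball x0 r" using r by auto
      then have yg: "y \<bullet> e < \<gamma> (P y)" using ch by (auto simp: P_def)
      have dist: "dist x0 (y + s *\<^sub>R v) \<le> 3 * r / 4" if "s \<in> {0..1}" for s
      proof -
        have "dist x0 (y + s *\<^sub>R v) \<le> dist x0 y + norm (s *\<^sub>R v)"
          using norm_triangle_ineq4[of "x0 - y" "s *\<^sub>R v"] by (simp add: dist_norm algebra_simps)
        also have "norm (s *\<^sub>R v) \<le> 1 * (r / 2)"
          using that r e by (simp add: v_def mult_mono)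
        finally show ?thesis using y by simp
      qed
      have in\<Omega>: "y + s *\<^sub>R v \<in> \<Omega>" if "s \<in> {0..1}" for s
      proof -
        have "0 \<le> s * r / 2" using that r by simp
        then have "y + s *\<^sub>R v \<in> {y \<in> ball x0 r. y \<bullet> e < \<gamma> (y - (y \<bullet> e) *\<^sub>R e)}"
          using dist[OF that] r yg P[of y s] by (auto simp: P_def[symmetric])
        then show ?thesis using ch by blast
      qed
      have "y + v \<in> Z" using dist[of 1] yg P[of y 1] by (simp add: Z_def)
      then have "\<bar>u (y + v)\<bar> \<le> B" using elim(1) in\<Omega>[of 1] by simp
      moreover have "\<bar>u (y + v) - u y\<bar> \<le> M * (\<Sum>i\<in>UNIV. \<bar>v $ i\<bar>)"
        using elim(2) in\<Omega> by blast
      ultimately show "\<bar>u y\<bar> \<le> B + M * (\<Sum>i\<in>UNIV. \<bar>v $ i\<bar>)" by linarith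
    qed
  qed
  then show ?thesis
    using r by (intro exI[of _ "ball x0 (r / 4)"] exI[of _ "B + M * (\<Sum>i\<in>UNIV. \<bar>v $ i\<bar>)"]) auto
qed

lemma weak_deriv_bounded:
  fixes u :: "real^'n \<Rightarrow> real"
  assumes "open \<Omega>" and sw: "\<And>i. weak_deriv \<Omega> u i (g i)" and M: "0 \<le> M"
    and bd: "\<And>i. AE x in lborel. x \<in> \<Omega> \<longrightarrow> \<bar>g i x\<bar> \<le> M"
    and "lipschitz_boundary \<Omega>" "bounded \<Omega>"
  shows "\<exists>B. AE y in lborel. y \<in> \<Omega> \<longrightarrow> \<bar>u y\<bar> \<le> B"
proof -
  have "\<exists>B. AE y in lborel. y \<in> closure \<Omega> \<and> y \<in> \<Omega> \<longrightarrow> \<bar>u y\<bar> \<le> B"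
  proof (rule locally_bounded_imp_bounded_compact)
    show "compact (closure \<Omega>)" using assms(6) by (simp add: compact_closure)
    fix x assume "x \<in> closure \<Omega>"
    then consider "x \<in> \<Omega>" | "x \<in> frontier \<Omega>"
      using closure_Un_frontier by blast
    then show "\<exists>V B. open V \<and> x \<in> V \<and> (AE y in lborel. y \<in> V \<and> y \<in> \<Omega> \<longrightarrow> \<bar>u y\<bar> \<le> B)"
    proof cases
      case 1
      then obtain V B where "open V" "x \<in> V" "AE y in lborel. y \<in> V \<longrightarrow> \<bar>u y\<bar> \<le> B"
        using weak_deriv_locally_bounded[OF assms(1-4)] by blast
      then show ?thesis by (intro exI[of _ V] exI[of _ B]) auto
    next
      case 2
      then show ?thesis using weak_deriv_bounded_near_boundary[OF assms(1-5)] by blast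
    qed
  qed
  then obtain B where B: "AE y in lborel. y \<in> closure \<Omega> \<and> y \<in> \<Omega> \<longrightarrow> \<bar>u y\<bar> \<le> B" by blast
  show ?thesis
    using B closure_subset[of \<Omega>] by (intro exI[of _ B]) (auto elim!: eventually_mono)
qed

section \<open>Poincare's inequality on boxes\<close>

lemma AE_cbox_imp_box: "AE x in lborel. x \<in> cbox a b \<longrightarrow> x \<in> box a (b :: real^'n)"
proof -
  have "negligible (cbox a b - box a b)" by (rule negligible_frontier_interval)
  then have "cbox a b - box a b \<in> null_sets lborel"
    by (subst null_sets_completion_iff[symmetric]) (auto simp: negligible_iff_null_sets)
  from AE_not_in[OF this] show ?thesis by eventually_elim auto
qed

text \<open>Only points with both x and x + h in the box count, and convexity keeps the segments
  between them inside. Nonnegative integrals allow the order of integration to be exchanged with no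
  integrability to check.\<close>

lemma weak_deriv_translate_nn_integral:
  fixes w w' :: "real^'n \<Rightarrow> real"
  assumes sw: "\<And>i. weak_deriv \<Omega> w i (g i)" and ab: "cbox a b \<subseteq> \<Omega>"
    and wv: "borel_version (cbox a b) w w'" and gv: "\<And>i. borel_version (cbox a b) (g i) (g' i)"
  shows "(\<integral>\<^sup>+x. ennreal \<bar>w' (x + h) - w' x\<bar> * (indicator (box a b) x * indicator (box a b) (x + h)) \<partial>lborel)
    \<le> (\<Sum>i\<in>UNIV. ennreal \<bar>h $ i\<bar> * (\<integral>\<^sup>+x. ennreal \<bar>g' i x\<bar> \<partial>lborel))"
proof -
  let ?J = "\<lambda>i x. (\<integral>\<^sup>+s. indicator {0..1} s * ennreal \<bar>g' i (x + s *\<^sub>R h)\<bar> \<partial>lborel)"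
  note w' = borel_versionD[OF wv] and g' = borel_versionD[OF gv]
  have [measurable]: "w' \<in> borel_measurable borel" "g' i \<in> borel_measurable borel" for i
    using w' g' by auto
  \<comment> \<open>The intersection of the box with its translate by -h.\<close>
  define a' b' where "a' = (\<chi> j. max (a $ j) (a $ j - h $ j))" "b' = (\<chi> j. min (b $ j) (b $ j - h $ j))"
  have box: "x \<in> box a' b'" if "x \<in> box a b" "x + h \<in> box a b" for x
    using that unfolding a'_b'_def mem_box_cart by (auto simp: less_diff_eq diff_less_eq)
  have seg: "x + s *\<^sub>R h \<in> cbox a b" if "x \<in> cbox a' b'" "0 \<le> s" "s \<le> 1" for x s
  proof -
    have "x \<in> cbox a b" "x + h \<in> cbox a b"
      using that(1) unfolding a'_b'_def mem_box_cart by (auto simp: le_diff_eq diff_le_eq)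
    then have "(1 - s) *\<^sub>R x + s *\<^sub>R (x + h) \<in> cbox a b"
      using that by (intro convexD convex_box) auto
    then show ?thesis by (simp add: algebra_simps)
  qed
  have "AE x in lborel. x \<in> box a' b' \<longrightarrow>
      w' (x + h) - w' x = (\<Sum>i\<in>UNIV. h $ i * (\<integral>s. indicator {0..1} s * g' i (x + s *\<^sub>R h) \<partial>lborel))"
    by (rule weak_deriv_translate[OF sw compact_cbox ab wv gv]) (rule seg)
  then have "AE x in lborel. ennreal \<bar>w' (x + h) - w' x\<bar> * (indicator (box a b) x * indicator (box a b) (x + h))
     \<le> (\<Sum>i\<in>UNIV. ennreal \<bar>h $ i\<bar> * (?J i x))"
  proof eventually_elim
    case (elim x)
    show ?case
    proof (cases "x \<in> box a b \<and> x + h \<in> box a b")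
      case True
      then have "ennreal \<bar>w' (x + h) - w' x\<bar> = ennreal \<bar>\<Sum>i\<in>UNIV. h $ i * (\<integral>s. indicator {0..1} s * g' i (x + s *\<^sub>R h) \<partial>lborel)\<bar>"
        using elim box[of x] by simp
      also have "\<dots> \<le> ennreal (\<Sum>i\<in>UNIV. \<bar>h $ i\<bar> * \<bar>\<integral>s. indicator {0..1} s * g' i (x + s *\<^sub>R h) \<partial>lborel\<bar>)"
        by (intro ennreal_leI sum_abs[THEN order_trans]) (simp add: abs_mult)
      also have "\<dots> = (\<Sum>i\<in>UNIV. ennreal \<bar>h $ i\<bar> * ennreal \<bar>\<integral>s. indicator {0..1} s * g' i (x + s *\<^sub>R h) \<partial>lborel\<bar>)"
        by (simp add: ennreal_mult flip: sum_ennreal)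
      also have "\<dots> \<le> (\<Sum>i\<in>UNIV. ennreal \<bar>h $ i\<bar> * (?J i x))"
      proof (intro sum_mono mult_left_mono)
        fix i
        show "ennreal \<bar>\<integral>s. indicator {0..1} s * g' i (x + s *\<^sub>R h) \<partial>lborel\<bar> \<le> (?J i x)"
        proof (cases "integrable lborel (\<lambda>s. indicator {0..1::real} s * g' i (x + s *\<^sub>R h))")
          case True
          have "ennreal (norm (\<integral>s. indicator {0..1} s * g' i (x + s *\<^sub>R h) \<partial>lborel))
            \<le> (\<integral>\<^sup>+s. ennreal (norm (indicator {0..1::real} s * g' i (x + s *\<^sub>R h))) \<partial>lborel)"
            by (rule integral_norm_bound_ennreal[OF True])
          also have "\<dots> = (?J i x)"
            by (intro nn_integral_cong) (auto simp: indicator_def)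
          finally show ?thesis by simp
        qed (simp add: not_integrable_integral_eq)
      qed simp
      finally show ?thesis using True by simp
    qed auto
  qed
  then have "(\<integral>\<^sup>+x. ennreal \<bar>w' (x + h) - w' x\<bar> * (indicator (box a b) x * indicator (box a b) (x + h)) \<partial>lborel)
    \<le> (\<integral>\<^sup>+x. (\<Sum>i\<in>UNIV. ennreal \<bar>h $ i\<bar> * (?J i x)) \<partial>lborel)"
    by (rule nn_integral_mono_AE)
  also have "\<dots> = (\<Sum>i\<in>UNIV. ennreal \<bar>h $ i\<bar> * (\<integral>\<^sup>+x. (?J i x) \<partial>lborel))"
    by (simp add: nn_integral_sum nn_integral_cmult)
  also have "\<dots> = (\<Sum>i\<in>UNIV. ennreal \<bar>h $ i\<bar> * (\<integral>\<^sup>+x. ennreal \<bar>g' i x\<bar> \<partial>lborel))"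
  proof (intro sum.cong refl arg_cong2[where f = "(*)"])
    fix i
    have "(\<integral>\<^sup>+x. (\<integral>\<^sup>+s. indicator {0..1::real} s * ennreal \<bar>g' i (x + s *\<^sub>R h)\<bar> \<partial>lborel) \<partial>lborel)
      = (\<integral>\<^sup>+s. (\<integral>\<^sup>+x. indicator {0..1::real} s * ennreal \<bar>g' i (x + s *\<^sub>R h)\<bar> \<partial>lborel) \<partial>lborel)"
      by (rule lborel_pair.Fubini'[symmetric]) measurable
    also have "\<dots> = (\<integral>\<^sup>+s. indicator {0..1::real} s * (\<integral>\<^sup>+x. ennreal \<bar>g' i x\<bar> \<partial>lborel) \<partial>lborel)"
      using nn_integral_lborel_shift[of "\<lambda>x. ennreal \<bar>g' i x\<bar>"] by (simp add: nn_integral_cmult)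
    also have "\<dots> = (\<integral>\<^sup>+x. ennreal \<bar>g' i x\<bar> \<partial>lborel)" by (simp add: nn_integral_multc)
    finally show "(\<integral>\<^sup>+x. (\<integral>\<^sup>+s. indicator {0..1::real} s * ennreal \<bar>g' i (x + s *\<^sub>R h)\<bar> \<partial>lborel) \<partial>lborel)
      = (\<integral>\<^sup>+x. ennreal \<bar>g' i x\<bar> \<partial>lborel)" .
  qed
  finally show ?thesis .
qed

text \<open>
  The mean oscillation is \<open>\<integral>\<integral> |w(x + h) - w(x)| dx dh\<close> over \<open>h\<close> in the box \<open>(a - b, b - a)\<close>,
  whose volume is \<open>2^n\<close> times that of the original box.
\<close>

lemma poincare_lborel:
  fixes w w' :: "real^'n \<Rightarrow> real"
  assumes sw: "\<And>i. weak_deriv \<Omega> w i (g i)" and ab: "cbox a b \<subseteq> \<Omega>"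
    and wv: "borel_version (cbox a b) w w'" and gv: "\<And>i. borel_version (cbox a b) (g i) (g' i)"
    and le: "\<And>j. a $ j < b $ j"
  shows "(\<integral>x. \<bar>w' x\<bar> \<partial>lborel) \<le> \<bar>\<integral>x. w' x \<partial>lborel\<bar> + 2 ^ CARD('n) * (\<Sum>i\<in>UNIV. (b $ i - a $ i) * (\<integral>x. \<bar>g' i x\<bar> \<partial>lborel))"
proof -
  note w' = borel_versionD[OF wv] and g' = borel_versionD[OF gv]
  have [measurable]: "w' \<in> borel_measurable borel" "g' i \<in> borel_measurable borel" for i
    using w' g' by auto
  define V where "V = measure lborel (box a b)"
  have Vprod: "V = (\<Prod>j\<in>UNIV. b $ j - a $ j)"
  proof -
    have "V = measure lborel (cbox a b)"
      unfolding V_def measure_def by (simp add: emeasure_lborel_box_eq emeasure_lborel_cbox_eq)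
    also have "\<dots> = (\<Prod>j\<in>UNIV. b $ j - a $ j)"
      using less_imp_le[OF le] by (intro content_cbox_cart) (simp add: interval_ne_empty_cart)
    finally show ?thesis .
  qed
  have V: "V > 0" using le unfolding Vprod by (intro prod_pos) auto
  have emV: "emeasure lborel (box a b) = ennreal V"
    unfolding V_def by (rule emeasure_eq_ennreal_measure) (simp add: emeasure_lborel_box_eq)
  define I where "I = (\<integral>x. w' x \<partial>lborel)"
  define G where "G = (\<Sum>i\<in>UNIV. (b $ i - a $ i) * (\<integral>x. \<bar>g' i x\<bar> \<partial>lborel))"
  have G0: "0 \<le> G" unfolding G_def using less_imp_le[OF le] by (intro sum_nonneg mult_nonneg_nonneg) auto
  let ?D = "\<lambda>x y. ennreal \<bar>w' y - w' x\<bar> * (indicator (box a b) x * indicator (box a b) y)"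
  have AEbox: "AE y in lborel. indicator (box a b) y * w' y = w' y"
    using AE_cbox_imp_box[of a b] by eventually_elim (use w'(2) in \<open>auto simp: indicator_def\<close>)
  \<comment> \<open>V w'(x) is the integral of w' minus the integral of w'(y) - w'(x) over y in the
    box. Integrating the resulting bound over x produces the mean oscillation.\<close>
  have pt: "ennreal (V * \<bar>w' x\<bar>) * indicator (box a b) x \<le> ennreal \<bar>I\<bar> * indicator (box a b) x + (\<integral>\<^sup>+y. ?D x y \<partial>lborel)" for x
  proof (cases "x \<in> box a b")
    case True
    have i1: "integrable lborel (\<lambda>y. indicator (box a b) y * w' y)"
      using integrable_mult_indicator[OF _ w'(1), of "box a b"] by simp
    have i2: "integrable lborel (\<lambda>y. indicator (box a b) y * w' x)"
      using emV by (intro integrable_mult_left integrable_real_indicator) auto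
    have "V * w' x = (\<integral>y. indicator (box a b) y * w' x \<partial>lborel)" by (simp add: V_def)
    moreover have "I = (\<integral>y. indicator (box a b) y * w' y \<partial>lborel)"
      unfolding I_def using AEbox by (intro integral_cong_AE) auto
    ultimately have eq: "V * w' x = I - (\<integral>y. indicator (box a b) y * (w' y - w' x) \<partial>lborel)"
      using i1 i2 by (simp only: right_diff_distrib Bochner_Integration.integral_diff)
    have "V * \<bar>w' x\<bar> = \<bar>V * w' x\<bar>" using V by (simp add: abs_mult)
    also have "\<dots> \<le> \<bar>I\<bar> + norm (\<integral>y. indicator (box a b) y * (w' y - w' x) \<partial>lborel)"
      unfolding eq real_norm_def by (rule abs_triangle_ineq4)
    finally have "ennreal (V * \<bar>w' x\<bar>) \<le> ennreal \<bar>I\<bar> + ennreal (norm (\<integral>y. indicator (box a b) y * (w' y - w' x) \<partial>lborel))"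
      by (simp add: ennreal_leI flip: ennreal_plus)
    also have "ennreal (norm (\<integral>y. indicator (box a b) y * (w' y - w' x) \<partial>lborel))
       \<le> (\<integral>\<^sup>+y. ennreal (norm (indicator (box a b) y * (w' y - w' x))) \<partial>lborel)"
      using i1 i2 by (intro integral_norm_bound_ennreal) (simp only: right_diff_distrib Bochner_Integration.integrable_diff)
    also have "\<dots> = (\<integral>\<^sup>+y. ?D x y \<partial>lborel)"
      using True by (intro nn_integral_cong) (auto simp: indicator_def)
    finally show ?thesis using True by (simp add: add_mono)
  qed simp
  have dbl: "(\<integral>\<^sup>+x. \<integral>\<^sup>+y. ?D x y \<partial>lborel \<partial>lborel) \<le> ennreal (2 ^ CARD('n) * V * G)"
  proof -
    \<comment> \<open>The substitution y = x + h and an exchange of integrals group the pairs (x, y)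
      by their displacement h.\<close>
    have "(\<integral>\<^sup>+x. \<integral>\<^sup>+y. ?D x y \<partial>lborel \<partial>lborel) = (\<integral>\<^sup>+x. \<integral>\<^sup>+h. ?D x (x + h) \<partial>lborel \<partial>lborel)"
    proof (rule nn_integral_cong)
      fix x
      show "(\<integral>\<^sup>+y. ?D x y \<partial>lborel) = (\<integral>\<^sup>+h. ?D x (x + h) \<partial>lborel)"
        using nn_integral_lborel_shift[of "?D x" x] by (simp add: add.commute)
    qed
    also have "\<dots> = (\<integral>\<^sup>+h. \<integral>\<^sup>+x. ?D x (x + h) \<partial>lborel \<partial>lborel)"
      by (rule lborel_pair.Fubini'[symmetric]) measurable
    also have "\<dots> \<le> (\<integral>\<^sup>+h. ennreal G * indicator (box (a - b) (b - a)) h \<partial>lborel)"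
    proof (rule nn_integral_mono)
      fix h
      show "(\<integral>\<^sup>+x. ?D x (x + h) \<partial>lborel) \<le> ennreal G * indicator (box (a - b) (b - a)) h"
      proof (cases "h \<in> box (a - b) (b - a)")
        case True
        have "(\<integral>\<^sup>+x. ?D x (x + h) \<partial>lborel) \<le> (\<Sum>i\<in>UNIV. ennreal \<bar>h $ i\<bar> * (\<integral>\<^sup>+x. ennreal \<bar>g' i x\<bar> \<partial>lborel))"
          by (rule weak_deriv_translate_nn_integral[OF sw ab wv gv])
        also have "\<dots> \<le> (\<Sum>i\<in>UNIV. ennreal (b $ i - a $ i) * ennreal (\<integral>x. \<bar>g' i x\<bar> \<partial>lborel))"
        proof (intro sum_mono mult_mono)
          fix i
          show "ennreal \<bar>h $ i\<bar> \<le> ennreal (b $ i - a $ i)"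
            using True by (intro ennreal_leI) (auto simp: mem_box_cart abs_le_iff intro: less_imp_le
              dest!: spec[of _ i])
          show "(\<integral>\<^sup>+x. ennreal \<bar>g' i x\<bar> \<partial>lborel) \<le> ennreal (\<integral>x. \<bar>g' i x\<bar> \<partial>lborel)"
            using g'(1) by (subst nn_integral_eq_integral) auto
        qed auto
        also have "\<dots> = ennreal G"
          unfolding G_def using less_imp_le[OF le] by (simp add: ennreal_mult[symmetric] sum_ennreal)
        finally show ?thesis using True by simp
      next
        case False
        have "?D x (x + h) = 0" for x
        proof -
          obtain j where "\<not> (a $ j - b $ j < h $ j \<and> h $ j < b $ j - a $ j)"
            using False by (auto simp: mem_box_cart)
          moreover have "a $ j - b $ j < h $ j \<and> h $ j < b $ j - a $ j" if "x \<in> box a b" "x + h \<in> box a b"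
          proof -
            have "a $ j < x $ j" "x $ j < b $ j" "a $ j < x $ j + h $ j" "x $ j + h $ j < b $ j"
              using that by (auto simp: mem_box_cart)
            then show ?thesis by linarith
          qed
          ultimately have "\<not> (x \<in> box a b \<and> x + h \<in> box a b)" by blast
          then show ?thesis by auto
        qed
        then have "(\<integral>\<^sup>+x. ?D x (x + h) \<partial>lborel) = (\<integral>\<^sup>+x. 0 \<partial>(lborel :: (real^'n) measure))"
          by (rule nn_integral_cong)
        then show ?thesis by (simp only: nn_integral_const mult_zero_left zero_le)
      qed
    qed
    also have "\<dots> = ennreal G * emeasure lborel (box (a - b) (b - a))" by (simp add: nn_integral_cmult)
    also have "emeasure lborel (box (a - b) (b - a)) = ennreal (2 ^ CARD('n) * V)"
    proof -
      have "emeasure lborel (box (a - b) (b - a)) = ennreal (measure lborel (cbox (a - b) (b - a)))"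
        by (subst emeasure_eq_ennreal_measure[symmetric]) (auto simp: emeasure_lborel_box_eq emeasure_lborel_cbox_eq)
      also have "measure lborel (cbox (a - b) (b - a)) = (\<Prod>j\<in>UNIV. (b - a) $ j - (a - b) $ j)"
      proof (rule content_cbox_cart)
        have "a $ j - b $ j \<le> b $ j - a $ j" for j using le[of j] by linarith
        then show "cbox (a - b) (b - a) \<noteq> {}" by (simp add: interval_ne_empty_cart)
      qed
      also have "\<dots> = (\<Prod>j\<in>UNIV. 2 * (b $ j - a $ j))" by (intro prod.cong) auto
      also have "\<dots> = 2 ^ CARD('n) * V" by (simp only: Vprod prod.distrib prod_constant)
      finally show ?thesis .
    qed
    also have "ennreal G * ennreal (2 ^ CARD('n) * V) = ennreal (2 ^ CARD('n) * V * G)"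
      using G0 V by (simp add: ennreal_mult[symmetric] mult_ac)
    finally show ?thesis .
  qed
  have "ennreal (V * (\<integral>x. \<bar>w' x\<bar> \<partial>lborel)) = ennreal (\<integral>x. V * \<bar>w' x\<bar> \<partial>lborel)" by simp
  also have "\<dots> = (\<integral>\<^sup>+x. ennreal (V * \<bar>w' x\<bar>) \<partial>lborel)"
    using w'(1) V by (intro nn_integral_eq_integral[symmetric]) auto
  also have "\<dots> = (\<integral>\<^sup>+x. ennreal (V * \<bar>w' x\<bar>) * indicator (box a b) x \<partial>lborel)"
    using AEbox by (intro nn_integral_cong_AE) (auto elim!: eventually_mono simp: indicator_def)
  also have "\<dots> \<le> (\<integral>\<^sup>+x. ennreal \<bar>I\<bar> * indicator (box a b) x + (\<integral>\<^sup>+y. ?D x y \<partial>lborel) \<partial>lborel)"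
    by (intro nn_integral_mono pt)
  also have "\<dots> = ennreal \<bar>I\<bar> * ennreal V + (\<integral>\<^sup>+x. \<integral>\<^sup>+y. ?D x y \<partial>lborel \<partial>lborel)"
    by (subst nn_integral_add) (auto simp: nn_integral_cmult emV)
  also have "\<dots> \<le> ennreal \<bar>I\<bar> * ennreal V + ennreal (2 ^ CARD('n) * V * G)"
    using dbl by (intro add_left_mono)
  also have "\<dots> = ennreal (V * (\<bar>I\<bar> + 2 ^ CARD('n) * G))"
    using V G0 by (simp add: ennreal_mult[symmetric] algebra_simps flip: ennreal_plus)
  finally have "V * (\<integral>x. \<bar>w' x\<bar> \<partial>lborel) \<le> V * (\<bar>I\<bar> + 2 ^ CARD('n) * G)"
    using V G0 by (subst (asm) ennreal_le_iff) auto
  then show ?thesis using V by (simp add: I_def G_def)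
qed


section \<open>Gauge integrals and Poincare's inequality on fine divisions\<close>

lemma lborel_integral_borel_version:
  fixes w w' :: "real^'n \<Rightarrow> real"
  assumes w: "set_integrable lebesgue K w" "compact K" and w': "borel_version K w w'"
  shows "(\<integral>x. w' x \<partial>lborel) = integral K w" "(\<integral>x. \<bar>w' x\<bar> \<partial>lborel) = integral K (\<lambda>x. \<bar>w x\<bar>)"
proof -
  have K: "K \<in> sets borel" using w(2) by (simp add: borel_compact)
  have *: "(\<integral>x. h' x \<partial>lborel) = integral K h"
    if h: "set_integrable lebesgue K h" and h': "borel_version K h h'" for h h' :: "real^'n \<Rightarrow> real"
  proof -
    have "(LINT x:K|lebesgue. indicator K x * h x) = (\<integral>x. indicator K x * h' x \<partial>lborel)"
      by (rule lebesgue_integral_borel_version[OF h' h]) (use K in auto)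
    moreover have "(LINT x:K|lebesgue. indicator K x * h x) = (LINT x:K|lebesgue. h x)"
      unfolding set_lebesgue_integral_def by (intro Bochner_Integration.integral_cong) (auto simp: indicator_def)
    moreover have "(\<integral>x. indicator K x * h' x \<partial>lborel) = (\<integral>x. h' x \<partial>lborel)"
      using borel_versionD(2)[OF h'] by (intro Bochner_Integration.integral_cong) (auto simp: indicator_def)
    ultimately show ?thesis using set_lebesgue_integral_eq_integral(2)[OF h] by simp
  qed
  show "(\<integral>x. w' x \<partial>lborel) = integral K w" by (rule *[OF w(1) w'])
  have "borel_version K (\<lambda>x. \<bar>w x\<bar>) (\<lambda>x. \<bar>w' x\<bar>)"
    using w' by (auto simp: borel_version_def elim!: eventually_mono)
  then show "(\<integral>x. \<bar>w' x\<bar> \<partial>lborel) = integral K (\<lambda>x. \<bar>w x\<bar>)"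
    by (rule *[OF set_integrable_abs[OF w(1)]])
qed

lemma poincare:
  fixes w :: "real^'n \<Rightarrow> real"
  assumes sw: "\<And>i. weak_deriv \<Omega> w i (g i)" and ab: "cbox a b \<subseteq> \<Omega>" and le: "\<And>j. a $ j \<le> b $ j"
  shows "integral (cbox a b) (\<lambda>x. \<bar>w x\<bar>) \<le> \<bar>integral (cbox a b) w\<bar> +
    2 ^ CARD('n) * (\<Sum>i\<in>UNIV. (b $ i - a $ i) * integral (cbox a b) (\<lambda>x. \<bar>g i x\<bar>))"
proof (cases "\<forall>j. a $ j < b $ j")
  case True
  have wi: "set_integrable lebesgue (cbox a b) w" by (rule weak_deriv_integrable(1)[OF sw compact_cbox ab])
  have gi: "set_integrable lebesgue (cbox a b) (g i)" for i by (rule weak_deriv_integrable(2)[OF sw compact_cbox ab])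
  obtain w' where w': "borel_version (cbox a b) w w'"
    using borel_version_ex[OF wi compact_cbox] by blast
  obtain g' where g': "\<And>i. borel_version (cbox a b) (g i) (g' i)"
    using borel_version_ex[OF gi compact_cbox] by metis
  have "(\<integral>x. \<bar>w' x\<bar> \<partial>lborel) \<le> \<bar>\<integral>x. w' x \<partial>lborel\<bar> + 2 ^ CARD('n) * (\<Sum>i\<in>UNIV. (b $ i - a $ i) * (\<integral>x. \<bar>g' i x\<bar> \<partial>lborel))"
    by (rule poincare_lborel[OF sw ab w' g']) (use True in auto)
  moreover note lborel_integral_borel_version[OF wi compact_cbox w'] lborel_integral_borel_version(2)[OF gi compact_cbox g']
  ultimately show ?thesis by simp
next
  \<comment> \<open>Some side has length zero, so the box is negligible and the left side
    vanishes.\<close>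
  case False
  then have "box a b = {}" by (auto simp: interval_eq_empty_cart not_less)
  then have "negligible (cbox a b)" by (simp add: negligible_interval)
  then have "integral (cbox a b) (\<lambda>x. \<bar>w x\<bar>) = 0" by (rule integral_unique[OF has_integral_negligible]) auto
  moreover have "0 \<le> (\<Sum>i\<in>UNIV. (b $ i - a $ i) * integral (cbox a b) (\<lambda>x. \<bar>g i x\<bar>))"
    using le by (intro sum_nonneg mult_nonneg_nonneg integral_nonneg)
      (auto intro!: set_lebesgue_integral_eq_integral(1) set_integrable_abs weak_deriv_integrable(2)[OF sw compact_cbox ab])
  ultimately show ?thesis by simp
qed

text \<open>On cells of side at most 2 \<delta> the gradient term of Poincare's inequality is small,
  uniformly in n. What remains are the integrals of w n over finitely many fixed cells, and these
  tend to 0 by hypothesis.\<close>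

lemma L1_convergence_on_box:
  fixes w :: "nat \<Rightarrow> real^'n \<Rightarrow> real"
  assumes sw: "\<And>n i. weak_deriv \<Omega> (w n) i (g n i)" and ab: "cbox a b \<subseteq> \<Omega>"
    and B: "\<And>n i. integral (cbox a b) (\<lambda>x. \<bar>g n i x\<bar>) \<le> B"
    and lim: "\<And>c d. cbox c d \<subseteq> cbox a b \<Longrightarrow> (\<lambda>n. integral (cbox c d) (w n)) \<longlonglongrightarrow> 0"
  shows "(\<lambda>n. integral (cbox a b) (\<lambda>x. \<bar>w n x\<bar>)) \<longlonglongrightarrow> 0"
proof (rule LIMSEQ_I)
  fix e :: real assume e: "e > 0"
  define N where "N = real CARD('n)"
  \<comment> \<open>Makes the total gradient contribution 2^N (2 \<delta> N |B|) at most e/2; |B| +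
    1 keeps the denominator positive.\<close>
  define \<delta> where "\<delta> = e / (2 ^ CARD('n) * 4 * N * (\<bar>B\<bar> + 1))"
  have N: "N > 0" by (simp add: N_def)
  have \<delta>: "\<delta> > 0" using e N by (simp add: \<delta>_def)
  have small: "2 ^ CARD('n) * (2 * \<delta> * (N * \<bar>B\<bar>)) < e"
  proof -
    have "2 ^ CARD('n) * (2 * \<delta> * (N * \<bar>B\<bar>)) = e / 2 * (\<bar>B\<bar> / (\<bar>B\<bar> + 1))"
    proof -
      have "A * (2 * (e / (A * 4 * N * D)) * (N * b)) = e / 2 * (b / D)" if "A > 0" "D > 0" for A D b
        using that N by (simp add: field_simps)
      from this[of "2 ^ CARD('n)" "\<bar>B\<bar> + 1" "\<bar>B\<bar>"] show ?thesis by (simp only: \<delta>_def) simp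
    qed
    also have "\<dots> \<le> e / 2 * 1" using e by (intro mult_left_mono) auto
    finally show ?thesis using e by linarith
  qed
  \<comment> \<open>Each cell lies in a ball of radius \<delta> around its tag, so its sides are at
    most 2 \<delta>.\<close>
  obtain p where p: "p tagged_division_of cbox a b" "(\<lambda>x. ball x \<delta>) fine p"
    using fine_division_exists[OF gauge_ball[OF \<delta>]] by metis
  define \<D> where "\<D> = snd ` p"
  have \<D>: "\<D> division_of cbox a b" unfolding \<D>_def by (rule division_of_tagged_division[OF p(1)])
  have fin: "finite \<D>" using division_ofD(1)[OF \<D>] .
  have ai: "set_integrable lebesgue (cbox a b) (w n)" "set_integrable lebesgue (cbox a b) (g n i)" for n i
    by (rule weak_deriv_integrable[OF sw compact_cbox ab])+
  have ii: "(\<lambda>x. \<bar>w n x\<bar>) integrable_on cbox a b" "(\<lambda>x. \<bar>g n i x\<bar>) integrable_on cbox a b" for n i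
    by (rule set_lebesgue_integral_eq_integral(1)[OF set_integrable_abs[OF ai(1)]]
        set_lebesgue_integral_eq_integral(1)[OF set_integrable_abs[OF ai(2)]])+
  have cell: "integral K (\<lambda>x. \<bar>w n x\<bar>) \<le> \<bar>integral K (w n)\<bar> + 2 ^ CARD('n) * (\<Sum>i\<in>UNIV. 2 * \<delta> * integral K (\<lambda>x. \<bar>g n i x\<bar>))"
    if K: "K \<in> \<D>" for K n
  proof -
    obtain c d where cd: "K = cbox c d" "K \<noteq> {}" "K \<subseteq> cbox a b"
      using division_ofD(2-4)[OF \<D> K] by blast
    obtain x where x: "(x, K) \<in> p" using K by (auto simp: \<D>_def)
    have le: "c $ j \<le> d $ j" for j using cd by (simp add: interval_ne_empty_cart)
    have side: "d $ j - c $ j \<le> 2 * \<delta>" for j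
    proof -
      have "c \<in> K" "d \<in> K" using le cd by (auto simp: mem_box_cart)
      then have "dist x c < \<delta>" "dist x d < \<delta>" using fineD[OF p(2) x] by auto
      then have "norm (d - c) < 2 * \<delta>"
        using dist_triangle3[of c d x] by (simp add: dist_norm norm_minus_commute)
      then show ?thesis using component_le_norm_cart[of "d - c" j] by auto
    qed
    have "integral K (\<lambda>x. \<bar>w n x\<bar>) \<le> \<bar>integral K (w n)\<bar> +
        2 ^ CARD('n) * (\<Sum>i\<in>UNIV. (d $ i - c $ i) * integral K (\<lambda>x. \<bar>g n i x\<bar>))"
      unfolding cd(1) by (rule poincare[OF sw _ le]) (use cd ab in auto)
    also have "\<dots> \<le> \<bar>integral K (w n)\<bar> + 2 ^ CARD('n) * (\<Sum>i\<in>UNIV. 2 * \<delta> * integral K (\<lambda>x. \<bar>g n i x\<bar>))"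
    proof (intro add_left_mono mult_left_mono sum_mono mult_right_mono side)
      fix i
      show "0 \<le> integral K (\<lambda>x. \<bar>g n i x\<bar>)"
        using integrable_on_subcbox[OF ii(2)] cd by (intro integral_nonneg) auto
    qed simp
    finally show ?thesis .
  qed
  have main: "integral (cbox a b) (\<lambda>x. \<bar>w n x\<bar>) \<le> (\<Sum>K\<in>\<D>. \<bar>integral K (w n)\<bar>) + 2 ^ CARD('n) * (2 * \<delta> * (N * \<bar>B\<bar>))" for n
  proof -
    have "integral (cbox a b) (\<lambda>x. \<bar>w n x\<bar>) = (\<Sum>K\<in>\<D>. integral K (\<lambda>x. \<bar>w n x\<bar>))"
      by (rule integral_combine_division_topdown[OF ii(1) \<D>])
    also have "\<dots> \<le> (\<Sum>K\<in>\<D>. \<bar>integral K (w n)\<bar> + 2 ^ CARD('n) * (\<Sum>i\<in>UNIV. 2 * \<delta> * integral K (\<lambda>x. \<bar>g n i x\<bar>)))"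
      by (intro sum_mono cell)
    also have "\<dots> = (\<Sum>K\<in>\<D>. \<bar>integral K (w n)\<bar>) + 2 ^ CARD('n) * (2 * \<delta> * (\<Sum>i\<in>UNIV. (\<Sum>K\<in>\<D>. integral K (\<lambda>x. \<bar>g n i x\<bar>))))"
      by (simp add: sum.distrib sum_distrib_left sum.swap[of _ \<D> UNIV])
    also have "(\<Sum>i\<in>UNIV. (\<Sum>K\<in>\<D>. integral K (\<lambda>x. \<bar>g n i x\<bar>))) = (\<Sum>i\<in>UNIV. integral (cbox a b) (\<lambda>x. \<bar>g n i x\<bar>))"
      by (intro sum.cong refl integral_combine_division_topdown[symmetric] ii \<D>)
    also have "\<dots> \<le> (\<Sum>i\<in>(UNIV::'n set). \<bar>B\<bar>)" by (intro sum_mono order_trans[OF B]) auto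
    also have "(\<Sum>i\<in>(UNIV::'n set). \<bar>B\<bar>) = N * \<bar>B\<bar>" by (simp add: N_def)
    finally show ?thesis using \<delta> by simp
  qed
  have "(\<lambda>n. \<Sum>K\<in>\<D>. \<bar>integral K (w n)\<bar>) \<longlonglongrightarrow> (\<Sum>K\<in>\<D>. \<bar>0\<bar>)"
  proof (intro tendsto_sum tendsto_rabs)
    fix K assume K: "K \<in> \<D>"
    obtain c d where cd: "K = cbox c d" "K \<subseteq> cbox a b"
      using division_ofD(2-4)[OF \<D> K] by blast
    then show "(\<lambda>n. integral K (w n)) \<longlonglongrightarrow> 0" using lim by simp
  qed
  then have "(\<lambda>n. (\<Sum>K\<in>\<D>. \<bar>integral K (w n)\<bar>) + 2 ^ CARD('n) * (2 * \<delta> * (N * \<bar>B\<bar>))) \<longlonglongrightarrow> 0 + 2 ^ CARD('n) * (2 * \<delta> * (N * \<bar>B\<bar>))"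
    by (intro tendsto_add tendsto_const) simp
  then have "eventually (\<lambda>n. (\<Sum>K\<in>\<D>. \<bar>integral K (w n)\<bar>) + 2 ^ CARD('n) * (2 * \<delta> * (N * \<bar>B\<bar>)) < e) sequentially"
    using small by (intro order_tendstoD(2)) auto
  then obtain n0 where n0: "\<And>n. n \<ge> n0 \<Longrightarrow> (\<Sum>K\<in>\<D>. \<bar>integral K (w n)\<bar>) + 2 ^ CARD('n) * (2 * \<delta> * (N * \<bar>B\<bar>)) < e"
    by (auto simp: eventually_sequentially)
  have "norm (integral (cbox a b) (\<lambda>x. \<bar>w n x\<bar>) - 0) < e" if "n \<ge> n0" for n
  proof -
    have "0 \<le> integral (cbox a b) (\<lambda>x. \<bar>w n x\<bar>)" by (intro integral_nonneg ii) auto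
    then show ?thesis using main[of n] n0[OF that] by simp
  qed
  then show "\<exists>n0. \<forall>n\<ge>n0. norm (integral (cbox a b) (\<lambda>x. \<bar>w n x\<bar>) - 0) < e" by blast
qed

section \<open>Convex combinations of bounded sequences\<close>

text \<open>The limit is the pointwise limit of a subsequence that is Cauchy almost everywhere, and
  Fatou's lemma in the second index turns the Cauchy estimate into convergence in mean. Both modes
  of convergence are kept: one for integral identities, one for arguments at a point.\<close>

lemma L1_Cauchy_subseq_limit:
  fixes s :: "nat \<Rightarrow> 'a \<Rightarrow> 'b::{banach, second_countable_topology}"
  assumes s: "\<And>n. integrable M (s n)"
    and C: "\<And>e. e > 0 \<Longrightarrow> \<exists>N. \<forall>i\<ge>N. \<forall>j\<ge>N. (\<integral>x. norm (s i x - s j x) \<partial>M) < e"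
  shows "\<exists>r G. strict_mono r \<and> integrable M G \<and> (AE x in M. (\<lambda>k. s (r k) x) \<longlonglongrightarrow> G x) \<and>
    (\<lambda>k. \<integral>x. norm (s (r k) x - G x) \<partial>M) \<longlonglongrightarrow> 0"
proof -
  have [measurable]: "s n \<in> borel_measurable M" for n using s by auto
  obtain r where r: "strict_mono r" "AE x in M. Cauchy (\<lambda>i. s (r i) x)"
    by (rule cauchy_L1_AE_cauchy_subseq[OF s C])
  define G where "G x = lim (\<lambda>i. s (r i) x)" for x
  have G[measurable]: "G \<in> borel_measurable M" unfolding G_def by (rule borel_measurable_lim_metric) simp
  have lim: "AE x in M. (\<lambda>k. s (r k) x) \<longlonglongrightarrow> G x"
    using r(2) by eventually_elim (simp add: G_def Cauchy_convergent_iff convergent_LIMSEQ_iff)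
  have bound: "(\<integral>\<^sup>+x. ennreal (norm (s (r k) x - G x)) \<partial>M) \<le> ennreal e"
    if N: "\<forall>i\<ge>N. \<forall>j\<ge>N. (\<integral>x. norm (s i x - s j x) \<partial>M) < e" and k: "k \<ge> N" for e N k
  proof -
    have "(\<integral>\<^sup>+x. ennreal (norm (s (r k) x - G x)) \<partial>M) = (\<integral>\<^sup>+x. liminf (\<lambda>j. ennreal (norm (s (r k) x - s (r j) x))) \<partial>M)"
    proof (rule nn_integral_cong_AE, use lim in eventually_elim)
      case (elim x)
      have "(\<lambda>j. ennreal (norm (s (r k) x - s (r j) x))) \<longlonglongrightarrow> ennreal (norm (s (r k) x - G x))"
        by (intro tendsto_ennrealI tendsto_intros elim)
      then show ?case by (intro lim_imp_Liminf[symmetric]) auto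
    qed
    also have "\<dots> \<le> liminf (\<lambda>j. \<integral>\<^sup>+x. ennreal (norm (s (r k) x - s (r j) x)) \<partial>M)"
      by (rule nn_integral_liminf) simp
    also have "\<dots> \<le> limsup (\<lambda>j. \<integral>\<^sup>+x. ennreal (norm (s (r k) x - s (r j) x)) \<partial>M)"
      by (rule Liminf_le_Limsup) simp
    also have "\<dots> \<le> ennreal e"
    proof (rule Limsup_bounded, rule eventually_sequentiallyI[of N])
      fix j assume "N \<le> j"
      then have "N \<le> r j" "N \<le> r k" using seq_suble[OF r(1)] k order_trans by blast+
      then have "(\<integral>x. norm (s (r k) x - s (r j) x) \<partial>M) < e" using N by blast
      then show "(\<integral>\<^sup>+x. ennreal (norm (s (r k) x - s (r j) x)) \<partial>M) \<le> ennreal e"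
        using s by (subst nn_integral_eq_integral) (auto intro!: ennreal_leI)
    qed
    finally show ?thesis .
  qed
  obtain N1 where N1: "\<forall>i\<ge>N1. \<forall>j\<ge>N1. (\<integral>x. norm (s i x - s j x) \<partial>M) < 1" using C[of 1] by auto
  have "integrable M (\<lambda>x. s (r N1) x - G x)"
    using bound[OF N1 order_refl] by (intro integrableI_bounded) (auto intro: le_less_trans)
  then have Gi: "integrable M G"
    using Bochner_Integration.integrable_diff[OF s[of "r N1"], of "\<lambda>x. s (r N1) x - G x"] by simp
  have "(\<lambda>k. \<integral>x. norm (s (r k) x - G x) \<partial>M) \<longlonglongrightarrow> 0"
  proof (rule LIMSEQ_I)
    fix e :: real assume e: "e > 0"
    obtain N where N: "\<forall>i\<ge>N. \<forall>j\<ge>N. (\<integral>x. norm (s i x - s j x) \<partial>M) < e / 2" using C[of "e / 2"] e by auto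
    have "norm ((\<integral>x. norm (s (r k) x - G x) \<partial>M) - 0) < e" if "k \<ge> N" for k
    proof -
      have "ennreal (\<integral>x. norm (s (r k) x - G x) \<partial>M) \<le> ennreal (e / 2)"
        using bound[OF N that] s Gi by (subst nn_integral_eq_integral[symmetric]) auto
      then show ?thesis using e by (simp add: ennreal_le_iff)
    qed
    then show "\<exists>n0. \<forall>k\<ge>n0. norm ((\<integral>x. norm (s (r k) x - G x) \<partial>M) - 0) < e" by blast
  qed
  with r(1) Gi lim show ?thesis by blast
qed

text \<open>The weights are recorded, rather than only membership in a convex hull, because one
  combination is applied to gradients at a point, to gradients as elements of L^1 and to sequences
  of integrals.\<close>

definition tail_weights :: "nat \<Rightarrow> (nat \<Rightarrow> real) \<Rightarrow> bool" where
  "tail_weights n l \<longleftrightarrow> finite {i. l i \<noteq> 0} \<and> (\<forall>i. 0 \<le> l i) \<and> (\<forall>i<n. l i = 0) \<and> sum l {i. l i \<noteq> 0} = 1"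

definition wsum :: "(nat \<Rightarrow> real) \<Rightarrow> (nat \<Rightarrow> 'b::real_vector) \<Rightarrow> 'b" where
  "wsum l h = (\<Sum>i\<in>{i. l i \<noteq> 0}. l i *\<^sub>R h i)"

lemma wsum_superset: "finite T \<Longrightarrow> {i. l i \<noteq> 0} \<subseteq> T \<Longrightarrow> wsum l h = (\<Sum>i\<in>T. l i *\<^sub>R h i)"
  unfolding wsum_def by (rule sum.mono_neutral_left) auto

lemma tail_weights_mono: "tail_weights m l \<Longrightarrow> n \<le> m \<Longrightarrow> tail_weights n l"
  by (auto simp: tail_weights_def)

lemma tail_weights_single: "tail_weights n (\<lambda>i. if i = n then 1 else 0)"
  by (auto simp: tail_weights_def)

lemma wsum_single: "wsum (\<lambda>i. if i = n then 1 else 0) h = h n"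
  by (simp add: wsum_def)

lemma tail_weights_midpoint:
  assumes "tail_weights n l" "tail_weights n \<mu>"
  shows "tail_weights n (\<lambda>i. (l i + \<mu> i) / 2)"
    "wsum (\<lambda>i. (l i + \<mu> i) / 2) h = (1 / 2) *\<^sub>R (wsum l h + wsum \<mu> h)"
proof -
  let ?T = "{i. l i \<noteq> 0} \<union> {i. \<mu> i \<noteq> 0}"
  have fin: "finite ?T" using assms by (auto simp: tail_weights_def)
  have sub: "{i. (l i + \<mu> i) / 2 \<noteq> 0} \<subseteq> ?T" by auto
  have "sum l ?T = sum l {i. l i \<noteq> 0}" "sum \<mu> ?T = sum \<mu> {i. \<mu> i \<noteq> 0}"
    by (rule sum.mono_neutral_right[OF fin]; auto)+
  then have s: "sum l ?T = 1" "sum \<mu> ?T = 1"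
    using assms by (simp_all add: tail_weights_def)
  have "sum (\<lambda>i. (l i + \<mu> i) / 2) {i. (l i + \<mu> i) / 2 \<noteq> 0} = sum (\<lambda>i. (l i + \<mu> i) / 2) ?T"
    by (rule sum.mono_neutral_left[OF fin sub]) auto
  also have "\<dots> = 1" by (simp add: s sum.distrib flip: sum_divide_distrib)
  finally show "tail_weights n (\<lambda>i. (l i + \<mu> i) / 2)"
    using assms finite_subset[OF sub fin] by (auto simp: tail_weights_def)
  have "wsum (\<lambda>i. (l i + \<mu> i) / 2) h = (\<Sum>i\<in>?T. ((l i + \<mu> i) / 2) *\<^sub>R h i)"
    by (rule wsum_superset[OF fin sub])
  also have "\<dots> = (1 / 2) *\<^sub>R ((\<Sum>i\<in>?T. l i *\<^sub>R h i) + (\<Sum>i\<in>?T. \<mu> i *\<^sub>R h i))"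
    by (simp add: scaleR_sum_right scaleR_add_left add_divide_distrib sum.distrib[symmetric] scaleR_add_right)
  also have "\<dots> = (1 / 2) *\<^sub>R (wsum l h + wsum \<mu> h)"
    using wsum_superset[OF fin, of l h] wsum_superset[OF fin, of \<mu> h] by auto
  finally show "wsum (\<lambda>i. (l i + \<mu> i) / 2) h = (1 / 2) *\<^sub>R (wsum l h + wsum \<mu> h)" .
qed

text \<open>Stage k uses only indices from k on, where all terms are already close to the limit, and
  a convex combination of small errors is small.\<close>

lemma wsum_tendsto:
  fixes h :: "nat \<Rightarrow> 'b::real_normed_vector"
  assumes "h \<longlonglongrightarrow> z" "\<And>k. tail_weights k (l k)"
  shows "(\<lambda>k. wsum (l k) h) \<longlonglongrightarrow> z"
proof (rule LIMSEQ_I)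
  fix e :: real assume "e > 0"
  then obtain N where N: "\<And>i. i \<ge> N \<Longrightarrow> norm (h i - z) < e / 2"
    using LIMSEQ_D[OF assms(1), of "e / 2"] by auto
  have "norm (wsum (l k) h - z) < e" if k: "k \<ge> N" for k
  proof -
    let ?S = "{i. l k i \<noteq> 0}"
    have W: "\<And>i. 0 \<le> l k i" "\<And>i. i < k \<Longrightarrow> l k i = 0" "sum (l k) ?S = 1"
      using assms(2)[of k] by (auto simp: tail_weights_def)
    have "z = (\<Sum>i\<in>?S. l k i *\<^sub>R z)" using W(3) by (simp flip: scaleR_sum_left)
    then have "wsum (l k) h - z = (\<Sum>i\<in>?S. l k i *\<^sub>R (h i - z))"
      by (simp add: wsum_def scaleR_diff_right sum_subtractf)
    also have "norm \<dots> \<le> (\<Sum>i\<in>?S. l k i * (e / 2))"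
    proof (intro sum_norm_le)
      fix i assume "i \<in> ?S"
      then have "i \<ge> N" using W(2)[of i] k by fastforce
      then show "norm (l k i *\<^sub>R (h i - z)) \<le> l k i * (e / 2)"
        using mult_left_mono[OF less_imp_le[OF N], of i "l k i"] W(1)[of i] by simp
    qed
    also have "\<dots> = e / 2" using W(3) by (simp flip: sum_distrib_right sum_divide_distrib)
    finally show ?thesis using \<open>e > 0\<close> by simp
  qed
  then show "\<exists>N. \<forall>k\<ge>N. norm (wsum (l k) h - z) < e" by blast
qed

section \<open>Square integrable functions\<close>

definition square_integrable :: "'a measure \<Rightarrow> ('a \<Rightarrow> 'b::euclidean_space) \<Rightarrow> bool" where
  "square_integrable M f \<longleftrightarrow> f \<in> borel_measurable M \<and> integrable M (\<lambda>x. (norm (f x))\<^sup>2)"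

lemma parallelogram_law:
  fixes a b :: "'b::real_inner"
  shows "(norm (a + b))\<^sup>2 + (norm (a - b))\<^sup>2 = 2 * (norm a)\<^sup>2 + 2 * (norm b)\<^sup>2"
  by (simp add: power2_norm_eq_inner algebra_simps inner_commute)

lemma norm_add_sq_le: "(norm (a + b))\<^sup>2 \<le> 2 * (norm a)\<^sup>2 + 2 * (norm (b::'b::real_inner))\<^sup>2"
  using parallelogram_law[of a b] by (smt (verit) zero_le_power2)

lemma square_integrable_add:
  assumes "square_integrable M f" "square_integrable M g"
  shows "square_integrable M (\<lambda>x. f x + g x)"
proof -
  have [measurable]: "f \<in> borel_measurable M" "g \<in> borel_measurable M"
    using assms by (auto simp: square_integrable_def)
  have "integrable M (\<lambda>x. 2 * (norm (f x))\<^sup>2 + 2 * (norm (g x))\<^sup>2)"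
    using assms by (auto simp: square_integrable_def)
  then have "integrable M (\<lambda>x. (norm (f x + g x))\<^sup>2)"
    by (rule Bochner_Integration.integrable_bound) (auto simp: norm_add_sq_le)
  then show ?thesis by (simp add: square_integrable_def)
qed

lemma square_integrable_scaleR:
  assumes "square_integrable M f"
  shows "square_integrable M (\<lambda>x. c *\<^sub>R f x)"
  using assms by (auto simp: square_integrable_def power_mult_distrib)

lemma square_integrable_wsum:
  assumes "\<And>i. square_integrable M (g i)"
  shows "square_integrable M (\<lambda>x. wsum l (\<lambda>i. g i x))"
proof -
  have "square_integrable M (\<lambda>x. \<Sum>i\<in>T. l i *\<^sub>R g i x)" for T
  proof (induction T rule: infinite_finite_induct)
    case (insert i T)
    then show ?case by (simp add: square_integrable_add square_integrable_scaleR assms)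
  qed (auto simp: square_integrable_def)
  then show ?thesis unfolding wsum_def .
qed

text \<open>Rests on t \<le> \<delta> + t^2/\<delta>, a rearrangement of (t - \<delta>)^2 + \<delta>
  t \<ge> 0. The free parameter later turns an L^2 Cauchy estimate into an L^1 one.\<close>

lemma square_integrable_L1_bound:
  assumes "finite_measure M" "square_integrable M f" "\<delta> > 0"
  shows "integrable M f" "(\<integral>x. norm (f x) \<partial>M) \<le> \<delta> * measure M (space M) + (\<integral>x. (norm (f x))\<^sup>2 \<partial>M) / \<delta>"
proof -
  interpret finite_measure M by fact
  have le: "norm (f x) \<le> \<delta> + (norm (f x))\<^sup>2 / \<delta>" for x
  proof -
    have "0 \<le> (norm (f x) - \<delta>)\<^sup>2 + \<delta> * norm (f x)" using assms(3) by simp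
    then show ?thesis using assms(3) by (simp add: field_simps power2_eq_square)
  qed
  have i: "integrable M (\<lambda>x. \<delta> + (norm (f x))\<^sup>2 / \<delta>)" "f \<in> borel_measurable M"
    using assms(2) by (auto simp: square_integrable_def)
  show fi: "integrable M f"
    by (rule Bochner_Integration.integrable_bound[OF i(1,2)])
      (use le assms(3) in \<open>auto intro!: AE_I2 order_trans[OF _ abs_ge_self]\<close>)
  have "(\<integral>x. norm (f x) \<partial>M) \<le> (\<integral>x. \<delta> + (norm (f x))\<^sup>2 / \<delta> \<partial>M)"
    by (intro integral_mono i(1) integrable_norm fi le)
  also have "\<dots> = \<delta> * measure M (space M) + (\<integral>x. (norm (f x))\<^sup>2 \<partial>M) / \<delta>"
    using assms(2) by (subst Bochner_Integration.integral_add) (auto simp: square_integrable_def mult.commute)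
  finally show "(\<integral>x. norm (f x) \<partial>M) \<le> \<delta> * measure M (space M) + (\<integral>x. (norm (f x))\<^sup>2 \<partial>M) / \<delta>" .
qed

text \<open>
  By the parallelogram law, near-minimisers of the \<open>L\<^sup>2\<close> norm over the convex hulls of the tails
  form a Cauchy sequence. This replaces weak compactness.
\<close>

theorem convex_combinations_converge:
  fixes g :: "nat \<Rightarrow> 'a \<Rightarrow> 'b::euclidean_space"
  assumes "finite_measure M" and g: "\<And>n. square_integrable M (g n)"
    and B: "\<And>n. (\<integral>x. (norm (g n x))\<^sup>2 \<partial>M) \<le> B"
  shows "\<exists>l G. (\<forall>k. tail_weights k (l k)) \<and> integrable M G \<and>
    (AE x in M. (\<lambda>k. wsum (l k) (\<lambda>i. g i x)) \<longlonglongrightarrow> G x) \<and>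
    (\<lambda>k. \<integral>x. norm (wsum (l k) (\<lambda>i. g i x) - G x) \<partial>M) \<longlonglongrightarrow> 0"
proof -
  interpret finite_measure M by fact
  define E where "E l = (\<integral>x. (norm (wsum l (\<lambda>i. g i x)))\<^sup>2 \<partial>M)" for l
  \<comment> \<open>The infimum of the squared norm over the hull of the tail from n. It increases
    with n because the hulls shrink, and single terms show that it stays below B, so it
    converges.\<close>
  define A where "A n = Inf (E ` {l. tail_weights n l})" for n
  have E0: "0 \<le> E l" for l by (simp add: E_def)
  have bdd: "bdd_below (E ` X)" for X using E0 by (intro bdd_belowI2[where m = 0])
  have ne: "E ` {l. tail_weights n l} \<noteq> {}" for n using tail_weights_single by blast
  have A_le: "A n \<le> E l" if "tail_weights n l" for n l
    unfolding A_def by (rule cInf_lower[OF _ bdd]) (use that in auto)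
  have A_mono: "A n \<le> A m" if "n \<le> m" for n m
    unfolding A_def by (rule cInf_superset_mono[OF ne bdd]) (use that tail_weights_mono in blast)
  have A_bound: "A n \<le> B" for n
    using A_le[OF tail_weights_single, of n] B[of n] by (simp add: E_def wsum_single)
  define a where "a = (SUP n. A n)"
  have A_a: "A n \<le> a" for n unfolding a_def by (rule cSUP_upper) (auto intro: bdd_aboveI2[OF A_bound])
  have A_lim: "A \<longlonglongrightarrow> a"
    unfolding a_def by (rule LIMSEQ_incseq_SUP) (auto intro: bdd_aboveI2[OF A_bound] simp: incseq_def A_mono)
  have "\<exists>l. tail_weights n l \<and> E l < A n + inverse (real (Suc n))" for n
  proof -
    have "Inf (E ` {l. tail_weights n l}) < A n + inverse (real (Suc n))" by (simp add: A_def)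
    then show ?thesis by (subst (asm) cInf_less_iff[OF ne bdd]) auto
  qed
  then obtain l where l: "\<And>n. tail_weights n (l n)" "\<And>n. E (l n) < A n + inverse (real (Suc n))" by metis
  define s where "s n x = wsum (l n) (\<lambda>i. g i x)" for n x
  have sq: "square_integrable M (s n)" for n unfolding s_def by (rule square_integrable_wsum[OF g])
  have sqd: "square_integrable M (\<lambda>x. s n x - s m x)" for n m
    using square_integrable_add[OF sq[of n] square_integrable_scaleR[OF sq[of m], of "-1"]] by simp
  \<comment> \<open>Collects the gap between A n and its limit and the tolerance 1/(n + 1) of the
    near-minimisers; the factor 4 comes from the parallelogram law.\<close>
  define \<epsilon> where "\<epsilon> n = 4 * (a - A n + inverse (real (Suc n)))" for n
  have diff: "(\<integral>x. (norm (s n x - s m x))\<^sup>2 \<partial>M) \<le> \<epsilon> n" if nm: "n \<le> m" for n m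
  proof -
    have W: "tail_weights n (l n)" "tail_weights n (l m)" using l(1) tail_weights_mono nm by blast+
    \<comment> \<open>The midpoint is itself a combination of the tail from n, so its squared norm
      is at least A n; subtracting it leaves only the gap to the infimum.\<close>
    have "(norm (s n x - s m x))\<^sup>2 = 2 * (norm (s n x))\<^sup>2 + 2 * (norm (s m x))\<^sup>2
      - 4 * (norm (wsum (\<lambda>i. (l n i + l m i) / 2) (\<lambda>i. g i x)))\<^sup>2" for x
      unfolding tail_weights_midpoint(2)[OF W] s_def
      using parallelogram_law[of "wsum (l n) (\<lambda>i. g i x)" "wsum (l m) (\<lambda>i. g i x)"]
      by (simp add: power_mult_distrib power2_eq_square)
    then have "(\<integral>x. (norm (s n x - s m x))\<^sup>2 \<partial>M) = 2 * E (l n) + 2 * E (l m) - 4 * E (\<lambda>i. (l n i + l m i) / 2)"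
      using sq[of n] sq[of m] square_integrable_wsum[OF g, of "\<lambda>i. (l n i + l m i) / 2"]
      unfolding E_def s_def square_integrable_def by simp
    also have "\<dots> \<le> \<epsilon> n"
    proof -
      have "inverse (real (Suc m)) \<le> inverse (real (Suc n))" using nm by (intro le_imp_inverse_le) auto
      then have "E (l m) \<le> a + inverse (real (Suc n))" using l(2)[of m] A_a[of m] by linarith
      moreover have "E (l n) \<le> a + inverse (real (Suc n))" using l(2)[of n] A_a[of n] by linarith
      moreover note A_le[OF tail_weights_midpoint(1)[OF W]]
      moreover have "2 * y + 2 * x - 4 * z \<le> 4 * (a - A n + q)"
        if "x \<le> a + q" "y \<le> a + q" "A n \<le> z" for x y z q :: real
      proof -
        have "2 * y + 2 * x - 4 * z \<le> 2 * (a + q) + 2 * (a + q) - 4 * A n"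
          using that by (intro diff_mono add_mono mult_left_mono) auto
        then show ?thesis by (simp add: algebra_simps)
      qed
      ultimately show ?thesis unfolding \<epsilon>_def by blast
    qed
    finally show ?thesis .
  qed
  have "\<epsilon> \<longlonglongrightarrow> 4 * (a - a + 0)"
    unfolding \<epsilon>_def[abs_def] by (intro tendsto_intros A_lim LIMSEQ_inverse_real_of_nat)
  then have \<epsilon>: "\<epsilon> \<longlonglongrightarrow> 0" by simp
  have Cauchy: "\<exists>N. \<forall>i\<ge>N. \<forall>j\<ge>N. (\<integral>x. norm (s i x - s j x) \<partial>M) < e" if e: "e > 0" for e
  proof -
    define \<mu> where "\<mu> = measure M (space M)"
    have \<mu>: "\<mu> \<ge> 0" by (simp add: \<mu>_def)
    \<comment> \<open>Keeps the term \<open>\<delta> * \<mu>\<close> at most e/2; \<mu> + 1 avoids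
      division by zero on a null space.\<close>
    define \<delta> where "\<delta> = e / (2 * (\<mu> + 1))"
    have \<delta>: "\<delta> > 0" using e \<mu> by (simp add: \<delta>_def)
    have "\<delta> * e / 2 > 0" using \<delta> e by simp
    then have "eventually (\<lambda>n. \<epsilon> n < \<delta> * e / 2) sequentially"
      by (rule order_tendstoD(2)[OF \<epsilon>])
    then obtain N where N: "\<And>n. n \<ge> N \<Longrightarrow> \<epsilon> n < \<delta> * e / 2"
      unfolding eventually_sequentially by blast
    have *: "(\<integral>x. norm (s i x - s j x) \<partial>M) < e" if ij: "N \<le> i" "i \<le> j" for i j
    proof -
      have "(\<integral>x. norm (s i x - s j x) \<partial>M) \<le> \<delta> * \<mu> + (\<integral>x. (norm (s i x - s j x))\<^sup>2 \<partial>M) / \<delta>"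
        unfolding \<mu>_def by (rule square_integrable_L1_bound(2)[OF assms(1) sqd \<delta>])
      also have "\<dots> < e / 2 + e / 2"
      proof (rule add_le_less_mono)
        show "\<delta> * \<mu> \<le> e / 2" using e \<mu> by (simp add: \<delta>_def field_simps)
        show "(\<integral>x. (norm (s i x - s j x))\<^sup>2 \<partial>M) / \<delta> < e / 2"
          using diff[OF ij(2)] N[OF ij(1)] \<delta> by (simp add: field_simps)
      qed
      finally show ?thesis by simp
    qed
    show ?thesis
    proof (intro exI allI impI)
      fix i j assume "N \<le> i" "N \<le> j"
      then show "(\<integral>x. norm (s i x - s j x) \<partial>M) < e"
        using *[of i j] *[of j i] by (cases "i \<le> j") (auto simp: norm_minus_commute)
    qed
  qed
  have si: "integrable M (s n)" for n by (rule square_integrable_L1_bound(1)[OF assms(1) sq zero_less_one])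
  obtain r G where rG: "strict_mono r" "integrable M G" "AE x in M. (\<lambda>k. s (r k) x) \<longlonglongrightarrow> G x"
    "(\<lambda>k. \<integral>x. norm (s (r k) x - G x) \<partial>M) \<longlonglongrightarrow> 0"
    using L1_Cauchy_subseq_limit[OF si Cauchy] by blast
  show ?thesis
  proof (intro exI conjI allI)
    show "tail_weights k (l (r k))" for k using l(1) tail_weights_mono seq_suble[OF rG(1)] by blast
  qed (use rG in \<open>simp_all add: s_def\<close>)
qed

section \<open>Level convexity and excess estimates\<close>

text \<open>The \<xi> n belong to different arguments v n and need not lie in the sublevel set S at
  u, but they eventually lie in the closure of any open half-space containing S. Closed half-spaces
  pass to convex combinations and limits, and a closed convex set can be strictly separated from
  each point outside it.\<close>

lemma level_convex_limit_le_one: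
  fixes F :: "'a::euclidean_space \<Rightarrow> 'b::euclidean_space \<Rightarrow> real"
  assumes closed: "\<And>t. closed {(u, \<xi>). F u \<xi> \<le> t}"
    and lc: "\<And>u. level_convex (F u)"
    and coercive: "\<And>u \<xi>. \<alpha> * norm \<xi> powr \<gamma> \<le> F u \<xi>" "\<alpha> > 0" "\<gamma> > 0"
    and v: "v \<longlonglongrightarrow> u" and ev: "\<And>e. e > 0 \<Longrightarrow> eventually (\<lambda>n. F (v n) (\<xi> n) \<le> 1 + e) sequentially"
    and l: "\<And>k. tail_weights k (l k)" and G: "(\<lambda>k. wsum (l k) \<xi>) \<longlonglongrightarrow> G"
  shows "F u G \<le> 1"
proof (rule field_le_epsilon)
  fix e :: real assume e: "e > 0"
  define S where "S = {\<zeta>. F u \<zeta> \<le> 1 + e}"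
  have "S = (\<lambda>\<zeta>. (u, \<zeta>)) -` {(u, \<xi>). F u \<xi> \<le> 1 + e}" by (auto simp: S_def)
  then have cl: "closed S"
    by (simp only:) (intro closed_vimage closed continuous_intros)
  have cv: "convex S" using lc[of u] by (auto simp: level_convex_def S_def)
  have "G \<in> S"
  proof (rule ccontr)
    assume "G \<notin> S"
    then obtain a b where ab: "a \<bullet> G < b" "\<And>x. x \<in> S \<Longrightarrow> a \<bullet> x > b"
      using separating_hyperplane_closed_point[OF cv cl] by metis
    \<comment> \<open>The radius that coercivity assigns to level 2, the level reached by the case e
      = 1 of \<open>ev\<close>, whatever the current e.\<close>
    define R where "R = (2 / \<alpha>) powr (1 / \<gamma>)"
    have bd: "norm \<zeta> \<le> R" if "F w \<zeta> \<le> 2" for w \<zeta>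
    proof -
      have "norm \<zeta> powr \<gamma> \<le> 2 / \<alpha>" using coercive(1)[of \<zeta> w] that coercive(2) by (simp add: field_simps)
      then have "(norm \<zeta> powr \<gamma>) powr (1 / \<gamma>) \<le> R"
        unfolding R_def using coercive(3) by (intro powr_mono2) auto
      then show ?thesis using coercive(3) by (simp add: powr_powr)
    qed
    \<comment> \<open>Otherwise infinitely many \<xi> n lie beyond the hyperplane. Coercivity bounds
      them, and joint closedness of the sublevel set puts a limit point in S, where the inner
      product with a exceeds b.\<close>
    have "eventually (\<lambda>n. a \<bullet> \<xi> n \<ge> b) sequentially"
    proof (rule ccontr)
      assume "\<not> ?thesis"
      then have fr: "frequently (\<lambda>n. a \<bullet> \<xi> n < b) sequentially" by (simp add: frequently_def not_less)
      define P where "P n \<longleftrightarrow> a \<bullet> \<xi> n < b \<and> F (v n) (\<xi> n) \<le> 1 + e \<and> norm (\<xi> n) \<le> R" for n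
      have "frequently P sequentially"
        unfolding P_def
        by (rule frequently_rev_mp[OF fr])
          (use ev[OF e] ev[OF zero_less_one] in \<open>eventually_elim, auto intro: bd\<close>)
      then have "infinite {n. P n}"
        by (simp add: frequently_cofinite flip: cofinite_eq_sequentially)
      then obtain r :: "nat \<Rightarrow> nat" where r: "strict_mono r" "\<And>n. P (r n)"
        using infinite_enumerate by blast
      have "\<forall>n. \<xi> (r n) \<in> cball 0 R" using r(2) by (simp add: P_def)
      then obtain \<zeta> q where q: "strict_mono q" "((\<lambda>n. \<xi> (r n)) \<circ> q) \<longlonglongrightarrow> \<zeta>"
        using compact_cball[of "0::'b" R] unfolding compact_def by metis
      have "(\<lambda>n. (v (r (q n)), \<xi> (r (q n)))) \<longlonglongrightarrow> (u, \<zeta>)"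
        using q(2) LIMSEQ_subseq_LIMSEQ[OF v strict_mono_o[OF r(1) q(1)]]
        by (intro tendsto_Pair) (auto simp: o_def)
      then have "(u, \<zeta>) \<in> {(u, \<xi>). F u \<xi> \<le> 1 + e}"
        by (rule closed_sequentially[OF closed, rotated]) (use r(2) in \<open>auto simp: P_def\<close>)
      then have "a \<bullet> \<zeta> > b" by (intro ab(2)) (simp add: S_def)
      moreover have "a \<bullet> \<zeta> \<le> b"
        by (rule LIMSEQ_le_const2[OF tendsto_inner[OF tendsto_const q(2)]])
          (use r(2) in \<open>auto simp: P_def intro: less_imp_le\<close>)
      ultimately show False by simp
    qed
    then obtain N where N: "\<And>n. n \<ge> N \<Longrightarrow> b \<le> a \<bullet> \<xi> n" by (auto simp: eventually_sequentially)
    have "b \<le> a \<bullet> wsum (l k) \<xi>" if "k \<ge> N" for k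
    proof -
      let ?S = "{i. l k i \<noteq> 0}"
      have W: "\<And>i. 0 \<le> l k i" "\<And>i. i < k \<Longrightarrow> l k i = 0" "sum (l k) ?S = 1"
        using l[of k] by (auto simp: tail_weights_def)
      have "b = (\<Sum>i\<in>?S. l k i * b)" using W(3) by (simp flip: sum_distrib_right)
      also have "\<dots> \<le> (\<Sum>i\<in>?S. l k i * (a \<bullet> \<xi> i))"
      proof (intro sum_mono mult_left_mono W N)
        fix i assume "i \<in> ?S"
        then show "N \<le> i" using W(2)[of i] that by fastforce
      qed
      finally show ?thesis by (simp add: wsum_def inner_sum_right)
    qed
    then have "b \<le> a \<bullet> G"
      by (intro LIMSEQ_le_const[OF tendsto_inner[OF tendsto_const G]]) auto
    then show False using ab(1) by simp
  qed
  then show "F u G \<le> 1 + e" by (simp add: S_def)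
qed

text \<open>With n = floor s, the binomial coefficient is at least (n/m)^m, and n^m \<ge> n^2 is at
  least half of s (s - 1). One factor s restores the energy density (1/s) t^s, and s - 1 remains as
  decay.\<close>

lemma excess_power_le_powr:
  fixes s t :: real
  assumes m: "m \<ge> 2" and s: "s \<ge> real m" and t: "t \<ge> 0"
  shows "(max (t - 1) 0) ^ m \<le> 2 * real m ^ m / (s - 1) * (1 / s * t powr s)"
proof (cases "t \<le> 1")
  case True
  moreover have "0 \<le> 2 * real m ^ m / (s - 1) * (1 / s * t powr s)"
    using m s by (intro mult_nonneg_nonneg divide_nonneg_nonneg) auto
  ultimately show ?thesis using m by (simp add: max_def power_0_left)
next
  case False
  define y where "y = t - 1"
  have y: "y > 0" "t = 1 + y" using False by (auto simp: y_def)
  define n where "n = nat \<lfloor>s\<rfloor>"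
  have n: "real n \<le> s" "s < real n + 1" "m \<le> n"
    using s m unfolding n_def by linarith+
  have n2: "n \<ge> 2" using n m by simp
  have "real (n choose m) * y ^ m \<le> (\<Sum>k\<le>n. real (n choose k) * y ^ k)"
    using y n by (intro member_le_sum[of m "{..n}" "\<lambda>k. real (n choose k) * y ^ k"]) auto
  also have "\<dots> = t ^ n" unfolding y(2) using binomial_ring[of y 1 n] by (simp add: add.commute)
  also have "\<dots> = t powr real n" using y by (simp add: powr_realpow)
  also have "\<dots> \<le> t powr s" using y n by (intro powr_mono) auto
  finally have A: "real (n choose m) * y ^ m \<le> t powr s" .
  have "(real n / real m) ^ m \<le> real (n choose m)"
    using binomial_ge_n_over_k_pow_k[OF n(3), where 'a = real] by simp
  then have "(real n / real m) ^ m * y ^ m \<le> t powr s"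
    using A y by (meson mult_right_mono order_trans zero_le_power less_imp_le)
  then have "y ^ m \<le> real m ^ m / real n ^ m * t powr s"
    using n2 m by (simp add: power_divide field_simps)
  also have "real m ^ m / real n ^ m \<le> 2 * real m ^ m / (s - 1) * (1 / s)"
  proof -
    \<comment> \<open>From n \<le> s < n + 1: s - 1 is below n, and s is at most 2 n because n \<ge>
      1.\<close>
    have "(s - 1) * s \<le> real n * (2 * real n)"
      using n n2 s m by (intro mult_mono) auto
    also have "\<dots> = 2 * real n ^ 2" by (simp add: power2_eq_square)
    also have "\<dots> \<le> 2 * real n ^ m" using n2 m by (intro mult_left_mono power_increasing) auto
    finally have "(s - 1) * s * real m ^ m \<le> 2 * real n ^ m * real m ^ m" by (intro mult_right_mono) auto
    moreover have "s > 1" using s m by linarith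
    ultimately show ?thesis using n2 by (simp add: field_simps)
  qed
  finally show ?thesis using y by (simp add: max_def mult.assoc mult_right_mono)
qed

text \<open>Writing z for the excess, coercivity bounds a^2 by ((1 + z)/\<alpha>)^(2/\<gamma>).
  Since 2/\<gamma> \<le> m, the power of 1 + z is at most (1 + z)^m, hence at most 2^m (1 +
  z^m).\<close>

lemma norm_sq_le_excess:
  fixes a F :: real
  assumes a: "0 \<le> a" and le: "\<alpha> * a powr \<gamma> \<le> F" and \<alpha>: "\<alpha> > 0" and \<gamma>: "\<gamma> > 0" and m: "2 \<le> \<gamma> * real m"
  shows "a\<^sup>2 \<le> (1 / \<alpha>) powr (2 / \<gamma>) * 2 ^ m * (1 + (max (F - 1) 0) ^ m)"
proof -
  define z where "z = max (F - 1) 0"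
  have z: "0 \<le> z" "F \<le> 1 + z" by (auto simp: z_def)
  have "a powr \<gamma> \<le> 1 / \<alpha> * (1 + z)" using le z \<alpha> by (simp add: field_simps)
  then have "(a powr \<gamma>) powr (2 / \<gamma>) \<le> (1 / \<alpha> * (1 + z)) powr (2 / \<gamma>)"
    using \<gamma> by (intro powr_mono2) auto
  moreover have "(a powr \<gamma>) powr (2 / \<gamma>) = a\<^sup>2"
    using a \<gamma> by (cases "a = 0") (auto simp: powr_powr)
  moreover have "(1 / \<alpha> * (1 + z)) powr (2 / \<gamma>) = (1 / \<alpha>) powr (2 / \<gamma>) * (1 + z) powr (2 / \<gamma>)"
    by (rule powr_mult)
  moreover have "(1 + z) powr (2 / \<gamma>) \<le> 2 ^ m * (1 + z ^ m)"
  proof -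
    have "(1 + z) powr (2 / \<gamma>) \<le> (1 + z) powr real m"
      using z m \<gamma> by (intro powr_mono) (auto simp: field_simps)
    also have "\<dots> = (1 + z) ^ m" using z by (simp add: powr_realpow)
    also have "\<dots> \<le> (2 * max 1 z) ^ m" using z by (intro power_mono) auto
    also have "\<dots> = 2 ^ m * (max 1 z) ^ m" by (simp add: power_mult_distrib)
    also have "(max 1 z) ^ m \<le> 1 + z ^ m" using z by (simp add: max_def)
    finally show ?thesis by simp
  qed
  ultimately show ?thesis
    using mult_left_mono[of "(1 + z) powr (2 / \<gamma>)" "2 ^ m * (1 + z ^ m)" "(1 / \<alpha>) powr (2 / \<gamma>)"]
    by (simp add: z_def mult.assoc)
qed

text \<open>The lower bound c on the exponents replaces the pointwise factor of
  \<open>excess_power_le_powr\<close> by a constant that decays as c grows.\<close>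

lemma excess_integral_le:
  fixes F q :: "'a \<Rightarrow> real"
  assumes [measurable]: "F \<in> borel_measurable M" "q \<in> borel_measurable M"
    and F0: "AE x in M. 0 \<le> F x" and q: "AE x in M. c \<le> q x" and c: "c \<ge> real m" and m: "m \<ge> 2"
    and E: "(\<integral>\<^sup>+x. ennreal (1 / q x * F x powr q x) \<partial>M) \<le> ennreal C"
    and C: "0 \<le> C"
  shows "integrable M (\<lambda>x. (max (F x - 1) 0) ^ m)"
    "(\<integral>x. (max (F x - 1) 0) ^ m \<partial>M) \<le> 2 * real m ^ m / (c - 1) * C"
proof -
  define K where "K = 2 * real m ^ m / (c - 1)"
  have c1: "c > 1" using c m by linarith
  have K: "0 \<le> K" using c1 by (simp add: K_def)
  have "(\<integral>\<^sup>+x. ennreal ((max (F x - 1) 0) ^ m) \<partial>M) \<le> (\<integral>\<^sup>+x. ennreal K * ennreal (1 / q x * F x powr q x) \<partial>M)"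
  proof (rule nn_integral_mono_AE, use F0 q in eventually_elim)
    case (elim x)
    have q1: "q x > 1" using elim c1 by simp
    have "(max (F x - 1) 0) ^ m \<le> 2 * real m ^ m / (q x - 1) * (1 / q x * F x powr q x)"
      using elim c m by (intro excess_power_le_powr) auto
    also have "\<dots> \<le> K * (1 / q x * F x powr q x)"
      unfolding K_def using elim c1 q1 by (intro mult_right_mono divide_left_mono) auto
    finally show ?case using K q1 by (simp add: ennreal_leI flip: ennreal_mult)
  qed
  also have "\<dots> \<le> ennreal K * ennreal C"
  proof -
    have "(\<integral>\<^sup>+x. ennreal K * ennreal (1 / q x * F x powr q x) \<partial>M) \<le> ennreal K * (\<integral>\<^sup>+x. ennreal (1 / q x * F x powr q x) \<partial>M)"
      by (simp add: nn_integral_cmult)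
    also have "\<dots> \<le> ennreal K * ennreal C" by (rule mult_left_mono[OF E]) simp
    finally show ?thesis .
  qed
  finally have *: "(\<integral>\<^sup>+x. ennreal ((max (F x - 1) 0) ^ m) \<partial>M) \<le> ennreal (K * C)"
    using K C by (simp add: ennreal_mult)
  have n: "0 \<le> (max (F x - 1) 0) ^ m" for x by simp
  show i: "integrable M (\<lambda>x. (max (F x - 1) 0) ^ m)"
    by (rule integrableI_bounded) (use * in \<open>auto simp: less_top[symmetric] top_unique\<close>)
  show "(\<integral>x. (max (F x - 1) 0) ^ m \<partial>M) \<le> 2 * real m ^ m / (c - 1) * C"
    using * nn_integral_eq_integral[OF i] K C by (simp add: K_def[symmetric])
qed

section \<open>Vector-valued weak derivatives\<close>

lemma AE_lebesgue_on_iff: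
  fixes \<Omega> :: "(real^'n) set"
  assumes "\<Omega> \<in> sets lebesgue"
  shows "(AE x in lebesgue_on \<Omega>. P x) \<longleftrightarrow> (AE x in lborel. x \<in> \<Omega> \<longrightarrow> P x)"
  using assms by (simp add: AE_restrict_space_iff AE_completion_iff)

lemma set_lebesgue_integral_lebesgue_on:
  fixes f :: "real^'n \<Rightarrow> 'b::euclidean_space"
  assumes "\<Omega> \<in> sets lebesgue"
  shows "(LINT x:\<Omega>|lebesgue. f x) = (\<integral>x. f x \<partial>lebesgue_on \<Omega>)"
  using assms by (simp add: integral_restrict_space set_lebesgue_integral_def)

lemma set_integrable_lebesgue_on:
  fixes f :: "real^'n \<Rightarrow> 'b::euclidean_space"
  assumes "\<Omega> \<in> sets lebesgue"
  shows "set_integrable lebesgue \<Omega> f \<longleftrightarrow> integrable (lebesgue_on \<Omega>) f"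
  using assms by (simp add: integrable_restrict_space set_integrable_def)

lemma set_integrable_cart_iff:
  fixes f :: "real^'n \<Rightarrow> real^'d"
  shows "set_integrable lebesgue S f \<longleftrightarrow> (\<forall>k. set_integrable lebesgue S (\<lambda>x. f x $ k))"
  using absolutely_integrable_componentwise_iff[where f = f and A = S] by (auto simp: Basis_vec_def inner_axis)

lemma bounded_test_integrable:
  fixes u :: "real^'n \<Rightarrow> 'b::euclidean_space" and \<psi> :: "real^'n \<Rightarrow> real"
  assumes "set_integrable lebesgue K u" "compact K" "K \<subseteq> \<Omega>"
    and \<psi>: "continuous_on UNIV \<psi>" "\<And>x. \<bar>\<psi> x\<bar> \<le> B" "\<And>x. x \<notin> K \<Longrightarrow> \<psi> x = 0"
  shows "set_integrable lebesgue \<Omega> (\<lambda>x. \<psi> x *\<^sub>R u x)"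
proof -
  have m: "\<psi> \<in> borel_measurable lebesgue"
    using borel_measurable_continuous_onI[OF \<psi>(1)] by (intro measurable_completion) simp
  have i: "integrable lebesgue (\<lambda>x. indicator K x *\<^sub>R u x)" using assms(1) by (simp add: set_integrable_def)
  have "integrable lebesgue (\<lambda>x. \<psi> x *\<^sub>R (indicator K x *\<^sub>R u x))"
  proof (rule Bochner_Integration.integrable_bound)
    show "integrable lebesgue (\<lambda>x. B *\<^sub>R (indicator K x *\<^sub>R u x))" using i by (rule integrable_scaleR_right)
    show "(\<lambda>x. \<psi> x *\<^sub>R (indicator K x *\<^sub>R u x)) \<in> borel_measurable lebesgue"
      using m borel_measurable_integrable[OF i] by (rule borel_measurable_scaleR)
    have "norm (\<psi> x *\<^sub>R (indicator K x *\<^sub>R u x)) \<le> norm (B *\<^sub>R (indicator K x *\<^sub>R u x))" for x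
      unfolding norm_scaleR by (intro mult_right_mono) (use \<psi>(2)[of x] in auto)
    then show "AE x in lebesgue. norm (\<psi> x *\<^sub>R (indicator K x *\<^sub>R u x)) \<le> norm (B *\<^sub>R (indicator K x *\<^sub>R u x))" by simp
  qed
  moreover have "\<psi> x *\<^sub>R (indicator K x *\<^sub>R u x) = indicator \<Omega> x *\<^sub>R (\<psi> x *\<^sub>R u x)" for x
    using \<psi>(3)[of x] assms(3) by (auto simp: indicator_def)
  ultimately show ?thesis unfolding set_integrable_def by (simp only:)
qed

lemma set_lebesgue_integral_cart_nth:
  fixes f :: "real^'n \<Rightarrow> real^'d"
  assumes "set_integrable lebesgue S f"
  shows "(LINT x:S|lebesgue. f x) $ k = (LINT x:S|lebesgue. f x $ k)"
  using integral_bounded_linear[OF bounded_linear_vec_nth assms[unfolded set_integrable_def], of k]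
  by (simp add: set_lebesgue_integral_def)

lemma test_function_bounds:
  fixes \<phi> :: "real^'n \<Rightarrow> real"
  assumes "test_function \<Omega> \<phi>"
  shows "\<exists>K B. compact K \<and> K \<subseteq> \<Omega> \<and> (\<forall>x. x \<notin> K \<longrightarrow> \<phi> x = 0) \<and> (\<forall>x. x \<notin> K \<longrightarrow> partial \<phi> i x = 0) \<and>
    (\<forall>x. \<bar>\<phi> x\<bar> \<le> B) \<and> (\<forall>x. \<bar>partial \<phi> i x\<bar> \<le> B) \<and>
    continuous_on UNIV \<phi> \<and> continuous_on UNIV (partial \<phi> i) \<and> 0 \<le> B"
proof (rule test_functionE[OF assms])
  fix K B
  assume "compact K" "K \<subseteq> \<Omega>" "\<And>x. x \<notin> K \<Longrightarrow> \<phi> x = 0" "\<And>x i. x \<notin> K \<Longrightarrow> partial \<phi> i x = 0"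
    "\<And>x. \<bar>\<phi> x\<bar> \<le> B" "\<And>x i. \<bar>partial \<phi> i x\<bar> \<le> B"
    "continuous_on UNIV \<phi>" "\<And>i. continuous_on UNIV (partial \<phi> i)" "0 \<le> B"
  then show ?thesis by (intro exI[of _ K] exI[of _ B]) simp
qed

text \<open>Taking components is exchanged with the Bochner integral for integrable functions;
  compact support and boundedness of the test function, together with local integrability, ensure
  integrability over all of \<Omega>.\<close>

lemma weak_partial_iff_weak_deriv:
  fixes u g :: "real^'n \<Rightarrow> real^'d"
  shows "weak_partial \<Omega> u i g \<longleftrightarrow> (\<forall>k. weak_deriv \<Omega> (\<lambda>x. u x $ k) i (\<lambda>x. g x $ k))"
proof -
  have loc: "locally_integrable \<Omega> h \<longleftrightarrow> (\<forall>k K. compact K \<and> K \<subseteq> \<Omega> \<longrightarrow> set_integrable lebesgue K (\<lambda>x. h x $ k))"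
    for h :: "real^'n \<Rightarrow> real^'d"
    unfolding locally_integrable_def by (subst set_integrable_cart_iff) blast
  have eq: "(LINT x:\<Omega>|lebesgue. partial \<phi> i x *\<^sub>R u x) = - (LINT x:\<Omega>|lebesgue. \<phi> x *\<^sub>R g x) \<longleftrightarrow>
    (\<forall>k. (LINT x:\<Omega>|lebesgue. partial \<phi> i x * u x $ k) = - (LINT x:\<Omega>|lebesgue. \<phi> x * g x $ k))"
    if li: "locally_integrable \<Omega> u" "locally_integrable \<Omega> g" and tf: "test_function \<Omega> \<phi>" for \<phi>
  proof -
    obtain K B where KB: "compact K" "K \<subseteq> \<Omega>"
      "\<And>x. x \<notin> K \<Longrightarrow> \<phi> x = 0" "\<And>x. x \<notin> K \<Longrightarrow> partial \<phi> i x = 0"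
      "\<And>x. \<bar>\<phi> x\<bar> \<le> B" "\<And>x. \<bar>partial \<phi> i x\<bar> \<le> B"
      "continuous_on UNIV \<phi>" "continuous_on UNIV (partial \<phi> i)"
      using test_function_bounds[OF tf, of i] by blast
    have Ki: "set_integrable lebesgue K u" "set_integrable lebesgue K g"
      using li KB(1,2) by (auto simp: locally_integrable_def)
    have "set_integrable lebesgue \<Omega> (\<lambda>x. partial \<phi> i x *\<^sub>R u x)"
      by (rule bounded_test_integrable[OF Ki(1) KB(1,2) KB(8) KB(6) KB(4)])
    moreover have "set_integrable lebesgue \<Omega> (\<lambda>x. \<phi> x *\<^sub>R g x)"
      by (rule bounded_test_integrable[OF Ki(2) KB(1,2) KB(7) KB(5) KB(3)])
    ultimately show ?thesis
      unfolding vec_eq_iff uminus_vec_def by (simp add: set_lebesgue_integral_cart_nth)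
  qed
  show ?thesis
  proof
    assume w: "weak_partial \<Omega> u i g"
    then have li: "locally_integrable \<Omega> u" "locally_integrable \<Omega> g" by (simp_all add: weak_partial_def)
    show "\<forall>k. weak_deriv \<Omega> (\<lambda>x. u x $ k) i (\<lambda>x. g x $ k)"
      unfolding weak_deriv_def
    proof (intro allI conjI impI)
      fix k \<phi> assume tf: "test_function \<Omega> \<phi>"
      with w have "(LINT x:\<Omega>|lebesgue. partial \<phi> i x *\<^sub>R u x) = - (LINT x:\<Omega>|lebesgue. \<phi> x *\<^sub>R g x)"
        by (simp add: weak_partial_def)
      then show "(LINT x:\<Omega>|lebesgue. partial \<phi> i x * u x $ k) = - (LINT x:\<Omega>|lebesgue. \<phi> x * g x $ k)"
        unfolding eq[OF li tf] by simp
    qed (use li loc in auto)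
  next
    assume s: "\<forall>k. weak_deriv \<Omega> (\<lambda>x. u x $ k) i (\<lambda>x. g x $ k)"
    then have li: "locally_integrable \<Omega> u" "locally_integrable \<Omega> g"
      unfolding loc by (simp_all add: weak_deriv_def)
    show "weak_partial \<Omega> u i g"
      unfolding weak_partial_def
    proof (intro allI conjI impI li)
      fix \<phi> assume tf: "test_function \<Omega> \<phi>"
      show "(LINT x:\<Omega>|lebesgue. partial \<phi> i x *\<^sub>R u x) = - (LINT x:\<Omega>|lebesgue. \<phi> x *\<^sub>R g x)"
        unfolding eq[OF li tf] using s tf by (simp add: weak_deriv_def)
    qed
  qed
qed

lemma weak_grad_weak_deriv:
  fixes v :: "real^'n \<Rightarrow> real^'d"
  assumes "\<And>i. \<exists>g. weak_partial \<Omega> v i g"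
  shows "weak_deriv \<Omega> (\<lambda>x. v x $ k) i (\<lambda>x. weak_grad \<Omega> v x $ k $ i)"
proof -
  have "weak_partial \<Omega> v i (SOME g. weak_partial \<Omega> v i g)"
    using assms by (rule someI_ex)
  then have "weak_deriv \<Omega> (\<lambda>x. v x $ k) i (\<lambda>x. (SOME g. weak_partial \<Omega> v i g) x $ k)"
    using weak_partial_iff_weak_deriv by blast
  then show ?thesis by (simp add: weak_grad_def)
qed

text \<open>The gradient chosen by \<open>weak_grad\<close> is known only to be integrable on
  compact subsets. Exhausting \<Omega> by compact sets still makes it measurable, as a pointwise
  limit of its restrictions.\<close>

lemma borel_measurable_lebesgue_on_exhaustion:
  fixes g :: "real^'n \<Rightarrow> real"
  assumes "open \<Omega>" "\<And>K. compact K \<Longrightarrow> K \<subseteq> \<Omega> \<Longrightarrow> set_integrable lebesgue K g"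
  shows "g \<in> borel_measurable (lebesgue_on \<Omega>)"
proof -
  obtain C where C: "\<And>n. compact (C n)" "\<And>n. C n \<subseteq> \<Omega>" "\<And>n. C n \<subseteq> interior (C (Suc n))" "\<Union>(range C) = \<Omega>"
    by (rule open_Union_compact_subsets[OF assms(1)]) blast
  have inc: "C n \<subseteq> C m" if "n \<le> m" for n m
    using that C(3) interior_subset by (induction rule: dec_induct) blast+
  have "(\<lambda>x. indicator \<Omega> x *\<^sub>R g x) \<in> borel_measurable lebesgue"
  proof (rule borel_measurable_LIMSEQ_real)
    fix n
    show "(\<lambda>x. indicator (C n) x *\<^sub>R g x) \<in> borel_measurable lebesgue"
      using assms(2)[OF C(1,2)] unfolding set_integrable_def by (rule borel_measurable_integrable)
  next
    fix x
    show "(\<lambda>n. indicator (C n) x *\<^sub>R g x) \<longlonglongrightarrow> indicator \<Omega> x *\<^sub>R g x"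
    proof (cases "x \<in> \<Omega>")
      case True
      then obtain n where "x \<in> C n" using C(4) by blast
      then have "x \<in> C m" if "n \<le> m" for m using inc[OF that] by blast
      then have "eventually (\<lambda>m. indicator (C m) x *\<^sub>R g x = indicator \<Omega> x *\<^sub>R g x) sequentially"
        using True by (intro eventually_sequentiallyI[of n]) simp
      then show ?thesis by (rule tendsto_eventually)
    next
      case False
      then have "x \<notin> C n" for n using C(2) by blast
      then show ?thesis using False by simp
    qed
  qed
  then show ?thesis
    using assms(1) by (subst borel_measurable_restrict_space_iff) auto
qed

lemma borel_measurable_matrixI:
  fixes D :: "'a \<Rightarrow> real^'n^'d"
  assumes "\<And>k i. (\<lambda>x. D x $ k $ i) \<in> borel_measurable M"
  shows "D \<in> borel_measurable M"
  using assms by (subst borel_measurable_euclidean_space) (auto simp: Basis_vec_def inner_axis)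

text \<open>The defining identity is linear, so it survives convex combinations. Its left side
  converges by weak convergence of v n, which combinations of ever later tails respect, and its
  right side by L^1 convergence of the combined gradients.\<close>

lemma weak_gradient_limit:
  fixes u :: "real^'n \<Rightarrow> real^'d" and D :: "nat \<Rightarrow> real^'n \<Rightarrow> real^'n^'d"
  assumes \<Omega>: "open \<Omega>" "bounded \<Omega>" and u: "in_L1 \<Omega> u" and wc: "weak_L1_conv \<Omega> v u"
    and sw: "\<And>n k i. weak_deriv \<Omega> (\<lambda>x. v n x $ k) i (\<lambda>x. D n x $ k $ i)"
    and D: "\<And>n. square_integrable (lebesgue_on \<Omega>) (D n)"
    and B: "\<And>n. (\<integral>x. (norm (D n x))\<^sup>2 \<partial>lebesgue_on \<Omega>) \<le> B"
  shows "\<exists>l G. (\<forall>k. tail_weights k (l k)) \<and> integrable (lebesgue_on \<Omega>) G \<and>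
    (AE x in lebesgue_on \<Omega>. (\<lambda>k. wsum (l k) (\<lambda>i. D i x)) \<longlonglongrightarrow> G x) \<and>
    (\<forall>k i. weak_deriv \<Omega> (\<lambda>x. u x $ k) i (\<lambda>x. G x $ k $ i))"
proof -
  let ?M = "lebesgue_on \<Omega>"
  have \<Omega>s: "\<Omega> \<in> sets lebesgue" using \<Omega> by auto
  have fm: "finite_measure (?M)"
    using \<Omega> by (intro finite_measure_lebesgue_on bounded_set_imp_lmeasurable) auto
  obtain l G where lG: "(\<forall>k. tail_weights k (l k)) \<and> integrable (?M) G \<and>
    (AE x in ?M. (\<lambda>k. wsum (l k) (\<lambda>i. D i x)) \<longlonglongrightarrow> G x) \<and>
    (\<lambda>k. \<integral>x. norm (wsum (l k) (\<lambda>i. D i x) - G x) \<partial>?M) \<longlonglongrightarrow> 0"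
    using convex_combinations_converge[where g = D, OF fm D B] by (elim exE) (rule that)
  have l: "\<And>k. tail_weights k (l k)" and Gi: "integrable (?M) G"
    and ae: "AE x in ?M. (\<lambda>k. wsum (l k) (\<lambda>i. D i x)) \<longlonglongrightarrow> G x"
    and L1: "(\<lambda>k. \<integral>x. norm (wsum (l k) (\<lambda>i. D i x) - G x) \<partial>?M) \<longlonglongrightarrow> 0"
    using lG by simp_all
  have Di: "integrable (?M) (D n)" for n
    by (rule square_integrable_L1_bound(1)[OF fm D zero_less_one])
  have "weak_deriv \<Omega> (\<lambda>x. u x $ k) i (\<lambda>x. G x $ k $ i)" for k i
    unfolding weak_deriv_def
  proof (intro conjI allI impI)
    fix K :: "(real^'n) set" assume K: "compact K \<and> K \<subseteq> \<Omega>"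
    have "set_integrable lebesgue \<Omega> (\<lambda>x. u x $ k)"
      using u unfolding in_L1_def set_integrable_cart_iff by blast
    then show "set_integrable lebesgue K (\<lambda>x. u x $ k)"
      by (rule set_integrable_subset) (use K lmeasurable_compact[of K] in auto)
    have "integrable (?M) (\<lambda>x. G x $ k $ i)"
      using integrable_bounded_linear[OF bounded_linear_vec_nth integrable_bounded_linear[OF bounded_linear_vec_nth Gi]] .
    then have "set_integrable lebesgue \<Omega> (\<lambda>x. G x $ k $ i)" by (simp add: set_integrable_lebesgue_on \<Omega>s)
    then show "set_integrable lebesgue K (\<lambda>x. G x $ k $ i)"
      by (rule set_integrable_subset) (use K lmeasurable_compact[of K] in auto)
  next
    fix \<phi> assume tf: "test_function \<Omega> \<phi>"
    obtain b where "(\<forall>x. \<bar>\<phi> x\<bar> \<le> b) \<and> (\<forall>x. \<bar>partial \<phi> i x\<bar> \<le> b) \<and>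
      continuous_on UNIV \<phi> \<and> continuous_on UNIV (partial \<phi> i) \<and> 0 \<le> b"
      using test_function_bounds[OF tf, of i] by (elim exE conjE) (intro that conjI)
    then have Kb: "\<And>x. \<bar>\<phi> x\<bar> \<le> b" "\<And>x. \<bar>partial \<phi> i x\<bar> \<le> b"
      "continuous_on UNIV \<phi>" "continuous_on UNIV (partial \<phi> i)" "0 \<le> b"
      by simp_all
    have cm: "h \<in> borel_measurable (?M)" if "continuous_on UNIV h" for h :: "real^'n \<Rightarrow> real"
      by (rule continuous_imp_measurable_on_sets_lebesgue[OF continuous_on_subset[OF that subset_UNIV] \<Omega>s])
    have m\<phi>[measurable]: "\<phi> \<in> borel_measurable (?M)" by (rule cm[OF Kb(3)])
    have \<phi>i: "integrable (?M) (\<lambda>x. \<phi> x * h x)" if "integrable (?M) h" for h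
    proof (rule Bochner_Integration.integrable_bound)
      show "integrable (?M) (\<lambda>x. b * h x)" using that by simp
      show "(\<lambda>x. \<phi> x * h x) \<in> borel_measurable (?M)"
        using m\<phi> borel_measurable_integrable[OF that] by (rule borel_measurable_times)
      have "norm (\<phi> x * h x) \<le> norm (b * h x)" for x
        unfolding norm_mult by (intro mult_right_mono) (use Kb(1)[of x] in auto)
      then show "AE x in ?M. norm (\<phi> x * h x) \<le> norm (b * h x)" by simp
    qed
    have ent: "integrable (?M) (\<lambda>x. H x $ k $ i)" if "integrable (?M) H" for H :: "real^'n \<Rightarrow> real^'n^'d"
      using integrable_bounded_linear[OF bounded_linear_vec_nth integrable_bounded_linear[OF bounded_linear_vec_nth that]] .
    define a where "a n = (LINT x:\<Omega>|lebesgue. partial \<phi> i x * v n x $ k)" for n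
    define a' where "a' = (LINT x:\<Omega>|lebesgue. partial \<phi> i x * u x $ k)"
    \<comment> \<open>Weak convergence is tested with the bounded field whose k-th component is the
      i-th partial derivative of \<open>\<phi>\<close> and whose other components vanish.\<close>
    have "(\<lambda>n. LINT x:\<Omega>|lebesgue. v n x \<bullet> (partial \<phi> i x *\<^sub>R axis k 1)) \<longlonglongrightarrow>
      (LINT x:\<Omega>|lebesgue. u x \<bullet> (partial \<phi> i x *\<^sub>R axis k 1))"
    proof -
      have "(\<lambda>x. partial \<phi> i x *\<^sub>R (axis k 1 :: real^'d)) \<in> borel_measurable (?M)"
        using cm[OF Kb(4)] by (intro borel_measurable_scaleR) auto
      moreover have "in_Linf \<Omega> (\<lambda>x. norm (partial \<phi> i x *\<^sub>R (axis k 1 :: real^'d)))"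
        using cm[OF Kb(4)] Kb(2) by (auto simp: in_Linf_def intro!: exI[of _ b])
      ultimately show ?thesis using wc unfolding weak_L1_conv_def by blast
    qed
    then have aa: "a \<longlonglongrightarrow> a'" unfolding a_def[abs_def] a'_def by (simp add: inner_axis)
    have an: "a n = - (\<integral>x. \<phi> x * D n x $ k $ i \<partial>?M)" for n
      using sw[of n k i] tf unfolding weak_deriv_def a_def by (simp add: set_lebesgue_integral_lebesgue_on[OF \<Omega>s])
    have wa: "wsum (l j) a = - (\<integral>x. \<phi> x * wsum (l j) (\<lambda>n. D n x) $ k $ i \<partial>?M)" for j
    proof -
      have "(\<integral>x. \<phi> x * wsum (l j) (\<lambda>n. D n x) $ k $ i \<partial>?M)
        = (\<integral>x. (\<Sum>n\<in>{n. l j n \<noteq> 0}. l j n * (\<phi> x * D n x $ k $ i)) \<partial>?M)"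
        unfolding wsum_def by (simp add: sum_distrib_left mult.left_commute)
      also have "\<dots> = (\<Sum>n\<in>{n. l j n \<noteq> 0}. \<integral>x. l j n * (\<phi> x * D n x $ k $ i) \<partial>?M)"
        by (intro Bochner_Integration.integral_sum integrable_mult_right \<phi>i ent Di)
      also have "\<dots> = - wsum (l j) a" unfolding wsum_def by (simp add: an sum_negf)
      finally show ?thesis by simp
    qed
    have wi: "integrable (?M) (\<lambda>x. wsum (l j) (\<lambda>n. D n x))" for j
      unfolding wsum_def by (intro Bochner_Integration.integrable_sum integrable_scaleR_right Di)
    have "(\<lambda>j. \<integral>x. \<phi> x * wsum (l j) (\<lambda>n. D n x) $ k $ i \<partial>?M) \<longlonglongrightarrow> (\<integral>x. \<phi> x * G x $ k $ i \<partial>?M)"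
    proof (rule LIM_zero_cancel, rule Lim_null_comparison)
      show "(\<lambda>j. b * (\<integral>x. norm (wsum (l j) (\<lambda>i. D i x) - G x) \<partial>?M)) \<longlonglongrightarrow> 0"
        using tendsto_mult_left[OF L1, of b] by simp
      have "norm ((\<integral>x. \<phi> x * wsum (l j) (\<lambda>n. D n x) $ k $ i \<partial>?M) - (\<integral>x. \<phi> x * G x $ k $ i \<partial>?M))
        \<le> b * (\<integral>x. norm (wsum (l j) (\<lambda>i. D i x) - G x) \<partial>?M)" for j
      proof -
        have "(\<integral>x. \<phi> x * wsum (l j) (\<lambda>n. D n x) $ k $ i \<partial>?M) - (\<integral>x. \<phi> x * G x $ k $ i \<partial>?M)
          = (\<integral>x. \<phi> x * wsum (l j) (\<lambda>n. D n x) $ k $ i - \<phi> x * G x $ k $ i \<partial>?M)"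
          by (intro Bochner_Integration.integral_diff[symmetric] \<phi>i ent wi Gi)
        also have "norm \<dots> \<le> (\<integral>x. norm (\<phi> x * wsum (l j) (\<lambda>n. D n x) $ k $ i - \<phi> x * G x $ k $ i) \<partial>?M)"
          by (rule integral_norm_bound)
        also have "\<dots> \<le> (\<integral>x. b * norm (wsum (l j) (\<lambda>i. D i x) - G x) \<partial>?M)"
        proof (intro integral_mono integrable_norm integrable_mult_right Bochner_Integration.integrable_diff \<phi>i ent wi Gi)
          fix x
          let ?w = "wsum (l j) (\<lambda>n. D n x) - G x"
          have "\<phi> x * wsum (l j) (\<lambda>n. D n x) $ k $ i - \<phi> x * G x $ k $ i = \<phi> x * ?w $ k $ i"
            by (simp add: right_diff_distrib)
          moreover have "\<bar>?w $ k $ i\<bar> \<le> norm ?w"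
            using component_le_norm_cart[of "?w $ k" i] Finite_Cartesian_Product.norm_nth_le[of ?w k] by linarith
          ultimately show "norm (\<phi> x * wsum (l j) (\<lambda>n. D n x) $ k $ i - \<phi> x * G x $ k $ i) \<le> b * norm ?w"
            using Kb(1)[of x] Kb(5) by (simp add: abs_mult mult_mono)
        qed
        finally show ?thesis by simp
      qed
      then show "\<forall>\<^sub>F j in sequentially. norm ((\<integral>x. \<phi> x * wsum (l j) (\<lambda>n. D n x) $ k $ i \<partial>?M) - (\<integral>x. \<phi> x * G x $ k $ i \<partial>?M))
        \<le> b * (\<integral>x. norm (wsum (l j) (\<lambda>i. D i x) - G x) \<partial>?M)"
        by simp
    qed
    then have "(\<lambda>j. wsum (l j) a) \<longlonglongrightarrow> - (\<integral>x. \<phi> x * G x $ k $ i \<partial>?M)"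
      unfolding wa by (rule tendsto_minus)
    then show "(LINT x:\<Omega>|lebesgue. partial \<phi> i x * u x $ k) = - (LINT x:\<Omega>|lebesgue. \<phi> x * G x $ k $ i)"
      using wsum_tendsto[OF aa l] LIMSEQ_unique unfolding a'_def set_lebesgue_integral_lebesgue_on[OF \<Omega>s] by blast
  qed
  then show ?thesis using l Gi ae by (intro exI[of _ l] exI[of _ G] conjI) auto
qed

section \<open>Compactness\<close>

lemma weak_deriv_diff:
  fixes u w :: "real^'n \<Rightarrow> real"
  assumes u: "weak_deriv \<Omega> u i g" and w: "weak_deriv \<Omega> w i h"
  shows "weak_deriv \<Omega> (\<lambda>x. u x - w x) i (\<lambda>x. g x - h x)"
  unfolding weak_deriv_def
proof (intro conjI allI impI)
  fix K :: "(real^'n) set" assume "compact K \<and> K \<subseteq> \<Omega>"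
  then show "set_integrable lebesgue K (\<lambda>x. u x - w x)" "set_integrable lebesgue K (\<lambda>x. g x - h x)"
    using u w unfolding weak_deriv_def by (auto intro: set_integral_diff)
next
  fix \<phi> assume tf: "test_function \<Omega> \<phi>"
  obtain K B where KB: "compact K" "K \<subseteq> \<Omega>"
      "\<And>x. x \<notin> K \<Longrightarrow> \<phi> x = 0" "\<And>x. x \<notin> K \<Longrightarrow> partial \<phi> i x = 0"
      "\<And>x. \<bar>\<phi> x\<bar> \<le> B" "\<And>x. \<bar>partial \<phi> i x\<bar> \<le> B"
      "continuous_on UNIV \<phi>" "continuous_on UNIV (partial \<phi> i)"
    using test_function_bounds[OF tf, of i] by blast
  have I1: "set_integrable lebesgue \<Omega> (\<lambda>x. partial \<phi> i x * f x)" if "set_integrable lebesgue K f" for f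
    using bounded_test_integrable[OF that KB(1,2) KB(8) KB(6) KB(4)] by simp
  have I2: "set_integrable lebesgue \<Omega> (\<lambda>x. \<phi> x * f x)" if "set_integrable lebesgue K f" for f
    using bounded_test_integrable[OF that KB(1,2) KB(7) KB(5) KB(3)] by simp
  have K: "set_integrable lebesgue K u" "set_integrable lebesgue K g" "set_integrable lebesgue K w" "set_integrable lebesgue K h"
    using weak_deriv_integrable[OF u KB(1,2)] weak_deriv_integrable[OF w KB(1,2)] by auto
  show "(LINT x:\<Omega>|lebesgue. partial \<phi> i x * (u x - w x)) = - (LINT x:\<Omega>|lebesgue. \<phi> x * (g x - h x))"
    using u w tf unfolding weak_deriv_def right_diff_distrib
    by (simp add: set_integral_diff(2)[OF I1[OF K(1)] I1[OF K(3)]] set_integral_diff(2)[OF I2[OF K(2)] I2[OF K(4)]])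
qed

lemma integral_box_lebesgue_on:
  fixes h :: "real^'n \<Rightarrow> real"
  assumes "\<Omega> \<in> sets lebesgue" "cbox a b \<subseteq> \<Omega>" "set_integrable lebesgue (cbox a b) h"
  shows "(\<integral>x. indicator (cbox a b) x * h x \<partial>lebesgue_on \<Omega>) = integral (cbox a b) h"
    "integrable (lebesgue_on \<Omega>) (\<lambda>x. indicator (cbox a b) x * h x)"
proof -
  have eq: "indicator \<Omega> x * (indicator (cbox a b) x * h x) = indicator (cbox a b) x * h x" for x
    using assms(2) by (auto simp: indicator_def)
  show "(\<integral>x. indicator (cbox a b) x * h x \<partial>lebesgue_on \<Omega>) = integral (cbox a b) h"
    unfolding set_lebesgue_integral_eq_integral(2)[OF assms(3), symmetric]
    using assms(1) by (simp add: integral_restrict_space set_lebesgue_integral_def eq del: indicator_simps)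
  show "integrable (lebesgue_on \<Omega>) (\<lambda>x. indicator (cbox a b) x * h x)"
    using assms(1,3) by (simp add: integrable_restrict_space set_integrable_def eq)
qed

lemma weak_conv_component_box:
  fixes u :: "real^'n \<Rightarrow> real^'d"
  assumes \<Omega>: "\<Omega> \<in> sets lebesgue" and wc: "weak_L1_conv \<Omega> v u" and u: "in_L1 \<Omega> u" and v: "\<And>n. in_L1 \<Omega> (v n)"
    and cd: "cbox c d \<subseteq> \<Omega>"
  shows "(\<lambda>n. integral (cbox c d) (\<lambda>x. v n x $ k - u x $ k)) \<longlonglongrightarrow> 0"
proof -
  let ?M = "lebesgue_on \<Omega>"
  \<comment> \<open>A bounded test field whose pairing with a function integrates the k-th component
    over the box.\<close>
  let ?g = "\<lambda>x. indicator (cbox c d) x *\<^sub>R (axis k 1 :: real^'d)"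
  have "cbox c d \<in> sets lebesgue" by simp
  then have m: "(indicator (cbox c d) :: _ \<Rightarrow> real) \<in> borel_measurable (?M)"
    by (intro measurable_restrict_space1 borel_measurable_indicator)
  have "?g \<in> borel_measurable (?M)"
    using m by (intro borel_measurable_scaleR) auto
  moreover have "in_Linf \<Omega> (\<lambda>x. norm (?g x))"
    using m by (auto simp: in_Linf_def intro!: exI[of _ 1] AE_I2)
  ultimately have "(\<lambda>n. LINT x:\<Omega>|lebesgue. v n x \<bullet> ?g x) \<longlonglongrightarrow> (LINT x:\<Omega>|lebesgue. u x \<bullet> ?g x)"
    using wc unfolding weak_L1_conv_def by blast
  moreover have "(LINT x:\<Omega>|lebesgue. h x \<bullet> ?g x) = integral (cbox c d) (\<lambda>x. h x $ k)"
    and hi: "(\<lambda>x. h x $ k) integrable_on cbox c d" if "in_L1 \<Omega> h" for h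
  proof -
    have "set_integrable lebesgue \<Omega> (\<lambda>x. h x $ k)"
      using that unfolding in_L1_def set_integrable_cart_iff by blast
    then have i: "set_integrable lebesgue (cbox c d) (\<lambda>x. h x $ k)"
      by (rule set_integrable_subset) (use cd in auto)
    then show "(\<lambda>x. h x $ k) integrable_on cbox c d" by (rule set_lebesgue_integral_eq_integral(1))
    have "(LINT x:\<Omega>|lebesgue. h x \<bullet> ?g x) = (\<integral>x. indicator (cbox c d) x * h x $ k \<partial>?M)"
      unfolding set_lebesgue_integral_lebesgue_on[OF \<Omega>] by (simp add: inner_axis)
    then show "(LINT x:\<Omega>|lebesgue. h x \<bullet> ?g x) = integral (cbox c d) (\<lambda>x. h x $ k)"
      using integral_box_lebesgue_on(1)[OF \<Omega> cd i] by simp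
  qed
  ultimately have "(\<lambda>n. integral (cbox c d) (\<lambda>x. v n x $ k)) \<longlonglongrightarrow> integral (cbox c d) (\<lambda>x. u x $ k)"
    using u v by simp
  then have "(\<lambda>n. integral (cbox c d) (\<lambda>x. v n x $ k) - integral (cbox c d) (\<lambda>x. u x $ k)) \<longlonglongrightarrow> 0"
    by (rule LIM_zero)
  then show ?thesis using hi u v by (simp add: Henstock_Kurzweil_Integration.integral_diff)
qed

text \<open>\<open>L1_convergence_on_box\<close> is applied to the differences v n - u. For this u
  must itself have an integrable weak gradient, which \<open>weak_gradient_limit\<close>
  supplies.\<close>

lemma rellich_box:
  fixes u :: "real^'n \<Rightarrow> real^'d" and D :: "nat \<Rightarrow> real^'n \<Rightarrow> real^'n^'d"
  assumes \<Omega>: "open \<Omega>" "bounded \<Omega>" and u: "in_L1 \<Omega> u" and v: "\<And>n. in_L1 \<Omega> (v n)" and wc: "weak_L1_conv \<Omega> v u"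
    and sw: "\<And>n k i. weak_deriv \<Omega> (\<lambda>x. v n x $ k) i (\<lambda>x. D n x $ k $ i)"
    and D: "\<And>n. square_integrable (lebesgue_on \<Omega>) (D n)"
    and B: "\<And>n. (\<integral>x. (norm (D n x))\<^sup>2 \<partial>lebesgue_on \<Omega>) \<le> B"
    and ab: "cbox a b \<subseteq> \<Omega>"
  shows "(\<lambda>n. integral (cbox a b) (\<lambda>x. \<bar>v n x $ k - u x $ k\<bar>)) \<longlonglongrightarrow> 0"
proof -
  let ?M = "lebesgue_on \<Omega>"
  have \<Omega>s: "\<Omega> \<in> sets lebesgue" using \<Omega> by auto
  have fm: "finite_measure (?M)"
    using \<Omega> by (intro finite_measure_lebesgue_on bounded_set_imp_lmeasurable) auto
  obtain G where G: "integrable (?M) G" "\<forall>k i. weak_deriv \<Omega> (\<lambda>x. u x $ k) i (\<lambda>x. G x $ k $ i)"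
    using weak_gradient_limit[OF \<Omega> u wc sw D B] by (elim exE conjE) (rule that)
  \<comment> \<open>The case \<delta> = 1 of \<open>square_integrable_L1_bound\<close> for D n, plus
    the L^1 norm of the limit gradient.\<close>
  define M where "M = 1 * measure (?M) (space (?M)) + B / 1 + (\<integral>x. norm (G x) \<partial>?M)"
  have Di: "integrable (?M) (D n)" for n
    by (rule square_integrable_L1_bound(1)[OF fm D zero_less_one])
  have sd: "weak_deriv \<Omega> (\<lambda>x. v n x $ k - u x $ k) i (\<lambda>x. D n x $ k $ i - G x $ k $ i)" for n i
    using sw G(2) by (intro weak_deriv_diff) blast+
  show ?thesis
  proof (rule L1_convergence_on_box[OF sd ab])
    fix n i
    have si: "set_integrable lebesgue (cbox a b) (\<lambda>x. D n x $ k $ i - G x $ k $ i)"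
      by (rule weak_deriv_integrable(2)[OF sd compact_cbox ab])
    have "integral (cbox a b) (\<lambda>x. \<bar>D n x $ k $ i - G x $ k $ i\<bar>)
      = (\<integral>x. indicator (cbox a b) x * \<bar>D n x $ k $ i - G x $ k $ i\<bar> \<partial>?M)"
      by (rule integral_box_lebesgue_on(1)[OF \<Omega>s ab set_integrable_abs[OF si], symmetric])
    also have "\<dots> \<le> (\<integral>x. norm (D n x) + norm (G x) \<partial>?M)"
    proof (intro integral_mono integral_box_lebesgue_on(2)[OF \<Omega>s ab set_integrable_abs[OF si]]
        Bochner_Integration.integrable_add integrable_norm Di G(1))
      fix x
      have "\<bar>H $ k $ i\<bar> \<le> norm H" for H :: "real^'n^'d"
        using component_le_norm_cart[of "H $ k" i] Finite_Cartesian_Product.norm_nth_le[of H k] by linarith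
      from this[of "D n x"] this[of "G x"]
      show "indicator (cbox a b) x * \<bar>D n x $ k $ i - G x $ k $ i\<bar> \<le> norm (D n x) + norm (G x)"
        by (auto simp: indicator_def)
    qed
    also have "\<dots> = (\<integral>x. norm (D n x) \<partial>?M) + (\<integral>x. norm (G x) \<partial>?M)"
      by (intro Bochner_Integration.integral_add integrable_norm Di G(1))
    also have "\<dots> \<le> M"
      unfolding M_def using square_integrable_L1_bound(2)[OF fm D[of n] zero_less_one] B[of n] by simp
    finally show "integral (cbox a b) (\<lambda>x. \<bar>D n x $ k $ i - G x $ k $ i\<bar>) \<le> M" .
  next
    fix c d assume "cbox c d \<subseteq> cbox a b"
    then show "(\<lambda>n. integral (cbox c d) (\<lambda>x. v n x $ k - u x $ k)) \<longlonglongrightarrow> 0"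
      using ab by (intro weak_conv_component_box[OF \<Omega>s wc u v]) auto
  qed
qed

text \<open>Finitely many boxes in \<Omega> cover all but a set of small measure, and truncation at
  1 lets the uncovered part contribute at most its measure. This avoids estimates up to the boundary
  and still yields almost everywhere convergence along a subsequence.\<close>

lemma rellich_in_measure:
  fixes u :: "real^'n \<Rightarrow> real^'d" and D :: "nat \<Rightarrow> real^'n \<Rightarrow> real^'n^'d"
  assumes \<Omega>: "open \<Omega>" "bounded \<Omega>" and u: "in_L1 \<Omega> u" and v: "\<And>n. in_L1 \<Omega> (v n)" and wc: "weak_L1_conv \<Omega> v u"
    and sw: "\<And>n k i. weak_deriv \<Omega> (\<lambda>x. v n x $ k) i (\<lambda>x. D n x $ k $ i)"
    and D: "\<And>n. square_integrable (lebesgue_on \<Omega>) (D n)"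
    and B: "\<And>n. (\<integral>x. (norm (D n x))\<^sup>2 \<partial>lebesgue_on \<Omega>) \<le> B"
  shows "(\<lambda>n. \<integral>x. min 1 (norm (v n x - u x)) \<partial>lebesgue_on \<Omega>) \<longlonglongrightarrow> 0"
proof (rule LIMSEQ_I)
  let ?M = "lebesgue_on \<Omega>"
  fix e :: real assume e: "e > 0"
  have \<Omega>s: "\<Omega> \<in> sets lebesgue" using \<Omega> by auto
  interpret finite_measure "?M"
    using \<Omega> by (intro finite_measure_lebesgue_on bounded_set_imp_lmeasurable) auto
  have e2: "e / 2 > 0" using e by simp
  obtain T where T': "closed T" "T \<subseteq> \<Omega>" "\<Omega> - T \<in> lmeasurable" "emeasure lebesgue (\<Omega> - T) < ennreal (e / 2)"
    by (rule sets_lebesgue_inner_closed[OF \<Omega>s e2])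
  have T: "closed T" "T \<subseteq> \<Omega>" "\<Omega> - T \<in> lmeasurable" "measure lebesgue (\<Omega> - T) < e / 2"
    using T' by (simp_all add: emeasure_eq_measure2 ennreal_less_iff)
  have cT: "compact T" using T \<Omega>(2) bounded_subset compact_eq_bounded_closed by blast
  have "\<forall>x. \<exists>ab. x \<in> T \<longrightarrow> x \<in> box (fst ab) (snd ab) \<and> cbox (fst ab) (snd ab) \<subseteq> \<Omega>"
    using open_contains_cbox[OF \<Omega>(1)] T(2) by (metis fst_conv snd_conv subsetD)
  then obtain ab where ab: "\<And>x. x \<in> T \<Longrightarrow> x \<in> box (fst (ab x)) (snd (ab x))" "\<And>x. x \<in> T \<Longrightarrow> cbox (fst (ab x)) (snd (ab x)) \<subseteq> \<Omega>"
    by metis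
  define R where "R x = cbox (fst (ab x)) (snd (ab x))" for x
  obtain F where F: "F \<subseteq> T" "finite F" "T \<subseteq> (\<Union>x\<in>F. box (fst (ab x)) (snd (ab x)))"
  proof (rule compactE_image[OF cT, of T "\<lambda>x. box (fst (ab x)) (snd (ab x))"])
    show "T \<subseteq> (\<Union>x\<in>T. box (fst (ab x)) (snd (ab x)))" using ab(1) by blast
  qed auto
  define S where "S n = (\<Sum>y\<in>F. \<Sum>k\<in>UNIV. integral (R y) (\<lambda>x. \<bar>v n x $ k - u x $ k\<bar>))" for n
  have "S \<longlonglongrightarrow> (\<Sum>y\<in>F. \<Sum>k\<in>(UNIV :: 'd set). 0)"
    unfolding S_def[abs_def] R_def
    by (intro tendsto_sum rellich_box[OF \<Omega> u v wc sw D B] ab(2)) (use F in auto)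
  then have "eventually (\<lambda>n. S n < e / 2) sequentially"
    using e by (intro order_tendstoD(2)) auto
  then obtain N where N: "\<And>n. n \<ge> N \<Longrightarrow> S n < e / 2" unfolding eventually_sequentially by blast
  have ui: "set_integrable lebesgue (R y) (\<lambda>x. \<bar>v n x $ k - u x $ k\<bar>)" if "y \<in> F" for y n k
  proof -
    have "set_integrable lebesgue \<Omega> (\<lambda>x. v n x $ k)" "set_integrable lebesgue \<Omega> (\<lambda>x. u x $ k)"
      using u v unfolding in_L1_def set_integrable_cart_iff by blast+
    then have "set_integrable lebesgue \<Omega> (\<lambda>x. v n x $ k - u x $ k)" by (rule set_integral_diff(1))
    then have "set_integrable lebesgue (R y) (\<lambda>x. v n x $ k - u x $ k)"
      by (rule set_integrable_subset) (use ab(2) F(1) that in \<open>auto simp: R_def\<close>)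
    then show ?thesis by (rule set_integrable_abs)
  qed
  have Ry: "R y \<subseteq> \<Omega>" if "y \<in> F" for y using ab(2) F(1) that by (auto simp: R_def)
  have main: "(\<integral>x. min 1 (norm (v n x - u x)) \<partial>?M) \<le> measure lebesgue (\<Omega> - T) + S n" for n
  proof -
    have bi: "integrable (?M) (\<lambda>x. indicator (R y) x * \<bar>v n x $ k - u x $ k\<bar>)" if "y \<in> F" for y k
      unfolding R_def by (rule integral_box_lebesgue_on(2)[OF \<Omega>s]) (use Ry ui that in \<open>auto simp: R_def\<close>)
    have b: "(\<integral>x. indicator (R y) x * \<bar>v n x $ k - u x $ k\<bar> \<partial>?M) = integral (R y) (\<lambda>x. \<bar>v n x $ k - u x $ k\<bar>)" if "y \<in> F" for y k
      unfolding R_def by (rule integral_box_lebesgue_on(1)[OF \<Omega>s]) (use Ry ui that in \<open>auto simp: R_def\<close>)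
    have vu: "integrable (?M) (\<lambda>x. v n x - u x)"
      using u v unfolding in_L1_def set_integrable_lebesgue_on[OF \<Omega>s] by (intro Bochner_Integration.integrable_diff)
    have mi: "integrable (?M) (\<lambda>x. min 1 (norm (v n x - u x)))"
      by (rule Bochner_Integration.integrable_bound[OF vu])
        (use borel_measurable_integrable[OF vu] in \<open>auto intro!: borel_measurable_min borel_measurable_norm\<close>)
    have sT: "\<Omega> - T \<in> sets (?M)" using T(3) by (auto simp: sets_restrict_space)
    have ii: "integrable (?M) (indicator (\<Omega> - T) :: _ \<Rightarrow> real)"
      using sT by (intro integrable_real_indicator) (auto simp: less_top[symmetric])
    have si: "integrable (?M) (\<lambda>x. \<Sum>y\<in>F. \<Sum>k\<in>UNIV. indicator (R y) x * \<bar>v n x $ k - u x $ k\<bar>)"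
      by (intro Bochner_Integration.integrable_sum bi)
    have "(\<integral>x. min 1 (norm (v n x - u x)) \<partial>?M)
      \<le> (\<integral>x. indicator (\<Omega> - T) x + (\<Sum>y\<in>F. \<Sum>k\<in>UNIV. indicator (R y) x * \<bar>v n x $ k - u x $ k\<bar>) \<partial>?M)"
    proof (intro integral_mono mi Bochner_Integration.integrable_add ii si)
      fix x assume "x \<in> space (?M)"
      then have x: "x \<in> \<Omega>" by simp
      have nn: "0 \<le> (\<Sum>k\<in>UNIV. indicator (R y) x * \<bar>v n x $ k - u x $ k\<bar>)" for y by (intro sum_nonneg) auto
      show "min 1 (norm (v n x - u x)) \<le> indicator (\<Omega> - T) x + (\<Sum>y\<in>F. \<Sum>k\<in>UNIV. indicator (R y) x * \<bar>v n x $ k - u x $ k\<bar>)"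
      proof (cases "x \<in> T")
        case True
        then obtain y where y: "y \<in> F" "x \<in> R y"
          using F(3) box_subset_cbox unfolding R_def by blast
        have "norm (v n x - u x) \<le> (\<Sum>k\<in>UNIV. \<bar>(v n x - u x) $ k\<bar>)" by (rule norm_le_l1_cart)
        also have "\<dots> = (\<Sum>k\<in>UNIV. indicator (R y) x * \<bar>v n x $ k - u x $ k\<bar>)" using y by simp
        also have "\<dots> \<le> (\<Sum>y\<in>F. \<Sum>k\<in>UNIV. indicator (R y) x * \<bar>v n x $ k - u x $ k\<bar>)"
          using y F(2) nn by (intro member_le_sum) auto
        finally show ?thesis using True by simp
      next
        case False
        have "0 \<le> (\<Sum>y\<in>F. \<Sum>k\<in>UNIV. indicator (R y) x * \<bar>v n x $ k - u x $ k\<bar>)" using nn by (intro sum_nonneg) auto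
        then show ?thesis using False x by simp
      qed
    qed
    also have "\<dots> = (\<integral>x. indicator (\<Omega> - T) x \<partial>?M) + (\<integral>x. (\<Sum>y\<in>F. \<Sum>k\<in>UNIV. indicator (R y) x * \<bar>v n x $ k - u x $ k\<bar>) \<partial>?M)"
      by (rule Bochner_Integration.integral_add[OF ii si])
    also have "(\<integral>x. indicator (\<Omega> - T) x \<partial>?M) = measure lebesgue (\<Omega> - T)"
    proof -
      have "(\<Omega> - T) \<inter> \<Omega> = \<Omega> - T" by blast
      then show ?thesis using \<Omega>s by (simp add: measure_restrict_space)
    qed
    also have "(\<integral>x. (\<Sum>y\<in>F. \<Sum>k\<in>UNIV. indicator (R y) x * \<bar>v n x $ k - u x $ k\<bar>) \<partial>?M) = S n"
      unfolding S_def by (subst Bochner_Integration.integral_sum, intro Bochner_Integration.integrable_sum bi, assumption)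
        (intro sum.cong refl, subst Bochner_Integration.integral_sum, auto intro!: bi sum.cong b)
    finally show ?thesis .
  qed
  have "norm ((\<integral>x. min 1 (norm (v n x - u x)) \<partial>?M) - 0) < e" if "n \<ge> N" for n
  proof -
    have "0 \<le> (\<integral>x. min 1 (norm (v n x - u x)) \<partial>?M)" by (intro integral_nonneg_AE) auto
    then show ?thesis using main[of n] N[OF that] T(4) by simp
  qed
  then show "\<exists>n0. \<forall>n\<ge>n0. norm ((\<integral>x. min 1 (norm (v n x - u x)) \<partial>?M) - 0) < e" by blast
qed

section \<open>The limit of bounded energies\<close>

lemma borel_measurable_vecI:
  fixes D :: "'a \<Rightarrow> real^'d"
  assumes "\<And>k. (\<lambda>x. D x $ k) \<in> borel_measurable M"
  shows "D \<in> borel_measurable M"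
  using assms by (subst borel_measurable_euclidean_space) (auto simp: Basis_vec_def inner_axis)

text \<open>Boundedness of u is the scalar estimate in each component, and this is where the
  Lipschitz boundary enters. The second conclusion, by uniqueness, transfers statements about G to
  \<open>weak_grad\<close>.\<close>

lemma bounded_weak_gradient_imp_sobolev_inf:
  fixes u :: "real^'n \<Rightarrow> real^'d" and G :: "real^'n \<Rightarrow> real^'n^'d"
  assumes \<Omega>: "open \<Omega>" "bounded \<Omega>" "lipschitz_boundary \<Omega>" and u: "in_L1 \<Omega> u"
    and G: "G \<in> borel_measurable (lebesgue_on \<Omega>)" and R: "0 \<le> R" and GR: "AE x in lebesgue_on \<Omega>. norm (G x) \<le> R"
    and sw: "\<And>k i. weak_deriv \<Omega> (\<lambda>x. u x $ k) i (\<lambda>x. G x $ k $ i)"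
  shows "sobolev_inf \<Omega> u" "AE x in lebesgue_on \<Omega>. weak_grad \<Omega> u x = G x"
proof -
  let ?M = "lebesgue_on \<Omega>"
  have \<Omega>s: "\<Omega> \<in> sets lebesgue" using \<Omega> by auto
  have entry: "\<bar>H $ k $ i\<bar> \<le> norm H" for H :: "real^'n^'d" and k i
    using component_le_norm_cart[of "H $ k" i] Finite_Cartesian_Product.norm_nth_le[of H k] by linarith
  have entm: "(\<lambda>x. G x $ k $ i) \<in> borel_measurable (?M)" for k i
    by (rule borel_measurable_lebesgue_on_exhaustion[OF \<Omega>(1) weak_deriv_integrable(2)[OF sw]])
  have wp: "weak_partial \<Omega> u i (\<lambda>x. \<chi> k. G x $ k $ i)" for i
    unfolding weak_partial_iff_weak_deriv using sw by simp
  have um: "u \<in> borel_measurable (?M)"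
    using u unfolding in_L1_def set_integrable_lebesgue_on[OF \<Omega>s] by (rule borel_measurable_integrable)
  have "\<exists>B. AE y in lborel. y \<in> \<Omega> \<longrightarrow> \<bar>u y $ k\<bar> \<le> B" for k
  proof (rule weak_deriv_bounded[OF \<Omega>(1) sw R _ \<Omega>(3,2)])
    fix i
    show "AE x in lborel. x \<in> \<Omega> \<longrightarrow> \<bar>G x $ k $ i\<bar> \<le> R"
      using GR unfolding AE_lebesgue_on_iff[OF \<Omega>s] by eventually_elim (use entry order_trans in blast)
  qed
  then obtain B where B: "\<And>k. AE y in lborel. y \<in> \<Omega> \<longrightarrow> \<bar>u y $ k\<bar> \<le> B k" by metis
  have "AE y in lborel. \<forall>k\<in>UNIV. y \<in> \<Omega> \<longrightarrow> \<bar>u y $ k\<bar> \<le> B k"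
    using B by (intro AE_finite_allI) auto
  then have "AE y in lborel. y \<in> \<Omega> \<longrightarrow> norm (u y) \<le> (\<Sum>k\<in>UNIV. B k)"
  proof eventually_elim
    case (elim y)
    then show ?case using norm_le_l1_cart[of "u y"] sum_mono[of UNIV "\<lambda>k. \<bar>u y $ k\<bar>" B] by auto
  qed
  then have "AE y in ?M. \<bar>norm (u y)\<bar> \<le> (\<Sum>k\<in>UNIV. B k)"
    unfolding AE_lebesgue_on_iff[OF \<Omega>s] by simp
  then have "in_Linf \<Omega> (\<lambda>x. norm (u x))"
    unfolding in_Linf_def by (intro conjI measurable_compose[OF um borel_measurable_norm] exI)
  moreover have "\<exists>g. weak_partial \<Omega> u i g \<and> g \<in> borel_measurable (?M) \<and> in_Linf \<Omega> (\<lambda>x. norm (g x))" for i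
  proof (intro exI[of _ "\<lambda>x. \<chi> k. G x $ k $ i"] conjI wp)
    show m: "(\<lambda>x. \<chi> k. G x $ k $ i) \<in> borel_measurable (?M)"
      using entm by (intro borel_measurable_vecI) simp
    have "AE x in ?M. \<bar>norm (\<chi> k. G x $ k $ i)\<bar> \<le> (\<Sum>k\<in>(UNIV :: 'd set). R)"
      using GR
    proof eventually_elim
      case (elim x)
      have "norm (\<chi> k. G x $ k $ i) \<le> (\<Sum>k\<in>UNIV. \<bar>(\<chi> k. G x $ k $ i) $ k\<bar>)" by (rule norm_le_l1_cart)
      also have "\<dots> \<le> (\<Sum>k\<in>(UNIV :: 'd set). R)"
        by (intro sum_mono) (use elim entry order_trans in \<open>simp, blast\<close>)
      finally show ?case by simp
    qed
    then show "in_Linf \<Omega> (\<lambda>x. norm (\<chi> k. G x $ k $ i))"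
      unfolding in_Linf_def by (intro conjI measurable_compose[OF m borel_measurable_norm] exI)
  qed
  ultimately show "sobolev_inf \<Omega> u" unfolding sobolev_inf_def using um by blast
  have "AE x in lborel. \<forall>k\<in>UNIV. \<forall>i\<in>UNIV. x \<in> \<Omega> \<longrightarrow> weak_grad \<Omega> u x $ k $ i = G x $ k $ i"
  proof (intro AE_finite_allI)
    fix k i
    have "weak_deriv \<Omega> (\<lambda>x. u x $ k) i (\<lambda>x. weak_grad \<Omega> u x $ k $ i)"
      by (rule weak_grad_weak_deriv) (use wp in blast)
    then show "AE x in lborel. x \<in> \<Omega> \<longrightarrow> weak_grad \<Omega> u x $ k $ i = G x $ k $ i"
      by (rule weak_deriv_unique[OF \<Omega>(1) _ sw])
  qed auto
  then show "AE x in ?M. weak_grad \<Omega> u x = G x"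
    unfolding AE_lebesgue_on_iff[OF \<Omega>s] by eventually_elim (simp add: vec_eq_iff)
qed

text \<open>The lower bound for a sequence already thinned out: exponents of at least n + m let the
  excess estimate apply from the first index on, and its right side tends to 0.\<close>

lemma bounded_energy_limit:
  fixes \<Omega> :: "(real^'n) set" and f :: "real^'n \<Rightarrow> real^'d \<Rightarrow> real^'n^'d \<Rightarrow> real"
  assumes \<Omega>: "open \<Omega>" "bounded \<Omega>" "lipschitz_boundary \<Omega>" and ni: "normal_integrand \<Omega> f"
    and H1: "AE x in lebesgue_on \<Omega>. \<forall>u. level_convex (f x u)"
    and H2: "\<alpha> > 0" "\<gamma> > 0" "AE x in lebesgue_on \<Omega>. \<forall>u \<xi>. f x u \<xi> \<ge> \<alpha> * norm \<xi> powr \<gamma>"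
    and u: "in_L1 \<Omega> u" and v: "\<And>n. in_L1 \<Omega> (v n)" and wc: "weak_L1_conv \<Omega> v u"
    and sob: "\<And>n. sobolev_var \<Omega> (q n) (v n)"
    and qm: "\<And>n. q n \<in> borel_measurable (lebesgue_on \<Omega>)"
    and m: "m \<ge> 2" "2 \<le> \<gamma> * real m"
    and cq: "\<And>n. AE x in lebesgue_on \<Omega>. real (n + m) \<le> q n x"
    and C: "0 \<le> C"
    and E: "\<And>n. (\<integral>\<^sup>+x. ennreal ((1 / q n x) * f x (v n x) (weak_grad \<Omega> (v n) x) powr q n x) \<partial>lebesgue_on \<Omega>) \<le> ennreal C"
  shows "sobolev_inf \<Omega> u \<and> (AE x in lebesgue_on \<Omega>. \<bar>f x (u x) (weak_grad \<Omega> u x)\<bar> \<le> 1)"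
proof -
  let ?M = "lebesgue_on \<Omega>"
  have \<Omega>s: "\<Omega> \<in> sets lebesgue" using \<Omega> by auto
  have fm: "finite_measure (?M)"
    using \<Omega> by (intro finite_measure_lebesgue_on bounded_set_imp_lmeasurable) auto
  interpret finite_measure "?M" by (rule fm)
  define D where "D n = weak_grad \<Omega> (v n)" for n
  have sw: "weak_deriv \<Omega> (\<lambda>x. v n x $ k) i (\<lambda>x. D n x $ k $ i)" for n k i
    unfolding D_def by (rule weak_grad_weak_deriv) (use sob[of n] in \<open>auto simp: sobolev_var_def\<close>)
  have Dm[measurable]: "D n \<in> borel_measurable (?M)" for n
    by (intro borel_measurable_matrixI borel_measurable_lebesgue_on_exhaustion[OF \<Omega>(1)] weak_deriv_integrable(2)[OF sw])
  have vi: "integrable (?M) (v n)" and ui: "integrable (?M) u" for n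
    using v u unfolding in_L1_def set_integrable_lebesgue_on[OF \<Omega>s] by blast+
  have [measurable]: "v n \<in> borel_measurable (?M)" "u \<in> borel_measurable (?M)" for n
    using vi ui by auto
  define F where "F n x = f x (v n x) (D n x)" for n x
  have Fm[measurable]: "F n \<in> borel_measurable (?M)" for n
  proof -
    \<comment> \<open>Joint measurability of the integrand gives measurability of its composition
      with this map.\<close>
    have "(\<lambda>x. (x, v n x, D n x)) \<in> ?M \<rightarrow>\<^sub>M ?M \<Otimes>\<^sub>M (borel \<Otimes>\<^sub>M borel)"
      by measurable
    from measurable_compose[OF this, of "\<lambda>(x, u, \<xi>). f x u \<xi>" borel] ni
    show ?thesis by (simp add: normal_integrand_def F_def[abs_def])
  qed
  have F0: "AE x in ?M. 0 \<le> F n x" for n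
    using H2(3)
  proof eventually_elim
    case (elim x)
    have "0 \<le> \<alpha> * norm (D n x) powr \<gamma>" using H2(1) by simp
    then show ?case unfolding F_def using elim order_trans by blast
  qed
  define z where "z n x = (max (F n x - 1) 0) ^ m" for n x
  have z0: "0 \<le> z n x" for n x by (simp add: z_def)
  have E': "(\<integral>\<^sup>+x. ennreal (1 / q n x * F n x powr q n x) \<partial>?M) \<le> ennreal C" for n
    using E[of n] by (simp add: F_def D_def)
  have zi: "integrable (?M) (z n)" for n
    unfolding z_def by (rule excess_integral_le(1)[OF Fm qm F0 cq _ m(1) E' C]) simp
  have zb: "(\<integral>x. z n x \<partial>?M) \<le> 2 * real m ^ m / (real (n + m) - 1) * C" for n
    unfolding z_def by (rule excess_integral_le(2)[OF Fm qm F0 cq _ m(1) E' C]) simp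
  define A where "A = (1 / \<alpha>) powr (2 / \<gamma>) * 2 ^ m"
  have A0: "0 \<le> A" by (simp add: A_def)
  have Dz: "AE x in ?M. (norm (D n x))\<^sup>2 \<le> A * (1 + z n x)" for n
    using H2(3)
  proof eventually_elim
    case (elim x)
    have "\<alpha> * norm (D n x) powr \<gamma> \<le> F n x" unfolding F_def using elim by blast
    then show ?case unfolding A_def z_def by (intro norm_sq_le_excess H2 m) auto
  qed
  have Azi: "integrable (?M) (\<lambda>x. A * (1 + z n x))" for n
    by (intro integrable_mult_right Bochner_Integration.integrable_add zi) simp
  have D2: "integrable (?M) (\<lambda>x. (norm (D n x))\<^sup>2)" for n
  proof (rule Bochner_Integration.integrable_bound[OF Azi])
    show "AE x in ?M. norm ((norm (D n x))\<^sup>2) \<le> norm (A * (1 + z n x))"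
      using Dz[of n] by eventually_elim simp
  qed measurable
  have Dsq: "square_integrable (?M) (D n)" for n
    using D2 Dm by (simp add: square_integrable_def)
  define B where "B = A * (measure (?M) (space (?M)) + 2 * real m ^ m * C)"
  have DB: "(\<integral>x. (norm (D n x))\<^sup>2 \<partial>?M) \<le> B" for n
  proof -
    have "(\<integral>x. (norm (D n x))\<^sup>2 \<partial>?M) \<le> (\<integral>x. A * (1 + z n x) \<partial>?M)"
      by (rule integral_mono_AE[OF D2 Azi Dz])
    also have "\<dots> = A * (measure (?M) (space (?M)) + (\<integral>x. z n x \<partial>?M))"
      using zi by simp
    also have "\<dots> \<le> B"
      unfolding B_def
    proof (intro mult_left_mono add_left_mono A0)
      \<comment> \<open>As m \<ge> 2, the denominator n + m - 1 is at least 1 for every n.\<close>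
      have "2 * real m ^ m / (real (n + m) - 1) * C \<le> 2 * real m ^ m / 1 * C"
        using m C by (intro mult_right_mono divide_left_mono) auto
      then show "(\<integral>x. z n x \<partial>?M) \<le> 2 * real m ^ m * C" using zb[of n] by simp
    qed
    finally show ?thesis .
  qed
  \<comment> \<open>One function collects the distance of v n to u and the excess, so that a single
    subsequence serves both.\<close>
  define h where "h n x = min 1 (norm (v n x - u x)) + z n x" for n x
  have mi: "integrable (?M) (\<lambda>x. min 1 (norm (v n x - u x)))" for n
  proof (rule Bochner_Integration.integrable_bound[OF Bochner_Integration.integrable_diff[OF vi[of n] ui]])
    show "(\<lambda>x. min 1 (norm (v n x - u x))) \<in> borel_measurable (?M)" by measurable
  qed auto
  have hi: "integrable (?M) (h n)" for n
    unfolding h_def by (intro Bochner_Integration.integrable_add mi zi)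
  have "(\<lambda>n. \<integral>x. norm (h n x) \<partial>?M) \<longlonglongrightarrow> 0"
  proof -
    have "(\<integral>x. norm (h n x) \<partial>?M) = (\<integral>x. min 1 (norm (v n x - u x)) \<partial>?M) + (\<integral>x. z n x \<partial>?M)" for n
      using z0 mi zi by (simp add: h_def abs_of_nonneg)
    moreover have "(\<lambda>n. \<integral>x. z n x \<partial>?M) \<longlonglongrightarrow> 0"
    proof (rule tendsto_sandwich[OF _ _ tendsto_const])
      show "\<forall>\<^sub>F n in sequentially. 0 \<le> (\<integral>x. z n x \<partial>?M)"
        using z0 by (intro always_eventually allI integral_nonneg_AE) auto
      show "\<forall>\<^sub>F n in sequentially. (\<integral>x. z n x \<partial>?M) \<le> 2 * real m ^ m / (real (n + m) - 1) * C"
        using zb by simp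
      show "(\<lambda>n. 2 * real m ^ m / (real (n + m) - 1) * C) \<longlonglongrightarrow> 0"
      proof -
        have "filterlim (\<lambda>n. - 1 + real (n + m)) at_top sequentially"
          by (intro filterlim_tendsto_add_at_top[OF tendsto_const]
              filterlim_compose[OF filterlim_real_sequentially filterlim_add_const_nat_at_top])
        then have "(\<lambda>n. 2 * real m ^ m / (- 1 + real (n + m))) \<longlonglongrightarrow> 0"
          by (rule tendsto_divide_0[OF tendsto_const filterlim_at_top_imp_at_infinity])
        from tendsto_mult_right[OF this, of C] show ?thesis by (simp add: algebra_simps)
      qed
    qed
    ultimately show ?thesis
      using tendsto_add[OF rellich_in_measure[OF \<Omega>(1,2) u v wc sw Dsq DB]] by simp
  qed
  then obtain r :: "nat \<Rightarrow> nat" where r: "strict_mono r" "AE x in ?M. (\<lambda>n. h (r n) x) \<longlonglongrightarrow> 0"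
    using tendsto_L1_AE_subseq[where u = h, OF hi] by blast
  have wcr: "weak_L1_conv \<Omega> (\<lambda>n. v (r n)) u"
    using wc r(1) unfolding weak_L1_conv_def by (auto intro: LIMSEQ_subseq_LIMSEQ[unfolded o_def])
  \<comment> \<open>The combinations are formed after the extraction, so that they involve only
    terms for which v n and the excess converge at almost every point.\<close>
  obtain l G where lG: "(\<forall>k. tail_weights k (l k)) \<and> integrable (?M) G \<and>
    (AE x in ?M. (\<lambda>k. wsum (l k) (\<lambda>i. D (r i) x)) \<longlonglongrightarrow> G x) \<and>
    (\<forall>k i. weak_deriv \<Omega> (\<lambda>x. u x $ k) i (\<lambda>x. G x $ k $ i))"
    using weak_gradient_limit[of \<Omega> u "\<lambda>n. v (r n)" "\<lambda>n. D (r n)", OF \<Omega>(1,2) u wcr sw Dsq DB]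
    by (elim exE) (rule that)
  have closed: "AE x in ?M. \<forall>t. closed {(u, \<xi>). f x u \<xi> \<le> t}"
    using ni by (simp add: normal_integrand_def)
  have le1: "AE x in ?M. f x (u x) (G x) \<le> 1"
    using closed H1 H2(3) r(2) conjunct1[OF conjunct2[OF conjunct2[OF lG]]]
  proof eventually_elim
    case (elim x)
    have hz: "z (r n) x \<le> h (r n) x" "min 1 (norm (v (r n) x - u x)) \<le> h (r n) x" for n
      using z0[of "r n" x] by (auto simp: h_def)
    have mt: "(\<lambda>n. min 1 (norm (v (r n) x - u x))) \<longlonglongrightarrow> 0"
      by (rule tendsto_sandwich[OF _ _ tendsto_const elim(4)]) (use hz in auto)
    have zt: "(\<lambda>n. z (r n) x) \<longlonglongrightarrow> 0"
      by (rule tendsto_sandwich[OF _ _ tendsto_const elim(4)]) (use hz z0 in auto)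
    have vlim: "(\<lambda>n. v (r n) x) \<longlonglongrightarrow> u x"
    proof (rule LIMSEQ_I)
      fix e :: real assume e: "e > 0"
      have "\<forall>\<^sub>F n in sequentially. min 1 (norm (v (r n) x - u x)) < min 1 e"
        using e by (intro order_tendstoD(2)[OF mt]) auto
      then obtain N where N: "\<And>n. n \<ge> N \<Longrightarrow> min 1 (norm (v (r n) x - u x)) < min 1 e"
        unfolding eventually_sequentially by blast
      have "norm (v (r n) x - u x) < e" if "n \<ge> N" for n using N[OF that] by linarith
      then show "\<exists>N. \<forall>n\<ge>N. norm (v (r n) x - u x) < e" by blast
    qed
    show ?case
    proof (rule level_convex_limit_le_one[where \<alpha> = \<alpha> and \<gamma> = \<gamma> and v = "\<lambda>n. v (r n) x" and \<xi> = "\<lambda>n. D (r n) x" and l = l])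
      fix e :: real assume e: "e > 0"
      \<comment> \<open>The threshold is e^m because z is the m-th power of the excess.\<close>
      have "\<forall>\<^sub>F n in sequentially. z (r n) x < e ^ m"
        using e by (intro order_tendstoD(2)[OF zt]) auto
      then show "\<forall>\<^sub>F n in sequentially. f x (v (r n) x) (D (r n) x) \<le> 1 + e"
      proof eventually_elim
        case (elim n)
        then have "max (F (r n) x - 1) 0 < e"
          unfolding z_def using e power_less_imp_less_base by (metis less_imp_le)
        then show ?case by (simp add: F_def)
      qed
    qed (use elim vlim H2 lG in auto)
  qed
  \<comment> \<open>Coercivity at level 1: where f(x, u, G) \<le> 1, the norm of G is at most this
    radius.\<close>
  define R where "R = (1 / \<alpha>) powr (1 / \<gamma>)"
  have GR: "AE x in ?M. norm (G x) \<le> R"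
    using le1 H2(3)
  proof eventually_elim
    case (elim x)
    then have "\<alpha> * norm (G x) powr \<gamma> \<le> 1" using order_trans by blast
    then have "norm (G x) powr \<gamma> \<le> 1 / \<alpha>" using H2(1) by (simp add: field_simps)
    then have "(norm (G x) powr \<gamma>) powr (1 / \<gamma>) \<le> R"
      unfolding R_def using H2(2) by (intro powr_mono2) auto
    then show ?case using H2(2) by (simp add: powr_powr)
  qed
  have R0: "0 \<le> R" by (simp add: R_def)
  have Gm: "G \<in> borel_measurable (?M)" using lG by auto
  have swG: "weak_deriv \<Omega> (\<lambda>x. u x $ k) i (\<lambda>x. G x $ k $ i)" for k i using lG by blast
  note fin = bounded_weak_gradient_imp_sobolev_inf[OF \<Omega> u Gm R0 GR swG]
  have "AE x in ?M. \<bar>f x (u x) (weak_grad \<Omega> u x)\<bar> \<le> 1"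
    using le1 fin(2) H2(3)
  proof eventually_elim
    case (elim x)
    have "0 \<le> \<alpha> * norm (G x) powr \<gamma>" using H2(1) by simp
    also have "\<dots> \<le> f x (u x) (G x)" using elim by blast
    finally show ?case using elim by simp
  qed
  then show ?thesis using fin(1) by blast
qed

section \<open>The Gamma-limit\<close>

lemma ess_inf_on_le_AE:
  "AE x in lebesgue_on S. ess_inf_on S p \<le> ereal (p x)"
  using esssup_AE[of "\<lambda>x. - ereal (p x)" "lebesgue_on S"]
  unfolding ess_inf_on_def by eventually_elim (simp add: ereal_uminus_le_reorder)

lemma AE_lebesgue_on_subset:
  fixes S T :: "(real^'n) set"
  assumes "AE x in lebesgue_on S. P x" "T \<subseteq> S" "S \<in> sets lebesgue" "T \<in> sets lebesgue"
  shows "AE x in lebesgue_on T. P x"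
  using assms(1) unfolding AE_lebesgue_on_iff[OF assms(3)] AE_lebesgue_on_iff[OF assms(4)]
  by eventually_elim (use assms(2) in auto)

lemma set_nn_integral_lebesgue_on:
  assumes "\<Omega> \<in> sets lebesgue"
  shows "(\<integral>\<^sup>+x\<in>\<Omega>. f x \<partial>lebesgue) = (\<integral>\<^sup>+x. f x \<partial>lebesgue_on \<Omega>)"
  using assms by (simp add: nn_integral_restrict_space)

text \<open>Partial sums of N j + 1 increase strictly and dominate every N k.\<close>

lemma strict_mono_above:
  obtains s :: "nat \<Rightarrow> nat" where "strict_mono s" "\<And>k. N k \<le> s k"
proof
  define s where "s k = (\<Sum>j\<le>k. Suc (N j))" for k
  show "strict_mono s" by (simp add: strict_mono_Suc_iff s_def)
  show "N k \<le> s k" for k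
    using member_le_sum[of k "{..k}" "\<lambda>j. Suc (N j)"] by (simp add: s_def)
qed

text \<open>A finite essential infimum makes its multiple by \<beta>, and with it the essential
  supremum, bounded above. Bounded exponents are what gives bounded functions a finite
  modular.\<close>

lemma AE_bounded_exponent:
  fixes \<Omega> :: "(real^'n) set"
  assumes "open \<Omega>" "0 < \<beta>" and le: "ess_sup_on (closure \<Omega>) p \<le> ereal \<beta> * ess_inf_on (closure \<Omega>) p"
  shows "\<exists>P. AE x in lebesgue_on \<Omega>. p x \<le> P"
proof -
  let ?M = "lebesgue_on \<Omega>"
  have \<Omega>s: "\<Omega> \<in> sets lebesgue" and cs: "closure \<Omega> \<in> sets lebesgue" using assms(1) by auto
  have low: "AE x in ?M. ess_inf_on (closure \<Omega>) p \<le> ereal (p x)"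
    by (rule AE_lebesgue_on_subset[OF ess_inf_on_le_AE closure_subset cs \<Omega>s])
  have up: "AE x in ?M. ereal (p x) \<le> ess_sup_on (closure \<Omega>) p"
    unfolding ess_sup_on_def by (rule AE_lebesgue_on_subset[OF esssup_AE closure_subset cs \<Omega>s])
  show ?thesis
  proof (cases "ess_inf_on (closure \<Omega>) p = \<infinity>")
    case True
    \<comment> \<open>No real value reaches \<infinity>, so \<open>low\<close> fails at every point
      and can hold almost everywhere only on a null domain, where any bound is true.\<close>
    have "AE x in ?M. p x \<le> 0" using low by eventually_elim (simp add: True)
    then show ?thesis by blast
  next
    case False
    then have "ereal \<beta> * ess_inf_on (closure \<Omega>) p \<noteq> \<infinity>"
      using assms(2) by (cases "ess_inf_on (closure \<Omega>) p") auto
    then obtain P where P: "ereal \<beta> * ess_inf_on (closure \<Omega>) p \<le> ereal P"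
      by (cases "ereal \<beta> * ess_inf_on (closure \<Omega>) p") auto
    have "AE x in ?M. p x \<le> P"
      using up
    proof eventually_elim
      case (elim x)
      then have "ereal (p x) \<le> ereal P" using le P order_trans by blast
      then show ?case by simp
    qed
    then show ?thesis by blast
  qed
qed

lemma in_Linf_imp_in_Lp_var:
  assumes "\<Omega> \<in> sets lebesgue" "finite_measure (lebesgue_on \<Omega>)" and h: "in_Linf \<Omega> h"
    and p1: "\<And>x. x \<in> \<Omega> \<Longrightarrow> 1 < p x" and P: "AE x in lebesgue_on \<Omega>. p x \<le> P"
  shows "in_Lp_var \<Omega> p h"
proof -
  let ?M = "lebesgue_on \<Omega>"
  obtain C where C: "AE x in ?M. \<bar>h x\<bar> \<le> C" using h by (auto simp: in_Linf_def)
  \<comment> \<open>At least 1, so that powers of K increase with the exponent and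
    \<open>K powr P\<close> bounds them all.\<close>
  define K where "K = max C 1"
  have sp: "AE x in ?M. x \<in> \<Omega>" by (rule AE_I2) simp
  have "(\<integral>\<^sup>+x. ennreal (\<bar>h x\<bar> powr p x) \<partial>?M) \<le> (\<integral>\<^sup>+x. ennreal (K powr P) \<partial>?M)"
  proof (rule nn_integral_mono_AE, use C P sp in eventually_elim)
    case (elim x)
    have "\<bar>h x\<bar> powr p x \<le> K powr p x" using elim p1[of x] by (intro powr_mono2) (auto simp: K_def)
    also have "\<dots> \<le> K powr P" using elim by (intro powr_mono) (auto simp: K_def)
    finally show ?case by (rule ennreal_leI)
  qed
  also have "\<dots> < \<infinity>"
    using finite_measure.emeasure_finite[OF assms(2)] by (simp add: ennreal_mult_less_top less_top)
  finally show ?thesis using h by (simp add: in_Lp_var_def in_Linf_def set_nn_integral_lebesgue_on[OF assms(1)])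
qed

lemma sobolev_inf_imp_sobolev_var:
  assumes "\<Omega> \<in> sets lebesgue" "finite_measure (lebesgue_on \<Omega>)" and u: "sobolev_inf \<Omega> u"
    and p1: "\<And>x. x \<in> \<Omega> \<Longrightarrow> 1 < p x" and P: "AE x in lebesgue_on \<Omega>. p x \<le> P"
  shows "sobolev_var \<Omega> p u"
  using u in_Linf_imp_in_Lp_var[OF assms(1,2) _ p1 P] unfolding sobolev_inf_def sobolev_var_def by blast

theorem theorem4p4:
  fixes \<Omega> :: "(real^'n) set"
    and p :: "nat \<Rightarrow> real^'n \<Rightarrow> real"
    and f :: "real^'n \<Rightarrow> real^'d \<Rightarrow> real^'n^'d \<Rightarrow> real"
    and \<beta> \<alpha> \<gamma> :: real
  assumes "open \<Omega>" and "bounded \<Omega>" and "lipschitz_boundary \<Omega>"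
    and "\<And>n. p n \<in> borel_measurable (lebesgue_on (closure \<Omega>))"
    and "\<And>n x. x \<in> closure \<Omega> \<Longrightarrow> p n x > 1"
    and "((\<lambda>n. ess_inf_on (closure \<Omega>) (p n)) \<longlongrightarrow> \<infinity>) sequentially"
    and "\<beta> > 1"
    and "\<And>n. ess_sup_on (closure \<Omega>) (p n) \<le> ereal \<beta> * ess_inf_on (closure \<Omega>) (p n)"
    and "normal_integrand \<Omega> f"
    and H1: "AE x in lebesgue_on \<Omega>. \<forall>u. level_convex (f x u)"
    and H2: "\<alpha> > 0" "\<gamma> > 0"
      "AE x in lebesgue_on \<Omega>. \<forall>u \<xi>. f x u \<xi> \<ge> \<alpha> * norm \<xi> powr \<gamma>"
  shows "(\<forall>u us. in_L1 \<Omega> u \<and> (\<forall>n. in_L1 \<Omega> (us n)) \<and> weak_L1_conv \<Omega> us u \<longrightarrow>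
            Finf \<Omega> f u \<le> liminf (\<lambda>n. Fn \<Omega> f (p n) (us n)))
       \<and> (\<forall>u. in_L1 \<Omega> u \<longrightarrow>
            (\<exists>us. (\<forall>n. in_L1 \<Omega> (us n)) \<and> strong_L1_conv \<Omega> us u \<and>
                  limsup (\<lambda>n. Fn \<Omega> f (p n) (us n)) \<le> Finf \<Omega> f u))"
proof (intro conjI allI impI)
  let ?M = "lebesgue_on \<Omega>"
  have \<Omega>s: "\<Omega> \<in> sets lebesgue" and cs: "closure \<Omega> \<in> sets lebesgue" using assms(1) by auto
  have fm: "finite_measure (?M)"
    using assms(1,2) by (intro finite_measure_lebesgue_on bounded_set_imp_lmeasurable) auto
  have pm: "p n \<in> borel_measurable (?M)" for n
    by (rule measurable_restrict_mono[OF assms(4)[of n] closure_subset])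
  have p1: "1 < p n x" if "x \<in> \<Omega>" for n x using assms(5)[of x n] that closure_subset by blast
  have plow: "AE x in ?M. c \<le> p n x" if "ereal c < ess_inf_on (closure \<Omega>) (p n)" for n c
    using AE_lebesgue_on_subset[OF ess_inf_on_le_AE[of "closure \<Omega>" "p n"] closure_subset cs \<Omega>s]
    by eventually_elim (use that in \<open>auto dest: less_le_trans\<close>)
  have pinf: "eventually (\<lambda>n. AE x in ?M. c \<le> p n x) sequentially" for c
  proof -
    have "eventually (\<lambda>n. ereal c < ess_inf_on (closure \<Omega>) (p n)) sequentially"
      by (rule order_tendstoD(1)[OF assms(6)]) simp
    then show ?thesis by eventually_elim (rule plow)
  qed
  {
    fix u and us :: "nat \<Rightarrow> real^'n \<Rightarrow> real^'d"
    assume a: "in_L1 \<Omega> u \<and> (\<forall>n. in_L1 \<Omega> (us n)) \<and> weak_L1_conv \<Omega> us u"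
    show "Finf \<Omega> f u \<le> liminf (\<lambda>n. Fn \<Omega> f (p n) (us n))"
    proof (cases "liminf (\<lambda>n. Fn \<Omega> f (p n) (us n)) = \<infinity>")
      case False
      then obtain c where c: "liminf (\<lambda>n. Fn \<Omega> f (p n) (us n)) = ennreal c" "0 \<le> c"
        by (cases "liminf (\<lambda>n. Fn \<Omega> f (p n) (us n))") auto
      \<comment> \<open>Any level strictly above the lower limit is undercut infinitely
        often.\<close>
      define C where "C = c + 1"
      have C: "liminf (\<lambda>n. Fn \<Omega> f (p n) (us n)) < ennreal C" "0 \<le> C"
        using c by (simp_all add: C_def ennreal_lessI)
      have "frequently (\<lambda>n. Fn \<Omega> f (p n) (us n) < ennreal C) sequentially"
      proof (rule ccontr)
        assume "\<not> ?thesis"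
        then have "\<forall>\<^sub>F n in sequentially. ennreal C \<le> Fn \<Omega> f (p n) (us n)"
          by (simp add: frequently_def not_less)
        then have "ennreal C \<le> liminf (\<lambda>n. Fn \<Omega> f (p n) (us n))" by (rule Liminf_bounded)
        then show False using C(1) by simp
      qed
      then have "infinite {n. Fn \<Omega> f (p n) (us n) < ennreal C}"
        by (simp add: frequently_cofinite flip: cofinite_eq_sequentially)
      then obtain r :: "nat \<Rightarrow> nat" where r: "strict_mono r" "\<And>n. Fn \<Omega> f (p (r n)) (us (r n)) < ennreal C"
        using infinite_enumerate by blast
      \<comment> \<open>The power m must be at least 2 for the excess estimate and satisfy \<gamma>
        m \<ge> 2 for control of the squared gradient.\<close>
      obtain m' :: nat where m': "2 / \<gamma> \<le> real m'" using real_arch_simple by blast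
      define m where "m = max m' 2"
      have m: "2 \<le> m" "2 \<le> \<gamma> * real m"
      proof -
        have "2 / \<gamma> \<le> real m" using m' by (simp add: m_def)
        then show "2 \<le> \<gamma> * real m" using H2(2) by (simp add: field_simps)
      qed (simp add: m_def)
      \<comment> \<open>The essential infima tend to infinity, so beyond some N k the exponent is at
        least k + m almost everywhere. Thinning the subsequence past these thresholds gives the
        growth that \<open>bounded_energy_limit\<close> asks for.\<close>
      have "\<exists>N. \<forall>n\<ge>N. AE x in ?M. real (k + m) \<le> p n x" for k
        using pinf[of "real (k + m)"] unfolding eventually_sequentially .
      then obtain N where N: "\<And>k n. N k \<le> n \<Longrightarrow> AE x in ?M. real (k + m) \<le> p n x"
        by metis
      obtain s where s: "strict_mono s" "\<And>k. N k \<le> s k" using strict_mono_above[of N] by blast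
      define w where "w k = r (s k)" for k
      have sw: "strict_mono w" using strict_mono_o[OF r(1) s(1)] by (simp add: w_def[abs_def] o_def)
      have Nw: "N k \<le> w k" for k using s(2)[of k] seq_suble[OF r(1), of "s k"] by (simp add: w_def)
      have FC: "Fn \<Omega> f (p (w k)) (us (w k)) < ennreal C" for k unfolding w_def by (rule r(2))
      have sob: "sobolev_var \<Omega> (p (w k)) (us (w k))" for k
        using FC[of k] by (auto simp: Fn_def split: if_splits)
      have E: "(\<integral>\<^sup>+x. ennreal ((1 / p (w k) x) * f x (us (w k) x) (weak_grad \<Omega> (us (w k)) x) powr p (w k) x) \<partial>?M) \<le> ennreal C" for k
        using FC[of k] sob[of k] by (simp add: Fn_def set_nn_integral_lebesgue_on[OF \<Omega>s])
      have wc: "weak_L1_conv \<Omega> (\<lambda>k. us (w k)) u"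
        using a sw unfolding weak_L1_conv_def by (auto intro: LIMSEQ_subseq_LIMSEQ[unfolded o_def])
      have "sobolev_inf \<Omega> u \<and> (AE x in ?M. \<bar>f x (u x) (weak_grad \<Omega> u x)\<bar> \<le> 1)"
        by (rule bounded_energy_limit[where q = "\<lambda>k. p (w k)" and v = "\<lambda>k. us (w k)" and m = m and C = C,
              OF assms(1-3,9) H1 H2])
          (use a wc sob pm m N Nw C(2) E in auto)
      then show ?thesis by (simp add: Finf_def)
    qed simp
  next
    fix u :: "real^'n \<Rightarrow> real^'d"
    assume u: "in_L1 \<Omega> u"
    show "\<exists>us. (\<forall>n. in_L1 \<Omega> (us n)) \<and> strong_L1_conv \<Omega> us u \<and>
                  limsup (\<lambda>n. Fn \<Omega> f (p n) (us n)) \<le> Finf \<Omega> f u"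
    proof (intro exI[of _ "\<lambda>_. u"] conjI allI u)
      show "strong_L1_conv \<Omega> (\<lambda>_. u) u" by (simp add: strong_L1_conv_def set_lebesgue_integral_def)
      show "limsup (\<lambda>n. Fn \<Omega> f (p n) u) \<le> Finf \<Omega> f u"
      proof (cases "sobolev_inf \<Omega> u \<and> (AE x in ?M. \<bar>f x (u x) (weak_grad \<Omega> u x)\<bar> \<le> 1)")
        case False
        then have "Finf \<Omega> f u = \<infinity>" by (auto simp: Finf_def)
        then show ?thesis by simp
      next
        case True
        \<comment> \<open>Finiteness of the energies starts here: a function with bounded values and
          bounded gradient lies in every W^{1,p_n}, because each p n is essentially bounded.\<close>
        have sob: "sobolev_var \<Omega> (p n) u" for n
        proof -
          obtain P where "AE x in ?M. p n x \<le> P"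
            using AE_bounded_exponent[OF assms(1) _ assms(8)[of n]] assms(7) by auto
          then show ?thesis
            using True p1 by (intro sobolev_inf_imp_sobolev_var[OF \<Omega>s fm]) auto
        qed
        have "limsup (\<lambda>n. Fn \<Omega> f (p n) u) \<le> 0"
        proof (rule ennreal_le_epsilon)
          fix e :: real assume e: "0 < e"
          define \<mu> where "\<mu> = measure (?M) (space (?M))"
          have \<mu>: "0 \<le> \<mu>" by (simp add: \<mu>_def)
          \<comment> \<open>Makes \<mu>/c = e \<mu>/(\<mu> + 1) at most e, and c positive even if
            \<Omega> is a null set.\<close>
          define c where "c = (\<mu> + 1) / e"
          have c: "c > 0" using e \<mu> by (simp add: c_def)
          have "\<forall>\<^sub>F n in sequentially. Fn \<Omega> f (p n) u \<le> ennreal e"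
            using pinf[of c]
          proof eventually_elim
            case (elim n)
            have "Fn \<Omega> f (p n) u = (\<integral>\<^sup>+x. ennreal ((1 / p n x) * f x (u x) (weak_grad \<Omega> u x) powr p n x) \<partial>?M)"
              using sob[of n] by (simp add: Fn_def set_nn_integral_lebesgue_on[OF \<Omega>s])
            also have "\<dots> \<le> (\<integral>\<^sup>+x. ennreal (1 / c) \<partial>?M)"
            proof (rule nn_integral_mono_AE, use elim conjunct2[OF True] H2(3) in eventually_elim)
              case (elim x)
              have "0 \<le> \<alpha> * norm (weak_grad \<Omega> u x) powr \<gamma>" using H2(1) by simp
              also have "\<dots> \<le> f x (u x) (weak_grad \<Omega> u x)" using elim by blast
              finally have "f x (u x) (weak_grad \<Omega> u x) powr p n x \<le> 1 powr p n x"
                using elim c by (intro powr_mono2) auto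
              then have "(1 / p n x) * f x (u x) (weak_grad \<Omega> u x) powr p n x \<le> (1 / c) * 1"
                using elim c by (intro mult_mono divide_left_mono) auto
              then show ?case by (intro ennreal_leI) simp
            qed
            also have "\<dots> = ennreal (1 / c) * ennreal \<mu>"
              using finite_measure.emeasure_eq_measure[OF fm] by (simp add: \<mu>_def)
            also have "\<dots> = ennreal (\<mu> / c)" using c \<mu> by (simp add: ennreal_mult[symmetric])
            also have "\<dots> \<le> ennreal e"
              using e \<mu> by (intro ennreal_leI) (simp add: c_def field_simps)
            finally show ?case .
          qed
          then show "limsup (\<lambda>n. Fn \<Omega> f (p n) u) \<le> 0 + ennreal e"
            by (intro Limsup_bounded) simp
        qed
        then show ?thesis using True by (simp add: Finf_def)
      qed
    qed
  }
qed

end
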